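(* Let $\gamma=\frac{\sqrt5+1}{2}$, let $T$ be the uniform random spanning tree of the helix-3-graph $G^{H_3}$, and let $Y_n=\big(\mathbf{1}_{\{h_n\in T\}},\mathbf{1}_{\{z_n\in T\}},i(T,n)\big)$, $n\in\mathbb{Z}$, with $i(T,n)\in\{1,\dots,5\}$ the connectivity type of $T$ restricted to $\{\dots,n-1,n\}$. Then the process $Y=(Y_n)_{n\in\mathbb{Z}}$ is a stationary Markov chain on $\Delta=\{\delta_1,\dots,\delta_{11}\}$ with transition matrix $R=(R_{k,l})_{k,l=1,\dots,11}$ whose nonzero entries are as follows: - for $k\in\{1,2,3\}$: $R_{k,1}=R_{k,2}=\bar R_{1,1}/2$, $R_{k,4}=1-\bar R_{1,1}$; - for $k\in\{4,5\}$: $R_{k,3}=\bar R_{2,1}$, $R_{k,6}=\bar R_{2,3}$, $R_{k,9}=\bar R_{2,4}$, $R_{k,10}=1-\bar R_{2,1}-\bar R_{2,3}-\bar R_{2,4}$; - for $k\in\{6,7,8\}$: $R_{k,3}=\bar R_{3,1}$, $R_{k,5}=1-\bar R_{3,1}$; - for $k=9$: $R_{9,6}=R_{9,7}=\bar R_{4,3}/2$, $R_{9,10}=1-\bar R_{4,3}$; - for $k\in\{10,11\}$: $R_{k,8}=\bar R_{5,3}$, $R_{k,11}=1-\bar R_{5,3}$; where $$\bar R_{1,1}=2(\gamma-\sqrt\gamma),\quad \bar R_{2,1}=\frac{\sqrt\gamma}{2+\sqrt\gamma},\quad \bar R_{2,3}=\frac{\gamma-1/\sqrt\gamma}{2+\sqrt\gamma},\quad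 \bar R_{2,4}=\frac{2-\sqrt\gamma}{2+\sqrt\gamma},$$ $$\bar R_{3,1}=\frac{\gamma^{3/2}-1}{2},\quad \bar R_{4,3}=\frac{2\sqrt5\,\gamma-2\gamma^{5/2}}{2-\sqrt\gamma},\quad \bar R_{5,3}=1-\frac{1}{\gamma+\sqrt\gamma}.$$ The invariant distribution is $$\begin{aligned}\pi^R=\frac{1}{4\sqrt5}\Big(&\gamma,\ \gamma,\ \gamma^{3/2}-\gamma^{-1},\ \gamma^{3/2}-\gamma^{-1},\ 3\gamma^{-1}-\gamma^{1/2},\ 2\gamma-2\gamma^{1/2},\\ &\sqrt5-\gamma^{3/2},\ \sqrt5\,\gamma^{3/2}-\gamma^3,\ 2\gamma^{-1}-\gamma^{-1/2},\ \sqrt5\,\gamma^{3/2}-\gamma^3,\ \gamma^4-2\gamma^{5/2}\Big),\end{aligned}$$ and the entropy is $$H^R=-\sum_{k,l=1}^{11}\pi^R_k\,R_{k,l}\log(R_{k,l})=\log\big(\gamma+\sqrt\gamma\,\big).$$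
   Context: Helix-3-graph $G^{H_3}$: vertex set $\mathbb{Z}$, edges $z_m=\{m-1,m\}$ and $h_m=\{m-3,m\}$ for $m\in\mathbb{Z}$. The uniform spanning tree measure on $G^{H_3}$ is the limit as $n\to\infty$ of the uniform distributions on the spanning trees of the subgraph induced by $\{-n,\dots,n\}$ (the limit exists, in the sense of convergence of probabilities of events depending on finitely many edges, and is concentrated on spanning trees of $G^{H_3}$). Connectivity type: for a spanning tree $t$ of $G^{H_3}$ and $n\in\mathbb{Z}$, consider the forest on the vertex set $\{n,n-1,n-2,\dots\}$ formed by the edges of $t$ with both endpoints in this set; each of its components contains at least one of $n,n-1,n-2$. Then $i(t,n)$ is - $1$ if it is connected (a spanning tree); - $2$ if it has two components, one containing $n$ and the other containing $n-1,n-2$; - $3$ if it has two components, one containing $n-2$ and the other containing $n,n-1$; - $4$ if it has two components, one containing $n-1$ and the other containing $n,n-2$; - $5$ if it has three components, each containing exactly one of $n,n-1,n-2$. States: $\delta_1=(0,1,1)$, $\delta_2=(1,0,1)$, $\delta_3=(1,1,1)$, $\delta_4=(0,0,2)$, $\delta_5=(1,0,2)$, $\delta_6=(0,1,3)$, $\delta_7=(1,0,3)$, $\delta_8=(1,1,3)$, $\delta_9=(1,0,4)$, $\delta_{10}=(0,0,5)$, $\delta_{11}=(1,0,5)$. $R_{k,l}$ is the transition probability from $\delta_k$ to $\delta_l$, and $\pi^R_k$ the invariant probability of $\delta_k$. Convention: $0\log 0=0$. *)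

theory Defs
  imports "HOL-Probability.Probability"
begin

section \<open>Undirected simple graphs\<close>

text \<open>
  A graph is given by a vertex set \<open>V\<close> and a set \<open>E\<close> of two-element subsets of \<open>V\<close>.
\<close>

definition graph_reachable :: "'a set set \<Rightarrow> ('a \<times> 'a) set" where
  "graph_reachable E = {(u, v). {u, v} \<in> E}\<^sup>*"

definition graph_connected :: "'a set \<Rightarrow> 'a set set \<Rightarrow> bool" where
  "graph_connected V E \<longleftrightarrow> V \<noteq> {} \<and> (\<forall>u\<in>V. \<forall>v\<in>V. (u, v) \<in> graph_reachable E)"

definition graph_cycle :: "'a set set \<Rightarrow> 'a list \<Rightarrow> bool" where
  "graph_cycle E c \<longleftrightarrow> length c \<ge> 3 \<and> distinct c \<and>
     (\<forall>i<length c. {c ! i, c ! (Suc i mod length c)} \<in> E)"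

definition spanning_trees :: "'a set \<Rightarrow> 'a set set \<Rightarrow> 'a set set set" where
  "spanning_trees V E = {t. t \<subseteq> E \<and> graph_connected V t \<and> (\<nexists>c. graph_cycle t c)}"

definition induced_edges :: "'a set set \<Rightarrow> 'a set \<Rightarrow> 'a set set" where
  "induced_edges E W = {e \<in> E. e \<subseteq> W}"

definition graph_components :: "'a set \<Rightarrow> 'a set set \<Rightarrow> 'a set set" where
  "graph_components V E = V // (graph_reachable E \<inter> V \<times> V)"


section \<open>The helix-3-graph and its uniform spanning tree\<close>

definition z_edge :: "int \<Rightarrow> int set" where
  "z_edge m = {m - 1, m}"

definition h_edge :: "int \<Rightarrow> int set" where
  "h_edge m = {m - 3, m}"

definition helix_edges :: "int set set" where
  "helix_edges = range z_edge \<union> range h_edge"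

definition helix_box :: "nat \<Rightarrow> int set" where
  "helix_box n = {- int n..int n}"

definition finite_ust :: "nat \<Rightarrow> int set set pmf" where
  "finite_ust n = pmf_of_set (spanning_trees (helix_box n) (induced_edges helix_edges (helix_box n)))"

text \<open>The sigma-algebra generated by the events \<open>e \<in> t\<close>, where \<open>e\<close> is an edge.\<close>

definition edge_space :: "int set set measure" where
  "edge_space = sigma (Pow helix_edges) ((\<lambda>e. {t \<in> Pow helix_edges. e \<in> t}) ` helix_edges)"

text \<open>
  \<open>T\<close> has the law of the uniform spanning tree: an event depending only on the edges
  in a finite set \<open>F\<close> has the form \<open>t \<inter> F \<in> A\<close> with \<open>A \<subseteq> Pow F\<close>, and its probability is the
  limit of its probabilities under the uniform distributions on the spanning trees of the boxes.
\<close>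

definition uniform_random_spanning_tree :: "'w measure \<Rightarrow> ('w \<Rightarrow> int set set) \<Rightarrow> bool" where
  "uniform_random_spanning_tree M T \<longleftrightarrow> prob_space M \<and> T \<in> measurable M edge_space \<and>
     (\<forall>F A. finite F \<and> F \<subseteq> helix_edges \<and> A \<subseteq> Pow F \<longrightarrow>
        (\<lambda>n. measure_pmf.prob (finite_ust n) {t. t \<inter> F \<in> A})
          \<longlonglongrightarrow> measure M {\<omega> \<in> space M. T \<omega> \<inter> F \<in> A})"

text \<open>
  The five cases are mutually exclusive, and one of them applies whenever \<open>t\<close> is a spanning tree
  of the helix-3-graph; the value 0 is a dummy for other edge sets \<open>t\<close>.
\<close>

definition connectivity_type :: "int set set \<Rightarrow> int \<Rightarrow> nat" where
  "connectivity_type t n =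
     (let E = induced_edges t {..n}; C = graph_components {..n} E in
      if graph_connected {..n} E then 1
      else if card C = 2 \<and> (\<exists>A\<in>C. \<exists>B\<in>C. A \<noteq> B \<and> n \<in> A \<and> n - 1 \<in> B \<and> n - 2 \<in> B) then 2
      else if card C = 2 \<and> (\<exists>A\<in>C. \<exists>B\<in>C. A \<noteq> B \<and> n - 2 \<in> A \<and> n \<in> B \<and> n - 1 \<in> B) then 3
      else if card C = 2 \<and> (\<exists>A\<in>C. \<exists>B\<in>C. A \<noteq> B \<and> n - 1 \<in> A \<and> n \<in> B \<and> n - 2 \<in> B) then 4
      else if card C = 3 \<and> (\<forall>A\<in>C. card (A \<inter> {n, n - 1, n - 2}) = 1) then 5
      else 0)"

definition helix_process :: "('w \<Rightarrow> int set set) \<Rightarrow> int \<Rightarrow> 'w \<Rightarrow> nat \<times> nat \<times> nat" where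
  "helix_process T n \<omega> =
     (of_bool (h_edge n \<in> T \<omega>), of_bool (z_edge n \<in> T \<omega>), connectivity_type (T \<omega>) n)"


section \<open>Stationary Markov chains on a finite state space\<close>

text \<open>
  The states are enumerated as \<open>s k\<close> for \<open>k \<in> I\<close>; matrices and distributions are indexed by \<open>I\<close>.
\<close>

definition stochastic_matrix :: "'i set \<Rightarrow> ('i \<Rightarrow> 'i \<Rightarrow> real) \<Rightarrow> bool" where
  "stochastic_matrix I P \<longleftrightarrow> (\<forall>k\<in>I. (\<forall>l\<in>I. P k l \<ge> 0) \<and> (\<Sum>l\<in>I. P k l) = 1)"

definition invariant_distribution :: "'i set \<Rightarrow> ('i \<Rightarrow> 'i \<Rightarrow> real) \<Rightarrow> ('i \<Rightarrow> real) \<Rightarrow> bool" where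
  "invariant_distribution I P \<rho> \<longleftrightarrow>
     (\<forall>k\<in>I. \<rho> k \<ge> 0) \<and> (\<Sum>k\<in>I. \<rho> k) = 1 \<and> (\<forall>l\<in>I. (\<Sum>k\<in>I. \<rho> k * P k l) = \<rho> l)"

definition stationary_process :: "'w measure \<Rightarrow> (int \<Rightarrow> 'w \<Rightarrow> 's) \<Rightarrow> bool" where
  "stationary_process M X \<longleftrightarrow>
     (\<forall>J x c. finite J \<longrightarrow>
        \<P>(\<omega> in M. \<forall>j\<in>J. X (j + c) \<omega> = x j) = \<P>(\<omega> in M. \<forall>j\<in>J. X j \<omega> = x j))"

definition markov_property ::
  "'w measure \<Rightarrow> (int \<Rightarrow> 'w \<Rightarrow> 's) \<Rightarrow> 'i set \<Rightarrow> ('i \<Rightarrow> 's) \<Rightarrow> ('i \<Rightarrow> 'i \<Rightarrow> real) \<Rightarrow> bool" where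
  "markov_property M X I s P \<longleftrightarrow>
     (\<forall>n m x. \<forall>k\<in>I. \<forall>l\<in>I. x n = s k \<longrightarrow>
        \<P>(\<omega> in M. \<forall>j\<in>{n - int m..n}. X j \<omega> = x j) > 0 \<longrightarrow>
        \<P>(\<omega> in M. X (n + 1) \<omega> = s l \<bar> \<forall>j\<in>{n - int m..n}. X j \<omega> = x j) = P k l)"

definition stationary_markov_chain ::
  "'w measure \<Rightarrow> (int \<Rightarrow> 'w \<Rightarrow> 's) \<Rightarrow> 'i set \<Rightarrow> ('i \<Rightarrow> 's) \<Rightarrow> ('i \<Rightarrow> 'i \<Rightarrow> real) \<Rightarrow> bool" where
  "stationary_markov_chain M X I s P \<longleftrightarrow>
     prob_space M \<and> finite I \<and> inj_on s I \<and> stochastic_matrix I P \<and>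
     (\<forall>n. X n \<in> measurable M (count_space UNIV)) \<and>
     (\<forall>n. AE \<omega> in M. X n \<omega> \<in> s ` I) \<and>
     stationary_process M X \<and> markov_property M X I s P"


section \<open>The states, the transition matrix and the invariant distribution\<close>

definition gam :: real where
  "gam = (sqrt 5 + 1) / 2"

text \<open>\<open>\<delta> k\<close> is meaningful for \<open>1 \<le> k \<le> 11\<close> only, and likewise for \<open>\<pi>R k\<close> below.\<close>

definition \<delta> :: "nat \<Rightarrow> nat \<times> nat \<times> nat" where
  "\<delta> k = [(0,1,1), (1,0,1), (1,1,1), (0,0,2), (1,0,2), (0,1,3), (1,0,3), (1,1,3),
          (1,0,4), (0,0,5), (1,0,5)] ! (k - 1)"

definition Rbar11 :: real where "Rbar11 = 2 * (gam - sqrt gam)"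
definition Rbar21 :: real where "Rbar21 = sqrt gam / (2 + sqrt gam)"
definition Rbar23 :: real where "Rbar23 = (gam - 1 / sqrt gam) / (2 + sqrt gam)"
definition Rbar24 :: real where "Rbar24 = (2 - sqrt gam) / (2 + sqrt gam)"
definition Rbar31 :: real where "Rbar31 = (gam powr (3/2) - 1) / 2"
definition Rbar43 :: real where
  "Rbar43 = (2 * sqrt 5 * gam - 2 * gam powr (5/2)) / (2 - sqrt gam)"
definition Rbar53 :: real where "Rbar53 = 1 - 1 / (gam + sqrt gam)"

definition R_mat :: "nat \<Rightarrow> nat \<Rightarrow> real" where
  "R_mat k l =
    (if k \<in> {1,2,3} then
       (if l = 1 \<or> l = 2 then Rbar11 / 2 else if l = 4 then 1 - Rbar11 else 0)
     else if k \<in> {4,5} then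
       (if l = 3 then Rbar21 else if l = 6 then Rbar23 else if l = 9 then Rbar24
        else if l = 10 then 1 - Rbar21 - Rbar23 - Rbar24 else 0)
     else if k \<in> {6,7,8} then
       (if l = 3 then Rbar31 else if l = 5 then 1 - Rbar31 else 0)
     else if k = 9 then
       (if l = 6 \<or> l = 7 then Rbar43 / 2 else if l = 10 then 1 - Rbar43 else 0)
     else if k \<in> {10,11} then
       (if l = 8 then Rbar53 else if l = 11 then 1 - Rbar53 else 0)
     else 0)"

definition R_nonzero_positions :: "(nat \<times> nat) set" where
  "R_nonzero_positions =
     {1,2,3} \<times> {1,2,4} \<union> {4,5} \<times> {3,6,9,10} \<union> {6,7,8} \<times> {3,5} \<union>
     {9} \<times> {6,7,10} \<union> {10,11} \<times> {8,11}"

definition \<pi>R :: "nat \<Rightarrow> real" where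
  "\<pi>R k = 1 / (4 * sqrt 5) *
    [gam, gam, gam powr (3/2) - gam powr (-1), gam powr (3/2) - gam powr (-1),
     3 * gam powr (-1) - gam powr (1/2), 2 * gam - 2 * gam powr (1/2),
     sqrt 5 - gam powr (3/2), sqrt 5 * gam powr (3/2) - gam ^ 3,
     2 * gam powr (-1) - gam powr (-1/2), sqrt 5 * gam powr (3/2) - gam ^ 3,
     gam ^ 4 - 2 * gam powr (5/2)] ! (k - 1)"

end

theory Submission
  imports Defs
begin

text \<open>
  Cut a spanning tree at a vertex \<open>m\<close>. The part on the vertices up to \<open>m\<close>
  is a forest, and since later vertices are joined to it only through the window \<open>m\<close>, \<open>m - 1\<close>,
  \<open>m - 2\<close>, each of its components meets the window. All that matters for the continuation is the
  partition of the window into components, the connectivity type. The new vertex \<open>m + 1\<close> can be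
  attached by \<open>h\<^bsub>m+1\<^esub>\<close> to \<open>m - 2\<close> and by \<open>z\<^bsub>m+1\<^esub>\<close> to \<open>m\<close>; whether a choice of these two edges
  closes a cycle or strands the component of \<open>m - 2\<close>, which leaves the window, and what the new
  type is, depends on the old type alone. So reading the pairs (\<open>h\<close>-edge present, \<open>z\<close>-edge present)
  from left to right is a run of a deterministic automaton with five live states, and the spanning
  trees of a box correspond to the words that lead from an initial type to type 1
  (\<open>spanning_tree_iff_run\<close>).

  The uniform spanning tree of a box is thus a uniform accepted word, and the infinite limit is the
  measure of maximal entropy of the automaton: with \<open>\<lambda> = \<gamma> + \<surd>\<gamma>\<close> the Perron eigenvalue of its transfer
  matrix and \<open>v\<close> the positive right eigenvector, a word \<open>w\<close> that leads from type \<open>i\<close> to type \<open>j\<close> has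
  probability \<open>v\<^sub>j / (\<lambda>\<^bsup>|w|\<^esup> v\<^sub>i)\<close> given type \<open>i\<close>. For words of length one this is the matrix \<open>R\<close>. Everything
  is a polynomial in \<open>s = \<surd>\<gamma>\<close> modulo \<open>s\<^sup>4 = s\<^sup>2 + 1\<close>. The entropy is \<open>log \<lambda>\<close> because
  \<open>- log R\<^sub>k\<^sub>l = log \<lambda> + log v\<^sub>k - log v\<^sub>l\<close> and the last two terms cancel in the stationary mean.

  Both the limit of the boxes and the passage to infinitely many vertices rest on resets. From every
  type some word of length four, of probability at least \<open>1 / \<lambda>\<^sup>4\<close>, leads to type 1; by Doeblin's argument
  the chain of types forgets its start geometrically fast (\<open>average_tendsto\<close>), which gives the law of
  the edges in a finite region (\<open>finite_ust_word_tendsto\<close>) and the uniqueness of the invariant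
  distribution. These words end with two consecutive \<open>z\<close>-edges, which join three consecutive vertices.
  In the infinite tree such pairs occur arbitrarily far in the past almost surely, and each of them
  forces the type to be 1. Therefore the type, although it depends on infinitely many edges, is almost
  surely a function of finitely many (\<open>anchor_has_type\<close>, \<open>regular_connectivity_type\<close>); its joint law
  with the subsequent edges (\<open>prob_ctype_word\<close>) then yields stationarity, the Markov property and the
  marginals.
\<close>

section \<open>The automaton of connectivity types\<close>

text \<open>
  A letter says whether the \<open>h\<close>-edge and the \<open>z\<close>-edge of the new vertex are present. The dead state 0
  is entered if the two edges close a cycle (types 1 and 4, where the oldest vertex \<open>m - 2\<close> of the
  window is connected to \<open>m\<close>) or if the \<open>h\<close>-edge is absent and \<open>m - 2\<close> is alone in its part of the
  window (types 3 and 5), so that its component loses contact with all later vertices.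
\<close>

definition step :: "nat \<Rightarrow> bool \<times> bool \<Rightarrow> nat" where
  "step i l =
    (if i = 1 then (case l of (False, False) \<Rightarrow> 2 | (True, True) \<Rightarrow> 0 | _ \<Rightarrow> 1)
     else if i = 2 then
       (case l of (False, False) \<Rightarrow> 5 | (False, True) \<Rightarrow> 3 | (True, False) \<Rightarrow> 4 | (True, True) \<Rightarrow> 1)
     else if i = 3 then (case l of (True, False) \<Rightarrow> 2 | (True, True) \<Rightarrow> 1 | _ \<Rightarrow> 0)
     else if i = 4 then (case l of (False, False) \<Rightarrow> 5 | (True, True) \<Rightarrow> 0 | _ \<Rightarrow> 3)
     else if i = 5 then (case l of (True, False) \<Rightarrow> 5 | (True, True) \<Rightarrow> 3 | _ \<Rightarrow> 0)
     else 0)"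

definition run :: "nat \<Rightarrow> (bool \<times> bool) list \<Rightarrow> nat" where
  "run = foldl step"

lemma run_simps [simp]: "run i [] = i" "run i (l # w) = run (step i l) w"
  "run i (u @ w) = run (run i u) w"
  by (simp_all add: run_def)

lemma step_0 [simp]: "step 0 l = 0"
  by (simp add: step_def)

lemma run_0 [simp]: "run 0 w = 0"
  by (induction w) simp_all

lemma step_le_5: "step i l \<le> 5"
  by (cases l) (simp add: step_def split: bool.splits)

lemma run_le_5: "i \<le> 5 \<Longrightarrow> run i w \<le> 5"
  by (induction w arbitrary: i) (simp_all add: step_le_5)

lemma run_nonzero_iff: "i \<in> {1..5} \<Longrightarrow> run i w \<noteq> 0 \<longleftrightarrow> run i w \<in> {1..5}"
  using run_le_5[of i w] by auto

lemma types_cases: "i \<in> {1..5} \<longleftrightarrow> i = 1 \<or> i = 2 \<or> i = 3 \<or> i = 4 \<or> i = (5::nat)"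
  by auto

lemma sum_types: "(\<Sum>i\<in>{1..5}. f i) = f 1 + f 2 + f 3 + f 4 + f (5::nat)"
proof -
  have "{1..5::nat} = {1,2,3,4,5}" by auto
  thus ?thesis by (simp add: add_ac)
qed

section \<open>Reachability and cycles after adding a vertex\<close>

lemma reachable_refl [simp]: "(x, x) \<in> graph_reachable E"
  by (simp add: graph_reachable_def)

lemma reachable_edge: "{x, y} \<in> E \<Longrightarrow> (x, y) \<in> graph_reachable E"
  by (auto simp: graph_reachable_def)

lemma reachable_trans:
  "(x, y) \<in> graph_reachable E \<Longrightarrow> (y, z) \<in> graph_reachable E \<Longrightarrow> (x, z) \<in> graph_reachable E"
  unfolding graph_reachable_def by (rule rtrancl_trans)

lemma reachable_sym: "(x, y) \<in> graph_reachable E \<Longrightarrow> (y, x) \<in> graph_reachable E"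
proof -
  have "sym {(u, v). {u, v} \<in> E}" by (auto simp: sym_def insert_commute)
  thus "(x, y) \<in> graph_reachable E \<Longrightarrow> (y, x) \<in> graph_reachable E"
    unfolding graph_reachable_def by (meson sym_rtrancl symE)
qed

lemma reachable_mono: "E \<subseteq> F \<Longrightarrow> (x, y) \<in> graph_reachable E \<Longrightarrow> (x, y) \<in> graph_reachable F"
  unfolding graph_reachable_def by (erule rtrancl_mono[THEN subsetD, rotated]) auto

text \<open>
  A walk through the new vertex \<open>v\<close> can be cut at its visits to \<open>v\<close>; before the first and after the
  last visit it stays in the old graph and enters or leaves \<open>v\<close> through a neighbour.
\<close>

lemma reachable_new_vertex:
  assumes v: "v \<notin> \<Union>F" "v \<notin> N" and x: "x \<noteq> v"
  defines "F' \<equiv> F \<union> (\<lambda>u. {u, v}) ` N"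
  shows "(x, v) \<in> graph_reachable F' \<longleftrightarrow> (\<exists>u\<in>N. (x, u) \<in> graph_reachable F)"
    and "y \<noteq> v \<Longrightarrow> (x, y) \<in> graph_reachable F' \<longleftrightarrow> (x, y) \<in> graph_reachable F \<or>
      (\<exists>u\<in>N. \<exists>w\<in>N. (x, u) \<in> graph_reachable F \<and> (w, y) \<in> graph_reachable F)"
proof -
  let ?P = "\<lambda>y. if y = v then \<exists>u\<in>N. (x, u) \<in> graph_reachable F
    else (x, y) \<in> graph_reachable F \<or>
      (\<exists>u\<in>N. \<exists>w\<in>N. (x, u) \<in> graph_reachable F \<and> (w, y) \<in> graph_reachable F)"
  \<comment> \<open>The case distinction on the endpoint makes both claims a single induction along the walk.\<close>
  have forward: "?P y" if "(x, y) \<in> graph_reachable F'" for y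
    using that[unfolded graph_reachable_def]
  proof (induction rule: rtrancl_induct)
    case base
    show ?case using x by simp
  next
    case (step y y')
    from step.hyps(2) have "{y, y'} \<in> F'" by simp
    then consider "{y, y'} \<in> F" | u where "u \<in> N" "{y, y'} = {u, v}"
      by (auto simp: F'_def)
    thus ?case
    proof cases
      case 1
      hence "y \<noteq> v" "y' \<noteq> v" using v by auto
      with step.IH reachable_edge[OF 1] show ?thesis
        by (auto intro: reachable_trans)
    next
      case 2
      hence "y = u \<and> y' = v \<or> y = v \<and> y' = u" by (auto simp: doubleton_eq_iff)
      thus ?thesis
      proof
        assume "y = u \<and> y' = v"
        with 2 step.IH v show ?thesis by (auto split: if_splits)
      next
        assume "y = v \<and> y' = u"
        with 2 step.IH v show ?thesis by (auto split: if_splits intro: reachable_refl)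
      qed
    qed
  qed
  have mono: "(a, b) \<in> graph_reachable F'" if "(a, b) \<in> graph_reachable F" for a b
    using that by (rule reachable_mono[rotated]) (auto simp: F'_def)
  have edge: "(u, v) \<in> graph_reachable F'" if "u \<in> N" for u
    using that by (intro reachable_edge) (auto simp: F'_def)
  show "(x, v) \<in> graph_reachable F' \<longleftrightarrow> (\<exists>u\<in>N. (x, u) \<in> graph_reachable F)"
    using forward[of v] by (auto intro: reachable_trans mono edge)
  show "(x, y) \<in> graph_reachable F' \<longleftrightarrow> (x, y) \<in> graph_reachable F \<or>
      (\<exists>u\<in>N. \<exists>w\<in>N. (x, u) \<in> graph_reachable F \<and> (w, y) \<in> graph_reachable F)" if "y \<noteq> v"
    using forward[of y] that
    by (auto intro: mono) (meson edge mono reachable_sym reachable_trans)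
qed

text \<open>
  Cycles have distinct vertices, so turning a connection into a cycle requires a path instead of a
  walk.
\<close>

lemma reachable_path:
  assumes "(x, y) \<in> graph_reachable E"
  obtains p where "p \<noteq> []" "distinct p" "hd p = x" "last p = y"
    "\<And>i. Suc i < length p \<Longrightarrow> {p ! i, p ! Suc i} \<in> E"
proof -
  from assms[unfolded graph_reachable_def]
  have "\<exists>p. p \<noteq> [] \<and> distinct p \<and> hd p = x \<and> last p = y \<and>
    (\<forall>i. Suc i < length p \<longrightarrow> {p ! i, p ! Suc i} \<in> E)"
  proof (induction rule: rtrancl_induct)
    case base
    show ?case by (rule exI[of _ "[x]"]) simp
  next
    case (step y z)
    then obtain p where p: "p \<noteq> []" "distinct p" "hd p = x" "last p = y"
      "\<forall>i. Suc i < length p \<longrightarrow> {p ! i, p ! Suc i} \<in> E" by blast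
    show ?case
    proof (cases "z \<in> set p")
      case True
      then obtain j where j: "j < length p" "p ! j = z" by (auto simp: in_set_conv_nth)
      have "hd (take (Suc j) p) = x" "last (take (Suc j) p) = z"
        using p j by (simp_all add: last_conv_nth min_absorb2)
      with p j show ?thesis
        by (intro exI[of _ "take (Suc j) p"]) auto
    next
      case False
      have "{(p @ [z]) ! i, (p @ [z]) ! Suc i} \<in> E" if "Suc i < length (p @ [z])" for i
      proof (cases "Suc i < length p")
        case True
        thus ?thesis using p by (simp add: nth_append)
      next
        case False
        hence "i = length p - 1" using that p by simp
        thus ?thesis using step.hyps(2) p by (simp add: nth_append last_conv_nth)
      qed
      with False p show ?thesis
        by (intro exI[of _ "p @ [z]"]) auto
    qed
  qed
  thus ?thesis using that by blast
qed

lemma path_reachable: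
  assumes "\<And>i. Suc i < length p \<Longrightarrow> {p ! i, p ! Suc i} \<in> E" "i < length p"
  shows "(p ! 0, p ! i) \<in> graph_reachable E"
  using assms(2)
proof (induction i)
  case (Suc i)
  thus ?case using assms(1)[of i] by (auto intro: reachable_trans reachable_edge)
qed simp

lemma graph_cycle_rotate:
  assumes "graph_cycle E c"
  shows "graph_cycle E (rotate k c)"
proof -
  have c: "length c \<ge> 3" "distinct c"
    "\<And>i. i < length c \<Longrightarrow> {c ! i, c ! (Suc i mod length c)} \<in> E"
    using assms by (auto simp: graph_cycle_def)
  have "{rotate k c ! i, rotate k c ! (Suc i mod length c)} \<in> E" if i: "i < length c" for i
  proof -
    have pos: "0 < length c" using c by linarith
    have "rotate k c ! (Suc i mod length c) = c ! ((k + Suc i mod length c) mod length c)"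
      using pos by (intro nth_rotate) simp
    also have "(k + Suc i mod length c) mod length c = Suc ((k + i) mod length c) mod length c"
      by (metis add_Suc_right mod_Suc_eq mod_add_right_eq)
    finally show ?thesis
      using c(3)[of "(k + i) mod length c"] pos i by (simp add: nth_rotate)
  qed
  thus ?thesis using c by (simp add: graph_cycle_def)
qed

text \<open>
  A cycle through \<open>v\<close>, rotated so as to start at \<open>v\<close>, is a path in the old graph between two different
  neighbours of \<open>v\<close>, and conversely.
\<close>

lemma graph_cycle_new_vertex:
  assumes v: "v \<notin> \<Union>F" "v \<notin> N"
  defines "F' \<equiv> F \<union> (\<lambda>u. {u, v}) ` N"
  shows "(\<exists>c. graph_cycle F' c) \<longleftrightarrow>
    (\<exists>c. graph_cycle F c) \<or> (\<exists>u\<in>N. \<exists>w\<in>N. u \<noteq> w \<and> (u, w) \<in> graph_reachable F)"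
    (is "?L \<longleftrightarrow> ?C \<or> ?N")
proof
  have old: "e \<in> F" if "e \<in> F'" "v \<notin> e" for e using that by (auto simp: F'_def)
  have new: "u \<in> N" if "{u, v} \<in> F'" for u using that v by (auto simp: F'_def doubleton_eq_iff)
  assume ?L
  then obtain c where c: "graph_cycle F' c" ..
  show "?C \<or> ?N"
  proof (cases "v \<in> set c")
    case False
    have "graph_cycle F c"
      using c False unfolding graph_cycle_def
    proof (elim conjE, intro conjI allI impI)
      fix i assume *: "\<forall>i<length c. {c ! i, c ! (Suc i mod length c)} \<in> F'" and i: "i < length c"
      have "0 < length c" using i by linarith
      hence "c ! i \<in> set c" "c ! (Suc i mod length c) \<in> set c" using i by auto
      thus "{c ! i, c ! (Suc i mod length c)} \<in> F" using * i False by (intro old) auto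
    qed
    thus ?thesis by blast
  next
    case True
    then obtain k where k: "k < length c" "c ! k = v" by (auto simp: in_set_conv_nth)
    define c' where "c' = rotate k c"
    have c': "graph_cycle F' c'" unfolding c'_def by (rule graph_cycle_rotate[OF c])
    hence len: "length c' \<ge> 3" "distinct c'"
      and edges: "\<And>i. i < length c' \<Longrightarrow> {c' ! i, c' ! (Suc i mod length c')} \<in> F'"
      by (auto simp: graph_cycle_def)
    have "c' ! 0 = v" using k nth_rotate[of 0 c k] by (cases "c = []") (simp_all add: c'_def)
    then obtain p where p: "c' = v # p" using len by (cases c') auto
    have lp: "length p \<ge> 2" "distinct p" "v \<notin> set p" using len p by auto
    have path: "{p ! i, p ! Suc i} \<in> F" if "Suc i < length p" for i
    proof -
      have "{p ! i, p ! Suc i} \<in> F'" using edges[of "Suc i"] that p by simp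
      moreover have "v \<noteq> p ! i" "v \<noteq> p ! Suc i"
        using that lp(3) nth_mem[of i p] nth_mem[of "Suc i" p] by auto
      ultimately show ?thesis by (intro old) auto
    qed
    have "{p ! 0, v} \<in> F'" using edges[of 0] lp p by (cases p) (simp_all add: insert_commute)
    hence "p ! 0 \<in> N" by (rule new)
    have "{p ! (length p - 1), v} \<in> F'" using edges[of "length p"] lp p by (cases p) simp_all
    hence "p ! (length p - 1) \<in> N" by (rule new)
    moreover have "p ! 0 \<noteq> p ! (length p - 1)" using lp nth_eq_iff_index_eq[of p 0 "length p - 1"] by force
    moreover have "(p ! 0, p ! (length p - 1)) \<in> graph_reachable F"
      using lp by (intro path_reachable path) auto
    ultimately show ?thesis using \<open>p ! 0 \<in> N\<close> by blast
  qed
next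
  assume "?C \<or> ?N"
  thus ?L
  proof
    assume ?C
    thus ?L by (auto simp: graph_cycle_def F'_def)
  next
    assume ?N
    then obtain u w where uw: "u \<in> N" "w \<in> N" "u \<noteq> w" "(u, w) \<in> graph_reachable F" by blast
    obtain p where p: "p \<noteq> []" "distinct p" "hd p = u" "last p = w"
      "\<And>i. Suc i < length p \<Longrightarrow> {p ! i, p ! Suc i} \<in> F"
      using reachable_path[OF uw(4)] by blast
    have len: "length p \<ge> 2" using p(1,3,4) uw(3) by (cases p; cases "tl p") auto
    have ends: "p ! 0 = u" "p ! (length p - 1) = w" using p by (simp_all add: hd_conv_nth last_conv_nth)
    have "v \<noteq> p ! i" if "i < length p" for i
    proof (cases "Suc i < length p")
      case True
      thus ?thesis using p(5)[of i] v(1) by auto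
    next
      case False
      hence "i = length p - 1" using that by simp
      thus ?thesis using ends uw v by auto
    qed
    hence "v \<notin> set p" by (auto simp: in_set_conv_nth)
    moreover have "{(v # p) ! i, (v # p) ! (Suc i mod length (v # p))} \<in> F'"
      if "i < length (v # p)" for i
    proof -
      consider "i = 0" | j where "i = Suc j" "Suc j < length p" | "i = length p" "0 < i"
        using \<open>i < length (v # p)\<close> len by (cases i) (fastforce simp: less_Suc_eq)+
      thus ?thesis
      proof cases
        case 1
        thus ?thesis using len ends uw by (auto simp: F'_def)
      next
        case 2
        thus ?thesis using p(5)[of j] by (simp add: F'_def)
      next
        case 3
        thus ?thesis using len ends uw by (auto simp: F'_def nth_Cons' insert_commute)
      qed
    qed
    ultimately have "graph_cycle F' (v # p)" using len p(2) by (simp add: graph_cycle_def)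
    thus ?L by blast
  qed
qed

section \<open>Types of the restrictions of an edge set\<close>

definition window_pattern :: "nat \<Rightarrow> bool \<Rightarrow> bool \<Rightarrow> bool \<Rightarrow> bool" where
  "window_pattern i p q r \<longleftrightarrow>
     i = 1 \<and> p \<and> q \<and> r \<or> i = 2 \<and> \<not> p \<and> q \<and> \<not> r \<or> i = 3 \<and> p \<and> \<not> q \<and> \<not> r \<or>
     i = 4 \<and> \<not> p \<and> \<not> q \<and> r \<or> i = 5 \<and> \<not> p \<and> \<not> q \<and> \<not> r"

text \<open>
  The set \<open>S\<close> is a half-line \<open>{a..}\<close> for trees of a box and for finite pieces of an infinite tree, and
  \<open>UNIV\<close> for the infinite tree, so that one step lemma serves all three.
\<close>

definition linked :: "int set \<Rightarrow> int set set \<Rightarrow> int \<Rightarrow> int \<Rightarrow> int \<Rightarrow> bool" where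
  "linked S t m x y \<longleftrightarrow> (x, y) \<in> graph_reachable (induced_edges t (S \<inter> {..m}))"

definition has_type :: "int set \<Rightarrow> int set set \<Rightarrow> int \<Rightarrow> nat \<Rightarrow> bool" where
  "has_type S t m i \<longleftrightarrow>
     window_pattern i (linked S t m m (m - 1)) (linked S t m (m - 1) (m - 2)) (linked S t m m (m - 2)) \<and>
     (\<forall>x\<in>S. x \<le> m \<longrightarrow> linked S t m x m \<or> linked S t m x (m - 1) \<or> linked S t m x (m - 2))"

definition has_forest_type :: "int set \<Rightarrow> int set set \<Rightarrow> int \<Rightarrow> nat \<Rightarrow> bool" where
  "has_forest_type S t m i \<longleftrightarrow>
     has_type S t m i \<and> (\<nexists>c. graph_cycle (induced_edges t (S \<inter> {..m})) c)"

definition letter :: "int set set \<Rightarrow> int \<Rightarrow> bool \<times> bool" where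
  "letter t m = (h_edge m \<in> t, z_edge m \<in> t)"

definition word :: "int set set \<Rightarrow> int \<Rightarrow> nat \<Rightarrow> (bool \<times> bool) list" where
  "word t m k = map (\<lambda>j. letter t (m + 1 + int j)) [0..<k]"

lemma linked_refl [simp]: "linked S t m x x"
  by (simp add: linked_def)

lemma linked_sym: "linked S t m x y \<Longrightarrow> linked S t m y x"
  unfolding linked_def by (rule reachable_sym)

lemma linked_commute: "linked S t m x y \<longleftrightarrow> linked S t m y x"
  using linked_sym by blast

lemma linked_trans: "linked S t m x y \<Longrightarrow> linked S t m y z \<Longrightarrow> linked S t m x z"
  unfolding linked_def by (rule reachable_trans)

lemma linked_mono: "S \<subseteq> S' \<Longrightarrow> linked S t m x y \<Longrightarrow> linked S' t m x y"
  unfolding linked_def by (erule reachable_mono[rotated]) (auto simp: induced_edges_def)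

lemma has_type_range: "has_type S t m i \<Longrightarrow> i \<in> {1..5}"
  by (auto simp: has_type_def window_pattern_def)

lemma window_pattern_unique:
  "window_pattern i p q r \<Longrightarrow> window_pattern j p q r \<Longrightarrow> i = j"
  unfolding window_pattern_def by (elim disjE conjE) simp_all

lemma has_type_unique: "has_type S t m i \<Longrightarrow> has_type S t m j \<Longrightarrow> i = j"
  unfolding has_type_def by (blast dest: window_pattern_unique)

lemma has_type_exists:
  assumes "\<And>x. x \<in> S \<Longrightarrow> x \<le> m \<Longrightarrow> linked S t m x m \<or> linked S t m x (m - 1) \<or> linked S t m x (m - 2)"
  shows "\<exists>i. has_type S t m i"
proof -
  let ?p = "linked S t m m (m - 1)" and ?q = "linked S t m (m - 1) (m - 2)"
    and ?r = "linked S t m m (m - 2)"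
  have "?p \<Longrightarrow> ?q \<Longrightarrow> ?r" by (rule linked_trans)
  moreover have "?p \<Longrightarrow> ?r \<Longrightarrow> ?q" by (rule linked_trans[OF linked_sym])
  moreover have "?q \<Longrightarrow> ?r \<Longrightarrow> ?p" by (rule linked_trans[OF _ linked_sym])
  ultimately have "\<exists>i. window_pattern i ?p ?q ?r"
    unfolding window_pattern_def by (cases ?p; cases ?q; cases ?r) simp_all
  thus ?thesis using assms unfolding has_type_def by blast
qed

lemma has_type_1_iff:
  "has_type S t m 1 \<longleftrightarrow> linked S t m m (m - 1) \<and> linked S t m m (m - 2) \<and>
     (\<forall>x\<in>S. x \<le> m \<longrightarrow> linked S t m x m)"
proof
  assume *: "has_type S t m 1"
  hence "linked S t m m (m - 1)" "linked S t m m (m - 2)"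
    by (simp_all add: has_type_def window_pattern_def)
  moreover from this * have "\<forall>x\<in>S. x \<le> m \<longrightarrow> linked S t m x m"
    unfolding has_type_def by (meson linked_sym linked_trans)
  ultimately show "linked S t m m (m - 1) \<and> linked S t m m (m - 2) \<and>
     (\<forall>x\<in>S. x \<le> m \<longrightarrow> linked S t m x m)" by blast
next
  assume *: "linked S t m m (m - 1) \<and> linked S t m m (m - 2) \<and>
     (\<forall>x\<in>S. x \<le> m \<longrightarrow> linked S t m x m)"
  hence "linked S t m (m - 1) (m - 2)" by (meson linked_sym linked_trans)
  with * show "has_type S t m 1" by (simp add: has_type_def window_pattern_def)
qed

lemma induced_edges_new_vertex:
  assumes "t \<subseteq> helix_edges" "{m - 2, m, m + 1} \<subseteq> S"
  shows "induced_edges t (S \<inter> {..m + 1}) = induced_edges t (S \<inter> {..m}) \<union>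
    (\<lambda>u. {u, m + 1}) ` ((if h_edge (m + 1) \<in> t then {m - 2} else {}) \<union>
                        (if z_edge (m + 1) \<in> t then {m} else {}))"
    (is "?L = ?R")
proof
  show "?R \<subseteq> ?L"
    using assms(2) by (auto simp: induced_edges_def h_edge_def z_edge_def split: if_splits)
  show "?L \<subseteq> ?R"
  proof
    fix e assume e: "e \<in> ?L"
    hence et: "e \<in> t" and eS: "e \<subseteq> S \<inter> {..m + 1}" by (auto simp: induced_edges_def)
    show "e \<in> ?R"
    proof (cases "m + 1 \<in> e")
      case False
      have "x \<le> m" if "x \<in> e" for x
      proof -
        have "x \<le> m + 1" "x \<noteq> m + 1" using that False eS by auto
        thus ?thesis by simp
      qed
      thus ?thesis using et eS by (auto simp: induced_edges_def)
    next
      case True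
      from et assms(1) obtain k where k: "e = z_edge k \<or> e = h_edge k"
        by (auto simp: helix_edges_def)
      hence "k \<in> e" by (auto simp: z_edge_def h_edge_def)
      hence "k \<le> m + 1" using eS by auto
      with k True have "k = m + 1" by (auto simp: z_edge_def h_edge_def)
      with k et show ?thesis
        by (auto simp: z_edge_def h_edge_def algebra_simps insert_commute)
    qed
  qed
qed

context
  fixes S t m N h z
  assumes tS: "t \<subseteq> helix_edges" "{m - 2, m - 1, m, m + 1} \<subseteq> S"
  defines "h \<equiv> h_edge (m + 1) \<in> t" and "z \<equiv> z_edge (m + 1) \<in> t"
  defines "N \<equiv> (if h then {m - 2} else {}) \<union> (if z then {m} else {})"
begin

lemma new_vertex_edges:
  "induced_edges t (S \<inter> {..m + 1}) = induced_edges t (S \<inter> {..m}) \<union> (\<lambda>u. {u, m + 1}) ` N"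
  using induced_edges_new_vertex[of t m S] tS by (simp add: N_def h_def z_def)

lemma new_vertex_fresh: "m + 1 \<notin> \<Union> (induced_edges t (S \<inter> {..m}))" "m + 1 \<notin> N"
  by (auto simp: induced_edges_def N_def)

lemma linked_new_vertex:
  "x \<le> m \<Longrightarrow> linked S t (m + 1) x (m + 1) \<longleftrightarrow> (\<exists>u\<in>N. linked S t m x u)"
  "x \<le> m \<Longrightarrow> y \<le> m \<Longrightarrow> linked S t (m + 1) x y \<longleftrightarrow>
     linked S t m x y \<or> (\<exists>u\<in>N. \<exists>w\<in>N. linked S t m x u \<and> linked S t m w y)"
  unfolding linked_def new_vertex_edges
  using reachable_new_vertex[OF new_vertex_fresh, of x] by simp_all

lemma cycle_new_vertex:
  "(\<exists>c. graph_cycle (induced_edges t (S \<inter> {..m + 1})) c) \<longleftrightarrow>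
     (\<exists>c. graph_cycle (induced_edges t (S \<inter> {..m})) c) \<or> h \<and> z \<and> linked S t m m (m - 2)"
  unfolding new_vertex_edges graph_cycle_new_vertex[OF new_vertex_fresh]
  unfolding linked_def[symmetric] using linked_commute[of S t m m "m - 2"] by (auto simp: N_def)

text \<open>
  The reason for the table \<open>step\<close>: connections among \<open>m + 1\<close>, \<open>m\<close> and \<open>m - 1\<close> are expressed through
  connections in the old window by \<open>linked_new_vertex\<close>. The vertex \<open>m - 2\<close> leaves the window but remains
  connected to it unless the letter is dead; hence so does everything that was connected to the old
  window. Acyclicity does not enter, so this applies to infinite edge sets as well.
\<close>

lemma has_type_step:
  assumes "has_type S t m i" "step i (letter t (m + 1)) \<noteq> 0"
  shows "has_type S t (m + 1) (step i (letter t (m + 1)))"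
proof -
  let ?L = "linked S t m" and ?L' = "linked S t (m + 1)"
  have pat: "window_pattern i (?L m (m - 1)) (?L (m - 1) (m - 2)) (?L m (m - 2))"
    and cover: "\<And>x. x \<in> S \<Longrightarrow> x \<le> m \<Longrightarrow> ?L x m \<or> ?L x (m - 1) \<or> ?L x (m - 2)"
    using assms(1) by (auto simp: has_type_def)
  have sym: "?L (m - 1) m = ?L m (m - 1)" "?L (m - 2) (m - 1) = ?L (m - 1) (m - 2)"
    "?L (m - 2) m = ?L m (m - 2)" by (rule linked_commute)+
  have i: "i \<in> {1..5}" using has_type_range[OF assms(1)] .
  have l: "letter t (m + 1) = (h, z)" by (simp add: letter_def h_def z_def)
  have swap: "?L' (m + 1) x = ?L' x (m + 1)" for x by (rule linked_commute)
  have new: "?L' (m + 1) m \<longleftrightarrow> h \<and> ?L m (m - 2) \<or> z"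
    "?L' (m + 1) (m - 1) \<longleftrightarrow> h \<and> ?L (m - 1) (m - 2) \<or> z \<and> ?L m (m - 1)"
    "?L' (m - 2) (m + 1) \<longleftrightarrow> h \<or> z \<and> ?L m (m - 2)"
    using linked_new_vertex(1)[of m] linked_new_vertex(1)[of "m - 1"] linked_new_vertex(1)[of "m - 2"]
    by (auto simp add: swap N_def sym)
  have "?L' m (m - 1) \<longleftrightarrow>
      ?L m (m - 1) \<or> (\<exists>u\<in>N. \<exists>w\<in>N. ?L m u \<and> ?L w (m - 1))"
    by (intro linked_new_vertex(2)) auto
  also have "\<dots> \<longleftrightarrow> ?L m (m - 1) \<or> h \<and> z \<and> ?L (m - 1) (m - 2)"
  proof -
    have "?L m (m - 2) \<and> ?L (m - 1) (m - 2) \<longrightarrow> ?L m (m - 1)"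
      by (meson linked_sym linked_trans)
    thus ?thesis by (cases h; cases z) (auto simp: N_def sym)
  qed
  finally have new': "?L' m (m - 1) \<longleftrightarrow> ?L m (m - 1) \<or> h \<and> z \<and> ?L (m - 1) (m - 2)" .
  have window: "window_pattern (step i (h, z))
      (?L' (m + 1) m) (?L' m (m - 1)) (?L' (m + 1) (m - 1))"
    using pat assms(2) i unfolding l new new'
    by (cases h; cases z) (auto simp: types_cases step_def window_pattern_def)
  have keep: "?L' x y" if "?L x y" "x \<le> m" "y \<le> m" for x y
    using that linked_new_vertex(2) by blast
  \<comment> \<open>The vertex that leaves the window is still connected to the new one.\<close>
  have "?L' (m - 2) (m + 1) \<or> ?L (m - 2) m \<or> ?L (m - 2) (m - 1)"
    using pat assms(2) i unfolding l new sym
    by (cases h; cases z) (auto simp: types_cases step_def window_pattern_def)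
  hence "?L' (m - 2) (m + 1) \<or> ?L' (m - 2) m \<or> ?L' (m - 2) (m - 1)"
    using keep by force
  hence "?L' x (m + 1) \<or> ?L' x m \<or> ?L' x (m - 1)" if "x \<in> S" "x \<le> m" for x
    using cover[OF that] keep[OF _ that(2), of m] keep[OF _ that(2), of "m - 1"]
      keep[OF _ that(2), of "m - 2"] linked_trans[of S t "m + 1" x "m - 2"] by auto
  hence "?L' x (m + 1) \<or> ?L' x m \<or> ?L' x (m - 1)" if "x \<in> S" "x \<le> m + 1" for x
    using that by (cases "x = m + 1") auto
  thus ?thesis using window by (simp add: has_type_def l)
qed

text \<open>
  For forests the step can be reversed: if the larger graph is acyclic and all its components meet the
  new window, then the smaller graph has these properties for the old window, because vertices reach
  \<open>m + 1\<close> through \<open>m\<close> or \<open>m - 2\<close> only, and the letter was not dead. Words therefore encode forests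
  faithfully, which is what counting spanning trees requires.
\<close>

lemma has_forest_type_step:
  assumes "j \<noteq> 0"
  shows "has_forest_type S t (m + 1) j \<longleftrightarrow>
    (\<exists>i. has_forest_type S t m i \<and> step i (letter t (m + 1)) = j)"
proof
  have l: "letter t (m + 1) = (h, z)" by (simp add: letter_def h_def z_def)
  have acyclic_step: "\<not> (h \<and> z \<and> linked S t m m (m - 2))"
    if "has_type S t m i" "step i (h, z) \<noteq> 0" for i
    using that by (auto simp: has_type_def window_pattern_def step_def)
  {
    assume "\<exists>i. has_forest_type S t m i \<and> step i (letter t (m + 1)) = j"
    thus "has_forest_type S t (m + 1) j"
      using has_type_step acyclic_step assms cycle_new_vertex
      by (auto simp: has_forest_type_def l)
  }
  assume j: "has_forest_type S t (m + 1) j"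
  note new = linked_new_vertex
  let ?L = "linked S t m" and ?L' = "linked S t (m + 1)"
  have cover': "?L' x (m + 1) \<or> ?L' x m \<or> ?L' x (m - 1)" if "x \<in> S" "x \<le> m" for x
    using j that by (auto simp: has_forest_type_def has_type_def)
  have "?L x m \<or> ?L x (m - 1) \<or> ?L x (m - 2)" if "x \<in> S" "x \<le> m" for x
    using cover'[OF that] that by (auto simp: new N_def split: if_splits)
  then obtain i where i: "has_type S t m i" using has_type_exists by blast
  have "step i (h, z) \<noteq> 0"
  proof
    assume dead: "step i (h, z) = 0"
    have "\<not> (h \<and> z \<and> ?L m (m - 2))"
      using j cycle_new_vertex by (auto simp: has_forest_type_def)
    with dead i have "\<not> h" "\<not> ?L m (m - 2)" "\<not> ?L (m - 1) (m - 2)"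
      by (auto simp: has_type_def window_pattern_def step_def split: bool.splits)
    hence "\<not> ?L (m - 2) m" "\<not> ?L (m - 2) (m - 1)" by (auto dest: linked_sym)
    with cover'[of "m - 2"] tS \<open>\<not> h\<close> show False by (auto simp: new N_def split: if_splits)
  qed
  moreover from this have "has_type S t (m + 1) (step i (h, z))"
    using has_type_step[OF i] by (simp add: l)
  hence "step i (h, z) = j"
    using j by (auto simp: has_forest_type_def intro: has_type_unique)
  ultimately show "\<exists>i. has_forest_type S t m i \<and> step i (letter t (m + 1)) = j"
    using i j cycle_new_vertex by (auto simp: has_forest_type_def l)
qed

end

lemma word_0 [simp]: "word t m 0 = []"
  by (simp add: word_def)

lemma length_word [simp]: "length (word t m k) = k"
  by (simp add: word_def)

lemma nth_word: "j < k \<Longrightarrow> word t m k ! j = letter t (m + 1 + int j)"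
  by (simp add: word_def)

lemma word_add: "word t m (k + l) = word t m k @ word t (m + int k) l"
  by (rule nth_equalityI) (auto simp: nth_append nth_word algebra_simps)

lemma word_Suc: "word t m (Suc k) = word t m k @ [letter t (m + int k + 1)]"
  by (simp add: word_def algebra_simps)

lemma word_1 [simp]: "word t m (Suc 0) = [letter t (m + 1)]"
  by (simp add: word_Suc)

lemma has_type_run:
  assumes "t \<subseteq> helix_edges" "{m - 2..} \<subseteq> S" "has_type S t m i" "run i (word t m k) \<noteq> 0"
  shows "has_type S t (m + int k) (run i (word t m k))"
  using assms(4)
proof (induction k)
  case (Suc k)
  let ?j = "run i (word t m k)"
  have "step ?j (letter t (m + int k + 1)) \<noteq> 0" using Suc.prems by (simp add: word_Suc)
  moreover from this have "?j \<noteq> 0" by (metis step_0)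
  hence "has_type S t (m + int k) ?j" by (rule Suc.IH)
  moreover have "{m + int k - 2, m + int k - 1, m + int k, m + int k + 1} \<subseteq> S"
    using assms(2) by auto
  ultimately have "has_type S t (m + int k + 1) (step ?j (letter t (m + int k + 1)))"
    using assms(1) by (intro has_type_step)
  thus ?case by (simp add: word_Suc algebra_simps)
qed (simp add: assms)

lemma has_forest_type_run:
  assumes "t \<subseteq> helix_edges" "{m - 2..} \<subseteq> S" "j \<noteq> 0"
  shows "has_forest_type S t (m + int k) j \<longleftrightarrow>
    (\<exists>i. has_forest_type S t m i \<and> run i (word t m k) = j)"
  using assms(3)
proof (induction k arbitrary: j)
  case (Suc k)
  let ?l = "letter t (m + int k + 1)"
  have "{m + int k - 2, m + int k - 1, m + int k, m + int k + 1} \<subseteq> S"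
    using assms(2) by auto
  hence "has_forest_type S t (m + int k + 1) j \<longleftrightarrow>
      (\<exists>i. has_forest_type S t (m + int k) i \<and> step i ?l = j)"
    using assms(1) Suc.prems by (intro has_forest_type_step)
  also have "\<dots> \<longleftrightarrow> (\<exists>i. i \<noteq> 0 \<and> has_forest_type S t (m + int k) i \<and> step i ?l = j)"
    using Suc.prems by (metis step_0)
  also have "\<dots> \<longleftrightarrow> (\<exists>i. has_forest_type S t m i \<and> step (run i (word t m k)) ?l = j)"
    using Suc.IH Suc.prems by (metis step_0)
  finally show ?case by (simp add: word_Suc algebra_simps)
qed simp

section \<open>The connectivity type\<close>

definition component :: "int set set \<Rightarrow> int \<Rightarrow> int \<Rightarrow> int set" where
  "component t n x = {y. y \<le> n \<and> linked UNIV t n x y}"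

lemma graph_components_eq:
  "graph_components {..n} (induced_edges t {..n}) = component t n ` {..n}"
  by (auto simp: graph_components_def quotient_def linked_def component_def)

lemma component_eq_iff:
  assumes "y \<le> n"
  shows "component t n x = component t n y \<longleftrightarrow> linked UNIV t n x y"
proof
  assume "component t n x = component t n y"
  moreover have "y \<in> component t n y" using assms by (simp add: component_def)
  ultimately have "y \<in> component t n x" by simp
  thus "linked UNIV t n x y" by (simp add: component_def)
next
  assume l: "linked UNIV t n x y"
  have "linked UNIV t n x z \<longleftrightarrow> linked UNIV t n y z" for z
    using linked_trans[OF l, of z] linked_trans[OF linked_sym[OF l], of z] by blast
  thus "component t n x = component t n y" by (simp add: component_def)
qed

lemma component_unique:
  assumes "A \<in> component t n ` {..n}" "x \<in> A"
  shows "A = component t n x"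
proof -
  obtain y where y: "A = component t n y" using assms(1) by blast
  with assms(2) have "x \<le> n" "linked UNIV t n y x" by (auto simp: component_def)
  thus ?thesis using y component_eq_iff by simp
qed

lemma mem_component [simp]: "x \<le> n \<Longrightarrow> x \<in> component t n x"
  by (simp add: component_def)

lemma two_components_iff:
  fixes t n
  defines "C \<equiv> component t n ` {..n}"
  assumes "a \<le> n" "b \<le> n" "c \<le> n"
  shows "card C = 2 \<and> (\<exists>A\<in>C. \<exists>B\<in>C. A \<noteq> B \<and> a \<in> A \<and> b \<in> B \<and> c \<in> B) \<longleftrightarrow>
    \<not> linked UNIV t n a b \<and> linked UNIV t n b c \<and>
    (\<forall>x\<le>n. linked UNIV t n x a \<or> linked UNIV t n x b)"
proof -
  let ?c = "component t n"
  note eq = component_eq_iff[of _ n t]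
  have "card C = 2 \<and> (\<exists>A\<in>C. \<exists>B\<in>C. A \<noteq> B \<and> a \<in> A \<and> b \<in> B \<and> c \<in> B) \<longleftrightarrow>
      ?c a \<noteq> ?c b \<and> ?c b = ?c c \<and> C \<subseteq> {?c a, ?c b}"
  proof
    assume *: "card C = 2 \<and> (\<exists>A\<in>C. \<exists>B\<in>C. A \<noteq> B \<and> a \<in> A \<and> b \<in> B \<and> c \<in> B)"
    then obtain A B where AB: "A \<in> C" "B \<in> C" "A \<noteq> B" "a \<in> A" "b \<in> B" "c \<in> B" by blast
    have eqs: "A = ?c a" "B = ?c b" "B = ?c c"
      by (rule component_unique[OF AB(1)[unfolded C_def] AB(4)]
               component_unique[OF AB(2)[unfolded C_def] AB(5)]
               component_unique[OF AB(2)[unfolded C_def] AB(6)])+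
    have card: "card C = 2" using * by simp
    hence "finite C" using card_ge_0_finite[of C] by simp
    hence "{A, B} = C" using card AB(1-3) by (intro card_seteq) simp_all
    thus "?c a \<noteq> ?c b \<and> ?c b = ?c c \<and> C \<subseteq> {?c a, ?c b}" using eqs AB(3) by simp
  next
    assume *: "?c a \<noteq> ?c b \<and> ?c b = ?c c \<and> C \<subseteq> {?c a, ?c b}"
    have mem: "?c a \<in> C" "?c b \<in> C" "a \<in> ?c a" "b \<in> ?c b" "c \<in> ?c c"
      using assms by simp_all
    hence "C = {?c a, ?c b}" using conjunct2[OF conjunct2[OF *]] by blast
    hence "card C = 2" using conjunct1[OF *] unfolding card_2_iff by blast
    thus "card C = 2 \<and> (\<exists>A\<in>C. \<exists>B\<in>C. A \<noteq> B \<and> a \<in> A \<and> b \<in> B \<and> c \<in> B)"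
      using mem * by metis
  qed
  also have "C \<subseteq> {?c a, ?c b} \<longleftrightarrow> (\<forall>x\<le>n. ?c x = ?c a \<or> ?c x = ?c b)"
    by (auto simp: C_def)
  finally show ?thesis by (simp add: assms eq)
qed

lemma three_components_iff:
  fixes t n
  defines "C \<equiv> component t n ` {..n}"
  shows "card C = 3 \<and> (\<forall>A\<in>C. card (A \<inter> {n, n - 1, n - 2}) = 1) \<longleftrightarrow> has_type UNIV t n 5"
proof -
  let ?L = "linked UNIV t n" and ?W = "{n, n - 1, n - 2}" and ?c = "component t n"
  have W_le: "x \<le> n" if "x \<in> ?W" for x using that by auto
  have type: "has_type UNIV t n 5 \<longleftrightarrow> inj_on ?c ?W \<and> C \<subseteq> ?c ` ?W"
  proof -
    have "C \<subseteq> ?c ` ?W \<longleftrightarrow> (\<forall>x\<le>n. ?c x = ?c n \<or> ?c x = ?c (n - 1) \<or> ?c x = ?c (n - 2))"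
      by (auto simp: C_def)
    also have "\<dots> \<longleftrightarrow> (\<forall>x\<le>n. ?L x n \<or> ?L x (n - 1) \<or> ?L x (n - 2))"
      by (simp add: component_eq_iff)
    moreover have "inj_on ?c ?W \<longleftrightarrow> \<not> ?L n (n - 1) \<and> \<not> ?L (n - 1) (n - 2) \<and> \<not> ?L n (n - 2)"
      by (simp add: inj_on_def component_eq_iff linked_commute[of UNIV t n "n - 1" n]
        linked_commute[of UNIV t n "n - 2"]) blast
    ultimately show ?thesis unfolding has_type_def window_pattern_def by auto
  qed
  show ?thesis unfolding type
  proof
    assume *: "card C = 3 \<and> (\<forall>A\<in>C. card (A \<inter> ?W) = 1)"
    have inj: "inj_on ?c ?W"
    proof (rule inj_onI)
      fix x y assume xy: "x \<in> ?W" "y \<in> ?W" "?c x = ?c y"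
      have "?c x \<in> C" using W_le xy(1) unfolding C_def by blast
      hence "card (?c x \<inter> ?W) = 1" using * by blast
      then obtain w where "?c x \<inter> ?W = {w}" by (auto simp: card_1_singleton_iff)
      moreover have "x \<in> ?c x" using W_le[OF xy(1)] by simp
      moreover have "y \<in> ?c x" unfolding xy(3) using W_le[OF xy(2)] by simp
      ultimately show "x = y" using xy(1,2) by (metis IntI singletonD)
    qed
    moreover have "finite C" using conjunct1[OF *] card_ge_0_finite[of C] by simp
    moreover have "?c ` ?W \<subseteq> C" unfolding C_def using W_le by blast
    moreover have "card (?c ` ?W) = 3" using card_image[OF inj] by simp
    ultimately show "inj_on ?c ?W \<and> C \<subseteq> ?c ` ?W"
      using * card_seteq[of C "?c ` ?W"] by simp
  next
    assume *: "inj_on ?c ?W \<and> C \<subseteq> ?c ` ?W"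
    have eq: "C = ?c ` ?W" using * W_le unfolding C_def by blast
    have "card C = 3" unfolding eq using card_image[of ?c ?W] * by simp
    moreover have "card (?c w \<inter> ?W) = 1" if w: "w \<in> ?W" for w
    proof -
      have "x = w" if "x \<in> ?c w" "x \<in> ?W" for x
      proof -
        have "?c w \<in> component t n ` {..n}" using W_le[OF w] by blast
        from component_unique[OF this that(1)] show "x = w"
          using inj_onD[OF conjunct1[OF *], of x w] w that(2) by simp
      qed
      hence "?c w \<inter> ?W = {w}" using w W_le[OF w] by auto
      thus ?thesis by simp
    qed
    ultimately show "card C = 3 \<and> (\<forall>A\<in>C. card (A \<inter> ?W) = 1)"
      unfolding eq by blast
  qed
qed

text \<open>
  In terms of connections between single vertices, the definition through the set of components is
  accessible both to the step lemma and to measurability.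
\<close>

lemma connectivity_type_cases:
  "connectivity_type t n =
     (if has_type UNIV t n 1 then 1 else if has_type UNIV t n 2 then 2
      else if has_type UNIV t n 3 then 3 else if has_type UNIV t n 4 then 4
      else if has_type UNIV t n 5 then 5 else 0)"
proof -
  let ?L = "linked UNIV t n"
  note c = linked_commute[of UNIV t n]
  have L: "?L x y \<longleftrightarrow> (x, y) \<in> graph_reachable (induced_edges t {..n})" for x y
    by (simp add: linked_def)
  have 1: "graph_connected {..n} (induced_edges t {..n}) \<longleftrightarrow> has_type UNIV t n 1"
  proof
    assume "graph_connected {..n} (induced_edges t {..n})"
    thus "has_type UNIV t n 1"
      unfolding has_type_1_iff graph_connected_def L[symmetric] by simp
  next
    assume "has_type UNIV t n 1"
    hence "\<And>x. x \<le> n \<Longrightarrow> ?L x n" unfolding has_type_1_iff by simp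
    hence "?L x y" if "x \<le> n" "y \<le> n" for x y using that by (meson linked_sym linked_trans)
    thus "graph_connected {..n} (induced_edges t {..n})"
      unfolding graph_connected_def L[symmetric] by auto
  qed
  have 2: "\<not> ?L n (n - 1) \<and> ?L (n - 1) (n - 2) \<and> (\<forall>x\<le>n. ?L x n \<or> ?L x (n - 1)) \<longleftrightarrow>
      has_type UNIV t n 2"
    unfolding has_type_def window_pattern_def
    using linked_trans[of UNIV t n _ "n - 1" "n - 2"] linked_trans[of UNIV t n _ "n - 2" "n - 1"]
      c[of "n - 1" "n - 2"] by auto
  have 3: "\<not> ?L (n - 2) n \<and> ?L n (n - 1) \<and> (\<forall>x\<le>n. ?L x (n - 2) \<or> ?L x n) \<longleftrightarrow>
      has_type UNIV t n 3"
    unfolding has_type_def window_pattern_def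
    using linked_trans[of UNIV t n _ n "n - 1"] linked_trans[of UNIV t n _ "n - 1" n]
      c[of n "n - 1"] c[of "n - 1" "n - 2"] c[of n "n - 2"] by auto
  have 4: "\<not> ?L (n - 1) n \<and> ?L n (n - 2) \<and> (\<forall>x\<le>n. ?L x (n - 1) \<or> ?L x n) \<longleftrightarrow>
      has_type UNIV t n 4"
    unfolding has_type_def window_pattern_def
    using linked_trans[of UNIV t n _ n "n - 2"] linked_trans[of UNIV t n _ "n - 2" n]
      c[of n "n - 1"] c[of "n - 1" "n - 2"] c[of n "n - 2"] by auto
  show ?thesis
    unfolding connectivity_type_def Let_def graph_components_eq
    using 1 2 3 4 two_components_iff[of n n "n - 1" "n - 2" t] two_components_iff[of "n - 2" n n "n - 1" t]
      two_components_iff[of "n - 1" n n "n - 2" t] three_components_iff[of t n]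
    by simp
qed

lemma connectivity_type_iff:
  assumes "i \<in> {1..5}"
  shows "connectivity_type t n = i \<longleftrightarrow> has_type UNIV t n i"
  using assms has_type_unique[of UNIV t n] unfolding connectivity_type_cases types_cases
  by (elim disjE) (auto dest: has_type_unique)

lemma connectivity_type_eqI: "has_type UNIV t n i \<Longrightarrow> connectivity_type t n = i"
  using connectivity_type_iff has_type_range by blast

section \<open>Spanning trees of a box as words\<close>

definition words :: "nat \<Rightarrow> (bool \<times> bool) list set" where
  "words k = {w. length w = k}"

lemma finite_words [simp, intro]: "finite (words k)"
  using finite_lists_length_eq[of "UNIV :: (bool \<times> bool) set" k] by (simp add: words_def)

lemma words_0 [simp]: "words 0 = {[]}"
  by (auto simp: words_def)

lemma sum_words_add:
  "(\<Sum>w\<in>words (k + l). f w) = (\<Sum>u\<in>words k. \<Sum>w\<in>words l. f (u @ w))"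
proof -
  have "bij_betw (\<lambda>(u, w). u @ w) (words k \<times> words l) (words (k + l))"
    by (rule bij_betwI[where g = "\<lambda>w. (take k w, drop k w)"]) (auto simp: words_def)
  from sum.reindex_bij_betw[OF this, of f] show ?thesis
    by (simp add: sum.cartesian_product case_prod_beta')
qed

definition initial_type :: "bool \<times> bool \<Rightarrow> nat" where
  "initial_type pq = (case pq of (True, True) \<Rightarrow> 1 | (True, False) \<Rightarrow> 2
     | (False, True) \<Rightarrow> 3 | (False, False) \<Rightarrow> 5)"

lemma z_edge_eq_iff [simp]: "z_edge m = z_edge k \<longleftrightarrow> m = k"
  by (auto simp: z_edge_def doubleton_eq_iff)

lemma h_edge_eq_iff [simp]: "h_edge m = h_edge k \<longleftrightarrow> m = k"
  by (auto simp: h_edge_def doubleton_eq_iff)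

lemma z_edge_neq_h_edge [simp]: "z_edge m \<noteq> h_edge k" "h_edge k \<noteq> z_edge m"
  by (auto simp: h_edge_def z_edge_def doubleton_eq_iff)

text \<open>
  The run starts at the third vertex of the half-line: the first three vertices can only be joined by
  two \<open>z\<close>-edges, since their \<open>h\<close>-edges leave the half-line.
\<close>

lemma has_forest_type_initial:
  assumes "t \<subseteq> helix_edges"
  shows "has_forest_type {a..} t (a + 2) i \<longleftrightarrow>
    i = initial_type (z_edge (a + 1) \<in> t, z_edge (a + 2) \<in> t)"
proof -
  define p q where "p \<longleftrightarrow> z_edge (a + 1) \<in> t" and "q \<longleftrightarrow> z_edge (a + 2) \<in> t"
  define N1 N2 where "N1 = (if p then {a} else {})" and "N2 = (if q then {a + 1} else {})"
  let ?E1 = "{} \<union> (\<lambda>u. {u, a + 1}) ` N1" and ?E = "induced_edges t ({a..} \<inter> {..a + 2})"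
  let ?L = "linked {a..} t (a + 2)"
  have z: "z_edge (a + 1) = {a, a + 1}" "z_edge (a + 2) = {a + 1, a + 2}"
    by (auto simp: z_edge_def)
  have E: "?E = ?E1 \<union> (\<lambda>u. {u, a + 2}) ` N2"
  proof
    show "?E1 \<union> (\<lambda>u. {u, a + 2}) ` N2 \<subseteq> ?E"
      by (auto simp: N1_def N2_def p_def q_def z induced_edges_def split: if_splits)
    show "?E \<subseteq> ?E1 \<union> (\<lambda>u. {u, a + 2}) ` N2"
    proof
      fix e assume e: "e \<in> ?E"
      then obtain k where k: "e = z_edge k \<or> e = h_edge k"
        using assms by (auto simp: induced_edges_def helix_edges_def)
      moreover have "e \<subseteq> {a..a + 2}" "e \<in> t" using e by (auto simp: induced_edges_def)
      ultimately have "e = z_edge k" "k = a + 1 \<or> k = a + 2" by (auto simp: z_edge_def h_edge_def)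
      hence "e = {a, a + 1} \<and> p \<or> e = {a + 1, a + 2} \<and> q"
        using \<open>e \<in> t\<close> unfolding p_def q_def z[symmetric] by blast
      thus "e \<in> ?E1 \<union> (\<lambda>u. {u, a + 2}) ` N2" by (auto simp: N1_def N2_def)
    qed
  qed
  have fresh: "a + 1 \<notin> \<Union> {}" "a + 1 \<notin> N1" "a + 2 \<notin> \<Union> ?E1" "a + 2 \<notin> N2"
    by (auto simp: N1_def N2_def split: if_splits)
  have empty: "(x, y) \<in> graph_reachable {} \<longleftrightarrow> x = y" for x y :: int
    by (simp add: graph_reachable_def)
  have one: "(a, a + 1) \<in> graph_reachable ?E1 \<longleftrightarrow> p"
    using reachable_new_vertex(1)[OF fresh(1,2), of a] by (simp add: empty N1_def)
  have one': "(a + 1, a) \<in> graph_reachable ?E1 \<longleftrightarrow> p"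
    using one reachable_sym by metis
  have linked: "?L a (a + 2) \<longleftrightarrow> p \<and> q" "?L (a + 1) (a + 2) \<longleftrightarrow> q" "?L a (a + 1) \<longleftrightarrow> p"
    unfolding linked_def E
    using reachable_new_vertex(1)[OF fresh(3,4), of a] reachable_new_vertex(1)[OF fresh(3,4), of "a + 1"]
      reachable_new_vertex(2)[OF fresh(3,4), of a "a + 1"] one one'
    by (simp_all add: N2_def)
  have "\<not> graph_cycle {} c" for c :: "int list"
    by (cases c) (auto simp: graph_cycle_def intro!: exI[of _ 0])
  hence "\<nexists>c. graph_cycle ?E1 c"
    unfolding graph_cycle_new_vertex[OF fresh(1,2)] by (auto simp: N1_def)
  hence acyclic: "\<nexists>c. graph_cycle ?E c"
    unfolding E graph_cycle_new_vertex[OF fresh(3,4)] by (auto simp: N2_def)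
  have cover: "x = a + 2 \<or> x = a + 1 \<or> x = a" if "x \<in> {a..}" "x \<le> a + 2" for x
    using that by auto
  have "has_type {a..} t (a + 2) (initial_type (p, q))"
  proof -
    have shift: "a + 2 - 1 = a + 1" "a + 2 - 2 = a" by simp_all
    have "?L (a + 2) (a + 1) \<longleftrightarrow> q" "?L (a + 1) a \<longleftrightarrow> p" "?L (a + 2) a \<longleftrightarrow> p \<and> q"
      using linked linked_commute by metis+
    moreover have "?L x (a + 2) \<or> ?L x (a + 1) \<or> ?L x a" if "x \<in> {a..}" "x \<le> a + 2" for x
      using cover[OF that] linked_refl by metis
    moreover have "window_pattern (initial_type (p, q)) q p (p \<and> q)"
      by (simp add: window_pattern_def initial_type_def split: bool.splits)
    ultimately show ?thesis unfolding has_type_def shift by simp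
  qed
  thus ?thesis
    using acyclic has_type_unique by (auto simp: has_forest_type_def p_def q_def)
qed

definition box_edges :: "nat \<Rightarrow> int set set" where
  "box_edges N = induced_edges helix_edges (helix_box N)"

lemma box_edges_iff:
  "z_edge m \<in> box_edges N \<longleftrightarrow> - int N < m \<and> m \<le> int N"
  "h_edge m \<in> box_edges N \<longleftrightarrow> - int N + 2 < m \<and> m \<le> int N"
  by (auto simp: box_edges_def induced_edges_def helix_edges_def helix_box_def z_edge_def h_edge_def)

lemma box_edges_cases:
  assumes "e \<in> box_edges N"
  obtains m where "e = z_edge m" "- int N < m" "m \<le> int N"
    | m where "e = h_edge m" "- int N + 2 < m" "m \<le> int N"
proof -
  from assms obtain m where "e = z_edge m \<or> e = h_edge m"
    by (auto simp: box_edges_def induced_edges_def helix_edges_def)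
  thus ?thesis using assms that box_edges_iff by metis
qed

lemma finite_box_edges: "finite (box_edges N)"
proof (rule finite_subset)
  show "box_edges N \<subseteq> z_edge ` {- int N..int N} \<union> h_edge ` {- int N..int N}"
    by (auto elim!: box_edges_cases)
qed auto

text \<open>
  The box ends at the vertex \<open>N\<close>, and a forest on it is a spanning tree exactly when its type at \<open>N\<close>
  is 1. Of the \<open>2 * N + 1\<close> vertices, all but the first three contribute a letter.
\<close>

lemma spanning_tree_iff_run:
  assumes "t \<subseteq> box_edges N" "N \<ge> 1"
  shows "t \<in> spanning_trees (helix_box N) (box_edges N) \<longleftrightarrow>
    run (initial_type (z_edge (- int N + 1) \<in> t, z_edge (- int N + 2) \<in> t))
      (word t (- int N + 2) (2 * N - 2)) = 1"
proof -
  let ?a = "- int N"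
  have t: "t \<subseteq> helix_edges" using assms(1) by (auto simp: box_edges_def induced_edges_def)
  have box: "{?a..} \<inter> {..int N} = helix_box N" by (auto simp: helix_box_def)
  have E: "induced_edges t ({?a..} \<inter> {..int N}) = t"
    unfolding box using assms(1) by (auto simp: box_edges_def induced_edges_def)
  have "graph_connected (helix_box N) t \<longleftrightarrow> has_type {?a..} t (int N) 1"
  proof
    assume c: "graph_connected (helix_box N) t"
    have "{int N - 2, int N - 1, int N} \<subseteq> helix_box N" using assms(2) by (auto simp: helix_box_def)
    with c show "has_type {?a..} t (int N) 1"
      unfolding has_type_1_iff linked_def E using box by (auto simp: graph_connected_def)
  next
    assume *: "has_type {?a..} t (int N) 1"
    have "(u, int N) \<in> graph_reachable t" if "u \<in> helix_box N" for u
      using * that unfolding has_type_1_iff linked_def E by (auto simp: helix_box_def)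
    hence "(u, v) \<in> graph_reachable t" if "u \<in> helix_box N" "v \<in> helix_box N" for u v
      using that by (blast intro: reachable_trans reachable_sym)
    thus "graph_connected (helix_box N) t" by (auto simp: graph_connected_def helix_box_def)
  qed
  hence "t \<in> spanning_trees (helix_box N) (box_edges N) \<longleftrightarrow> has_forest_type {?a..} t (int N) 1"
    using assms(1) by (auto simp: spanning_trees_def has_forest_type_def E)
  also have "\<dots> \<longleftrightarrow> has_forest_type {?a..} t (?a + 2 + int (2 * N - 2)) 1"
  proof -
    have "int N = ?a + 2 + int (2 * N - 2)" using assms(2) by (simp add: of_nat_diff)
    from arg_cong[OF this, of "\<lambda>m. has_forest_type {?a..} t m 1"] show ?thesis .
  qed
  also have "\<dots> \<longleftrightarrow>
      (\<exists>i. has_forest_type {?a..} t (?a + 2) i \<and> run i (word t (?a + 2) (2 * N - 2)) = 1)"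
    using t by (intro has_forest_type_run) auto
  also have "\<dots> \<longleftrightarrow> run (initial_type (z_edge (?a + 1) \<in> t, z_edge (?a + 2) \<in> t))
      (word t (?a + 2) (2 * N - 2)) = 1"
    unfolding has_forest_type_initial[OF t] by simp
  finally show ?thesis .
qed

definition encode :: "nat \<Rightarrow> int set set \<Rightarrow> (bool \<times> bool) \<times> (bool \<times> bool) list" where
  "encode N t = ((z_edge (- int N + 1) \<in> t, z_edge (- int N + 2) \<in> t),
     word t (- int N + 2) (2 * N - 2))"

lemma bij_betw_encode:
  assumes "N \<ge> 1"
  shows "bij_betw (encode N) (Pow (box_edges N)) (UNIV \<times> words (2 * N - 2))"
proof -
  let ?a = "- int N" and ?L = "2 * N - 2"
  define decode :: "(bool \<times> bool) \<times> (bool \<times> bool) list \<Rightarrow> int set set" where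
    "decode = (\<lambda>((p, q), w). (if p then {z_edge (?a + 1)} else {}) \<union> (if q then {z_edge (?a + 2)} else {}) \<union>
      {z_edge (?a + 3 + int j) | j. j < ?L \<and> snd (w ! j)} \<union>
      {h_edge (?a + 3 + int j) | j. j < ?L \<and> fst (w ! j)})"
  have position: "\<exists>j<?L. m = ?a + 3 + int j" if "?a + 2 < m" "m \<le> int N" for m
    using that by (intro exI[of _ "nat (m - ?a - 3)"]) auto
  show ?thesis
  proof (rule bij_betwI[where g = decode])
    show "encode N \<in> Pow (box_edges N) \<rightarrow> UNIV \<times> words ?L"
      by (auto simp: encode_def words_def)
    show "decode \<in> UNIV \<times> words ?L \<rightarrow> Pow (box_edges N)"
      using assms by (auto simp: decode_def box_edges_iff split: if_splits)
    show "encode N (decode y) = y" if y: "y \<in> UNIV \<times> words ?L" for y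
    proof -
      obtain p q w where pqw: "y = ((p, q), w)" "length w = ?L"
        using y by (cases y) (auto simp: words_def)
      have "word (decode y) (?a + 2) ?L = w"
        using pqw by (intro nth_equalityI) (auto simp: nth_word letter_def decode_def prod_eq_iff)
      thus ?thesis by (auto simp: pqw encode_def decode_def)
    qed
    show "decode (encode N t) = t" if t: "t \<in> Pow (box_edges N)" for t
    proof -
      have bits: "word t (?a + 2) ?L ! j = (h_edge (?a + 3 + int j) \<in> t, z_edge (?a + 3 + int j) \<in> t)"
        if "j < ?L" for j using that by (simp add: nth_word letter_def algebra_simps)
      have "decode (encode N t) \<subseteq> t"
        by (auto simp: decode_def encode_def bits[simplified] split: if_splits)
      moreover have "e \<in> decode (encode N t)" if e: "e \<in> t" for e
      proof -
        from e t have "e \<in> box_edges N" by auto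
        thus ?thesis
        proof (cases rule: box_edges_cases)
          case (1 m)
          consider "m = ?a + 1" | "m = ?a + 2" | j where "j < ?L" "m = ?a + 3 + int j"
            using 1 position[of m] by fastforce
          thus ?thesis using e 1 by cases (auto simp: decode_def encode_def bits[simplified])
        next
          case (2 m)
          then obtain j where "j < ?L" "m = ?a + 3 + int j" using position[of m] by auto
          thus ?thesis using e 2 by (auto simp: decode_def encode_def bits[simplified])
        qed
      qed
      ultimately show ?thesis by blast
    qed
  qed
qed

text \<open>
  Prescribing the word \<open>x\<close> in a given position of the box leaves free the two initial edges, the word
  \<open>u\<close> on its left and the word \<open>u'\<close> on its right.
\<close>

lemma card_spanning_trees_word:
  assumes "2 * N - 2 = d + k + e" "N \<ge> 1" "length x = k"
  shows "card {t \<in> spanning_trees (helix_box N) (box_edges N). word t (- int N + 2 + int d) k = x} =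
    (\<Sum>pq\<in>UNIV. \<Sum>u\<in>words d. \<Sum>u'\<in>words e. of_bool (run (initial_type pq) (u @ x @ u') = 1))"
proof -
  let ?a = "- int N" and ?L = "2 * N - 2" and ?ST = "spanning_trees (helix_box N) (box_edges N)"
  let ?g = "\<lambda>(pq, w). of_bool (run (initial_type pq) w = 1 \<and> take k (drop d w) = x) :: nat"
  have sub: "?ST \<subseteq> Pow (box_edges N)" by (auto simp: spanning_trees_def)
  have "{t \<in> ?ST. word t (?a + 2 + int d) k = x} =
      {t \<in> Pow (box_edges N). t \<in> ?ST \<and> word t (?a + 2 + int d) k = x}" using sub by auto
  hence "card {t \<in> ?ST. word t (?a + 2 + int d) k = x} =
      (\<Sum>t\<in>Pow (box_edges N). of_bool (t \<in> ?ST \<and> word t (?a + 2 + int d) k = x))"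
    using sum.inter_filter[of "Pow (box_edges N)" "\<lambda>_. 1 :: nat"] finite_box_edges[of N]
    by (simp add: of_bool_def card_eq_sum del: sum_constant)
  also have "\<dots> = (\<Sum>t\<in>Pow (box_edges N). ?g (encode N t))"
  proof (rule sum.cong[OF refl])
    fix t assume "t \<in> Pow (box_edges N)"
    moreover have "word t (?a + 2) ?L = word t (?a + 2) d @ word t (?a + 2 + int d) k @
        word t (?a + 2 + int d + int k) e"
      unfolding assms(1) by (simp only: word_add of_nat_add append_assoc add.assoc)
    ultimately show "of_bool (t \<in> ?ST \<and> word t (?a + 2 + int d) k = x) = ?g (encode N t)"
      using spanning_tree_iff_run[of t N] assms(2) by (simp add: encode_def)
  qed
  also have "\<dots> = (\<Sum>y\<in>UNIV \<times> words ?L. ?g y)"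
    using sum.reindex_bij_betw[OF bij_betw_encode[OF assms(2)], of ?g] .
  also have "\<dots> = (\<Sum>pq\<in>UNIV. \<Sum>w\<in>words ?L. ?g (pq, w))"
    unfolding sum.cartesian_product by (rule sum.cong) auto
  also have "\<dots> = (\<Sum>pq\<in>UNIV. \<Sum>u\<in>words d. \<Sum>u'\<in>words e.
      of_bool (run (initial_type pq) (u @ x @ u') = 1))"
  proof (rule sum.cong[OF refl])
    fix pq :: "bool \<times> bool"
    have "(\<Sum>w\<in>words ?L. ?g (pq, w)) =
        (\<Sum>u\<in>words d. \<Sum>y\<in>words k. \<Sum>u'\<in>words e. ?g (pq, u @ y @ u'))"
      unfolding assms(1) add.assoc by (simp add: sum_words_add)
    also have "\<dots> = (\<Sum>u\<in>words d. \<Sum>y\<in>words k. if y = x then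
        (\<Sum>u'\<in>words e. of_bool (run (initial_type pq) (u @ y @ u') = 1)) else 0)"
      by (intro sum.cong refl) (auto simp: words_def)
    also have "\<dots> = (\<Sum>u\<in>words d. \<Sum>u'\<in>words e. of_bool (run (initial_type pq) (u @ x @ u') = 1))"
      using assms(3) by (simp add: words_def sum.delta[OF finite_words[unfolded words_def]])
    finally show "(\<Sum>w\<in>words ?L. ?g (pq, w)) = \<dots>" .
  qed
  finally show ?thesis .
qed

section \<open>Perron eigenvectors and transition weights\<close>

text \<open>
  The number \<open>sg\<close> generates a field of degree four that contains all constants of the theorem. With
  \<open>sg ^ 4 = sg\<^sup>2 + 1\<close> every identity between them becomes an identity of polynomials in \<open>sg\<close>.
\<close>

definition sg :: real where
  "sg = sqrt gam"

definition lam :: real where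
  "lam = gam + sqrt gam"

text \<open>
  Right and left eigenvectors, for the eigenvalue \<open>lam\<close>, of the matrix that counts the letters leading
  from one type to another. The value 0 at the dead state makes words without a live run weightless.
\<close>

definition perron :: "nat \<Rightarrow> real" where
  "perron i = (if i = 1 then 1 else if i = 2 then sg\<^sup>2 + sg - 2 else if i = 3 then 1 - sg\<^sup>2 + sg
     else if i = 4 then 2 * sg ^ 3 - 2 * sg - 1 else if i = 5 then sg\<^sup>2 - sg else 0)"

definition perron_left :: "nat \<Rightarrow> real" where
  "perron_left i = (if i = 1 then sg ^ 3 + sg\<^sup>2 + 1 else if i = 2 then sg + 1
     else if i = 3 then sg\<^sup>2 + sg - 1 else if i = 4 then sg ^ 3 - sg else if i = 5 then sg\<^sup>2 else 0)"

text \<open>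
  The stationary law of a chain with weights \<open>v\<^sub>j / (\<lambda> v\<^sub>i)\<close> is the product of the two eigenvectors; the
  factor makes it a probability.
\<close>

definition type_law :: "nat \<Rightarrow> real" where
  "type_law i = perron_left i * perron i / (4 * sqrt 5)"

lemma gam_eq: "gam = sg\<^sup>2" and sqrt5_eq: "sqrt 5 = 2 * sg\<^sup>2 - 1"
proof -
  show "gam = sg\<^sup>2" by (simp add: sg_def gam_def)
  thus "sqrt 5 = 2 * sg\<^sup>2 - 1" by (simp add: gam_def field_simps)
qed

lemma sg_nonneg: "0 \<le> sg"
  by (simp add: sg_def gam_def)

lemma sg_pow4: "sg ^ 4 = sg\<^sup>2 + 1"
proof -
  have "gam\<^sup>2 = gam + 1" by (simp add: gam_def power2_eq_square field_simps)
  thus ?thesis by (simp add: gam_eq)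
qed

lemma lam_eq: "lam = sg\<^sup>2 + sg"
  by (simp add: lam_def gam_eq sg_nonneg)

lemma gam_bounds: "1.618 < gam" "gam < 1.61805"
proof -
  have "2.236 < sqrt (5::real)" by (rule real_less_rsqrt) (simp add: power2_eq_square)
  moreover have "sqrt (5::real) < 2.2361" by (rule real_less_lsqrt) (simp_all add: power2_eq_square)
  ultimately show "1.618 < gam" "gam < 1.61805" by (auto simp: gam_def)
qed

lemma sg_bounds: "1.272 < sg" "sg < 1.2721"
proof -
  show "1.272 < sg" unfolding sg_def
    using gam_bounds by (intro real_less_rsqrt) (simp add: power2_eq_square)
  show "sg < 1.2721" unfolding sg_def
    using gam_bounds by (intro real_less_lsqrt) (simp_all add: power2_eq_square)
qed

lemma lam_pos: "0 < lam" and lam_gt_1: "1 < lam"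
  using sg_bounds gam_bounds by (auto simp: lam_eq gam_eq[symmetric])

lemma lam_inverse: "1 / lam = sg\<^sup>2 - sg"
proof -
  have "(sg\<^sup>2 - sg) * lam = 1" unfolding lam_eq using sg_pow4 by algebra
  thus ?thesis using lam_pos by (simp add: field_simps)
qed

lemma perron_pos: "i \<in> {1..5} \<Longrightarrow> 0 < perron i" and perron_le_1: "perron i \<le> 1"
proof -
  \<comment> \<open>The fourth coordinate is 2 (sg ^ 3 - sg) - 1 and needs a bound on a product.\<close>
  have "1.272 * 0.618 < sg * (gam - 1)" "sg * (gam - 1) < 1.2721 * 0.61805"
    using sg_bounds gam_bounds by (intro mult_strict_mono; simp)+
  hence "0.5 < sg ^ 3 - sg" "sg ^ 3 - sg < 0.79"
    by (simp_all add: gam_eq power2_eq_square power3_eq_cube algebra_simps)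
  thus "i \<in> {1..5} \<Longrightarrow> 0 < perron i" "perron i \<le> 1"
    using sg_bounds gam_bounds
    by (auto simp: types_cases perron_def gam_eq[symmetric])
qed

lemma perron_nonneg: "0 \<le> perron i"
  using perron_pos[of i] by (cases "i \<in> {1..5}") (auto simp: perron_def)

lemma perron_0 [simp]: "perron 0 = 0" "perron (Suc 0) = 1"
  by (simp_all add: perron_def)

lemma perron_values: "perron 1 = 1" "perron 2 = sg\<^sup>2 + sg - 2" "perron 3 = 1 - sg\<^sup>2 + sg"
  "perron 4 = 2 * sg ^ 3 - 2 * sg - 1" "perron 5 = sg\<^sup>2 - sg"
  by (simp_all add: perron_def)

lemma perron_left_values: "perron_left 1 = sg ^ 3 + sg\<^sup>2 + 1" "perron_left 2 = sg + 1"
  "perron_left 3 = sg\<^sup>2 + sg - 1" "perron_left 4 = sg ^ 3 - sg" "perron_left 5 = sg\<^sup>2"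
  by (simp_all add: perron_left_def)

lemma sum_letters: "(\<Sum>l\<in>UNIV. f l) = f (False, False) + f (False, True) + f (True, False) + f (True, True)"
proof -
  have *: "(UNIV :: (bool \<times> bool) set) = {(False, False), (False, True), (True, False), (True, True)}"
    by auto
  show ?thesis unfolding * by (simp add: add_ac)
qed

lemma perron_equations:
  "2 * perron 1 + perron 2 = lam * perron 1"
  "perron 1 + perron 3 + perron 4 + perron 5 = lam * perron 2"
  "perron 1 + perron 2 = lam * perron 3"
  "2 * perron 3 + perron 5 = lam * perron 4"
  "perron 3 + perron 5 = lam * perron 5"
proof -
  show "2 * perron 1 + perron 2 = lam * perron 1"
    unfolding lam_eq perron_values by simp
  show "perron 1 + perron 3 + perron 4 + perron 5 = lam * perron 2"
    unfolding lam_eq perron_values using sg_pow4 by algebra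
  show "perron 1 + perron 2 = lam * perron 3"
    unfolding lam_eq perron_values using sg_pow4 by algebra
  show "2 * perron 3 + perron 5 = lam * perron 4"
    unfolding lam_eq perron_values using sg_pow4 by algebra
  show "perron 3 + perron 5 = lam * perron 5"
    unfolding lam_eq perron_values using sg_pow4 by algebra
qed

lemma perron_eigenvector:
  assumes "i \<in> {1..5}"
  shows "(\<Sum>l\<in>UNIV. perron (step i l)) = lam * perron i"
  using perron_equations assms unfolding types_cases sum_letters
  by (elim disjE) (simp_all add: step_def)

text \<open>
  The conditional probability of a word given the type at which it starts.
\<close>

definition weight :: "nat \<Rightarrow> (bool \<times> bool) list \<Rightarrow> real" where
  "weight i w = perron (run i w) / (lam ^ length w * perron i)"

text \<open>
  The \<open>k\<close>-step transition operator of the chain of types, applied to \<open>f\<close>.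
\<close>

definition average :: "nat \<Rightarrow> (nat \<Rightarrow> real) \<Rightarrow> nat \<Rightarrow> real" where
  "average k f i = (\<Sum>w\<in>words k. weight i w * f (run i w))"

lemma weight_nonneg: "0 \<le> weight i w"
  using lam_pos perron_nonneg by (simp add: weight_def)

lemma weight_dead [simp]: "run i w = 0 \<Longrightarrow> weight i w = 0"
  by (simp add: weight_def)

lemma weight_Nil: "i \<in> {1..5} \<Longrightarrow> weight i [] = 1"
  using perron_pos[of i] by (simp add: weight_def)

lemma weight_append:
  assumes "i \<in> {1..5}"
  shows "weight i (u @ w) = weight i u * weight (run i u) w"
proof (cases "run i u = 0")
  case False
  hence "0 < perron (run i u)" using assms run_nonzero_iff perron_pos by blast
  thus ?thesis by (simp add: weight_def power_add)
qed simp

lemma words_Suc_0: "words (Suc 0) = (\<lambda>l. [l]) ` UNIV"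
  by (auto simp: words_def length_Suc_conv)

lemma sum_words_Suc_0: "(\<Sum>w\<in>words (Suc 0). f w) = (\<Sum>l\<in>UNIV. f [l])"
  unfolding words_Suc_0 by (subst sum.reindex) (auto simp: inj_on_def)

lemma average_0 [simp]: "i \<in> {1..5} \<Longrightarrow> average 0 f i = f i"
  by (simp add: average_def weight_Nil)

lemma average_cong: "i \<in> {1..5} \<Longrightarrow> (\<And>j. j \<in> {1..5} \<Longrightarrow> f j = g j) \<Longrightarrow> average k f i = average k g i"
  unfolding average_def using run_nonzero_iff[of i]
  by (intro sum.cong refl) (metis mult_eq_0_iff weight_dead)

lemma average_add:
  assumes "i \<in> {1..5}"
  shows "average (k + l) f i = average k (average l f) i"
  unfolding average_def sum_words_add
  by (simp add: weight_append[OF assms] sum_distrib_left mult.assoc)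

lemma average_1: "average (Suc 0) f i = (\<Sum>l\<in>UNIV. perron (step i l) * f (step i l)) / (lam * perron i)"
  by (simp add: average_def sum_words_Suc_0 weight_def sum_divide_distrib)

lemma average_const:
  assumes "i \<in> {1..5}"
  shows "average k (\<lambda>_. c) i = c"
  using assms
proof (induction k arbitrary: i)
  case (Suc k)
  have "average (Suc 0 + k) (\<lambda>_. c) i = average (Suc 0) (average k (\<lambda>_. c)) i"
    by (rule average_add[OF Suc.prems])
  also have "\<dots> = average (Suc 0) (\<lambda>_. c) i"
    using Suc by (intro average_cong)
  also have "\<dots> = (\<Sum>l\<in>UNIV. perron (step i l)) * c / (lam * perron i)"
    by (simp add: average_1 sum_distrib_right)
  also have "\<dots> = c"
    using perron_eigenvector[OF Suc.prems] perron_pos[OF Suc.prems] lam_pos by simp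
  finally show ?case by simp
qed simp

lemma sum_weight: "i \<in> {1..5} \<Longrightarrow> (\<Sum>w\<in>words k. weight i w) = 1"
  using average_const[of i k 1] by (simp add: average_def)

lemma type_law_nonneg: "0 \<le> type_law i"
proof -
  have "0 \<le> perron_left i"
    using sg_bounds gam_bounds one_less_power[of sg 3]
    by (auto simp: perron_left_def gam_eq[symmetric] power3_eq_cube)
       (simp add: gam_eq power2_eq_square mult_left_le)
  thus ?thesis using perron_nonneg by (simp add: type_law_def)
qed

lemma sum_type_law: "(\<Sum>i\<in>{1..5}. type_law i) = 1"
proof -
  have "(\<Sum>i\<in>{1..5}. perron_left i * perron i) = 4 * sqrt 5"
    unfolding sum_types sqrt5_eq perron_values perron_left_values using sg_pow4 by algebra
  thus ?thesis by (simp add: type_law_def sum_divide_distrib[symmetric])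
qed

text \<open>
  One step is the left eigenvector equation; further steps are iterates of it by \<open>average_add\<close>.
\<close>

lemma type_law_invariant:
  "(\<Sum>i\<in>{1..5}. type_law i * average k f i) = (\<Sum>i\<in>{1..5}. type_law i * f i)"
proof (induction k arbitrary: f)
  case 0
  show ?case by (intro sum.cong refl) simp
next
  case (Suc k)
  have left: "(\<Sum>i\<in>{1..5}. perron_left i * (\<Sum>l\<in>UNIV. perron (step i l) * g (step i l))) =
      lam * (\<Sum>i\<in>{1..5}. perron_left i * perron i * g i)" for g
  proof -
    have 1: "lam * perron_left 1 = 2 * perron_left 1 + perron_left 2 + perron_left 3"
      unfolding lam_eq perron_left_values using sg_pow4 by algebra
    have 2: "lam * perron_left 2 = perron_left 1 + perron_left 3"
      unfolding lam_eq perron_left_values by algebra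
    have 3: "lam * perron_left 3 = perron_left 2 + 2 * perron_left 4 + perron_left 5"
      unfolding lam_eq perron_left_values using sg_pow4 by algebra
    have 4: "lam * perron_left 4 = perron_left 2"
      unfolding lam_eq perron_left_values using sg_pow4 by algebra
    have 5: "lam * perron_left 5 = perron_left 2 + perron_left 4 + perron_left 5"
      unfolding lam_eq perron_left_values using sg_pow4 by algebra
    from 1 2 3 4 5 show ?thesis
      unfolding sum_types sum_letters
      by (simp add: step_def) (algebra)
  qed
  have "type_law i * average (Suc 0) g i =
      perron_left i * (\<Sum>l\<in>UNIV. perron (step i l) * g (step i l)) / (4 * sqrt 5 * lam)"
    if "i \<in> {1..5}" for i g
    using perron_pos[OF that] lam_pos by (simp add: type_law_def average_1 field_simps)
  hence one: "(\<Sum>i\<in>{1..5}. type_law i * average (Suc 0) g i) = (\<Sum>i\<in>{1..5}. type_law i * g i)" for g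
    using lam_pos left[of g] by (simp add: sum_divide_distrib[symmetric] type_law_def)
  have "(\<Sum>i\<in>{1..5}. type_law i * average (Suc k) f i) =
      (\<Sum>i\<in>{1..5}. type_law i * average (Suc 0) (average k f) i)"
    using average_add[of _ "Suc 0" k f] by (intro sum.cong) auto
  thus ?case using one Suc.IH by simp
qed

section \<open>Geometric ergodicity\<close>

text \<open>
  The last two letters are \<open>z\<close>-edges without \<open>h\<close>-edges; they will make the reset visible in the tree
  without knowledge of the type. The first two letters lead to type 1, by way of type 3 from types 4
  and 5.
\<close>

lemma reset_word_exists:
  assumes "i \<in> {1..5}"
  obtains u where "u \<in> words 4" "run i u = 1" "drop 2 u = [(False, True), (False, True)]"
proof -
  let ?z = "(False, True)"
  have "\<exists>u. u \<in> words 4 \<and> run i u = 1 \<and> drop 2 u = [?z, ?z]"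
    using assms unfolding types_cases
  proof (elim disjE)
    assume "i = 1" thus ?thesis
      by (intro exI[of _ "[?z, ?z, ?z, ?z]"]) (simp add: words_def step_def)
  next
    assume "i = 2" thus ?thesis
      by (intro exI[of _ "[(True, True), ?z, ?z, ?z]"]) (simp add: words_def step_def)
  next
    assume "i = 3" thus ?thesis
      by (intro exI[of _ "[(True, True), ?z, ?z, ?z]"]) (simp add: words_def step_def)
  next
    assume "i = 4" thus ?thesis
      by (intro exI[of _ "[(True, False), (True, True), ?z, ?z]"]) (simp add: words_def step_def)
  next
    assume "i = 5" thus ?thesis
      by (intro exI[of _ "[(True, True), (True, True), ?z, ?z]"]) (simp add: words_def step_def)
  qed
  thus ?thesis using that by blast
qed

text \<open>
  A reset word leads to type 1, where the eigenvector is 1, and starts where it is at most 1.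
\<close>

definition reset_prob :: real where
  "reset_prob = 1 / lam ^ 4"

lemma reset_prob_bounds: "0 < reset_prob" "reset_prob < 1"
  using lam_gt_1 one_less_power[of lam 4] by (simp_all add: reset_prob_def)

lemma weight_reset:
  assumes "i \<in> {1..5}" "u \<in> words 4" "run i u = 1"
  shows "reset_prob \<le> weight i u"
  using assms perron_pos[of i] perron_le_1[of i] lam_pos
  by (simp add: weight_def words_def reset_prob_def frac_le)

text \<open>
  Doeblin's minorisation: four steps dominate the multiple \<open>reset_prob\<close> of the point mass at type 1.
\<close>

lemma average_mono_reset:
  assumes i: "i \<in> {1..5}" and f: "\<And>j. j \<in> {1..5} \<Longrightarrow> 0 \<le> f j"
  shows "reset_prob * f 1 \<le> average 4 f i"
proof -
  obtain u where u: "u \<in> words 4" "run i u = 1" using reset_word_exists[OF i] by metis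
  have nonneg: "0 \<le> weight i w * f (run i w)" for w
    using f[of "run i w"] run_nonzero_iff[OF i, of w] weight_nonneg[of i w]
    by (cases "run i w = 0") auto
  have "reset_prob * f 1 \<le> weight i u * f (run i u)"
    using weight_reset[OF i u] f[of 1] u(2) by (simp add: mult_right_mono)
  also have "\<dots> \<le> average 4 f i"
    unfolding average_def using u(1) nonneg by (intro member_le_sum) auto
  finally show ?thesis .
qed

lemma average_diff: "average k (\<lambda>j. f j - g j) i = average k f i - average k g i"
  by (simp add: average_def algebra_simps sum_subtractf)

lemma average_nonneg:
  assumes i: "i \<in> {1..5}" and f: "\<And>j. j \<in> {1..5} \<Longrightarrow> 0 \<le> f j"
  shows "0 \<le> average k f i"
  unfolding average_def
proof (rule sum_nonneg)
  fix w show "0 \<le> weight i w * f (run i w)"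
    using f[of "run i w"] run_nonzero_iff[OF i, of w] weight_nonneg[of i w]
    by (cases "run i w = 0") auto
qed

text \<open>
  The oscillation of a function over the types does not grow under averaging, and every four steps
  multiply it by at most \<open>1 - reset_prob\<close>, since all averages share the part \<open>reset_prob * f 1\<close>.
\<close>

lemma average_contracts:
  assumes "\<forall>i\<in>{1..5}. a \<le> f i \<and> f i \<le> a + d"
  shows "\<exists>a'. \<forall>i\<in>{1..5}. a' \<le> average k f i \<and> average k f i \<le> a' + (1 - reset_prob) ^ (k div 4) * d"
  using assms
proof (induction k arbitrary: f a d rule: less_induct)
  case (less k)
  show ?case
  proof (cases "k < 4")
    case True
    have "a \<le> average k f i \<and> average k f i \<le> a + d" if "i \<in> {1..5}" for i
      using average_nonneg[OF that, of "\<lambda>j. f j - a" k] average_nonneg[OF that, of "\<lambda>j. (a + d) - f j" k]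
        less.prems average_const[OF that] by (simp add: average_diff)
    thus ?thesis using True by (intro exI[of _ a]) simp
  next
    case False
    define g where "g = average (k - 4) f"
    obtain b where b: "\<forall>i\<in>{1..5}. b \<le> g i \<and> g i \<le> b + (1 - reset_prob) ^ ((k - 4) div 4) * d"
      unfolding g_def using less.IH[OF _ less.prems, of "k - 4"] False by auto
    let ?d = "(1 - reset_prob) ^ ((k - 4) div 4) * d"
    have "k div 4 = Suc ((k - 4) div 4)" using False by (simp add: le_div_geq)
    hence d: "(1 - reset_prob) ^ (k div 4) * d = ?d - reset_prob * ?d" by (simp add: algebra_simps)
    have avg: "average k f i = average 4 g i" if "i \<in> {1..5}" for i
      using average_add[OF that, of 4 "k - 4" f] False by (simp add: g_def)
    \<comment> \<open>The minorisation is applied to the nonnegative functions g - b and b + ?d - g.\<close>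
    have "b + reset_prob * (g 1 - b) \<le> average k f i \<and>
        average k f i \<le> b + reset_prob * (g 1 - b) + (?d - reset_prob * ?d)" if i: "i \<in> {1..5}" for i
      using average_mono_reset[OF i, of "\<lambda>j. g j - b"] average_mono_reset[OF i, of "\<lambda>j. (b + ?d) - g j"]
        b average_const[OF i] by (simp add: average_diff avg[OF i] algebra_simps)
    thus ?thesis unfolding d by blast
  qed
qed

text \<open>
  The stationary mean lies in the shrinking range of the averages because averaging preserves it.
\<close>

lemma average_tendsto:
  assumes "i \<in> {1..5}"
  shows "(\<lambda>k. average k f i) \<longlonglongrightarrow> (\<Sum>j\<in>{1..5}. type_law j * f j)"
proof -
  define L where "L = (\<Sum>j\<in>{1..5}. type_law j * f j)"
  define B where "B = (\<Sum>j\<in>{1..5}. \<bar>f j\<bar>)"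
  have B: "\<forall>j\<in>{1..5}. - B \<le> f j \<and> f j \<le> - B + 2 * B"
  proof
    fix j :: nat assume "j \<in> {1..5}"
    hence "\<bar>f j\<bar> \<le> B" unfolding B_def by (intro member_le_sum) auto
    thus "- B \<le> f j \<and> f j \<le> - B + 2 * B" by linarith
  qed
  have bound: "norm (average k f i - L) \<le> (1 - reset_prob) ^ (k div 4) * (2 * B)" for k
  proof -
    let ?d = "(1 - reset_prob) ^ (k div 4) * (2 * B)"
    obtain a where a: "\<forall>j\<in>{1..5}. a \<le> average k f j \<and> average k f j \<le> a + ?d"
      using average_contracts[OF B] by blast
    have "(\<Sum>j\<in>{1..5}. type_law j * a) \<le> (\<Sum>j\<in>{1..5}. type_law j * average k f j)"
      "(\<Sum>j\<in>{1..5}. type_law j * average k f j) \<le> (\<Sum>j\<in>{1..5}. type_law j * (a + ?d))"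
      using a type_law_nonneg by (intro sum_mono mult_left_mono; simp)+
    hence "a \<le> L" "L \<le> a + ?d"
      unfolding type_law_invariant L_def[symmetric] sum_distrib_right[symmetric] sum_type_law by simp_all
    thus ?thesis using bspec[OF a assms] by (simp add: abs_le_iff)
  qed
  have null: "(\<lambda>k. (1 - reset_prob) ^ (k div 4) * (2 * B)) \<longlonglongrightarrow> 0 * (2 * B)"
  proof (intro tendsto_mult tendsto_const)
    have "filterlim (\<lambda>k::nat. k div 4) at_top sequentially"
      unfolding filterlim_at_top
    proof
      fix Z :: nat
      show "\<forall>\<^sub>F k in sequentially. Z \<le> k div 4"
        by (rule eventually_sequentiallyI[of "4 * Z"]) simp
    qed
    thus "(\<lambda>k. (1 - reset_prob) ^ (k div 4)) \<longlonglongrightarrow> 0"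
      using filterlim_compose[OF LIMSEQ_realpow_zero[of "1 - reset_prob"]] reset_prob_bounds by simp
  qed
  have "(\<lambda>k. average k f i - L) \<longlonglongrightarrow> 0"
    by (rule Lim_null_comparison[OF always_eventually[OF allI[OF bound]]]) (use null in simp)
  thus ?thesis unfolding L_def by (rule LIM_zero_cancel)
qed

text \<open>
  There are finitely many types, so the function may vary while the number of steps grows. This
  occurs for a window in a box whose two sides both recede.
\<close>

lemma average_tendsto_joint:
  assumes i: "i \<in> {1..5}" and d: "filterlim d at_top sequentially"
    and h: "\<And>j. j \<in> {1..5} \<Longrightarrow> (\<lambda>N. h N j) \<longlonglongrightarrow> g j"
  shows "(\<lambda>N. average (d N) (h N) i) \<longlonglongrightarrow> (\<Sum>j\<in>{1..5}. type_law j * g j)"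
proof -
  have decomp: "average k f i = (\<Sum>j\<in>{1..5}. average k (\<lambda>r. of_bool (r = j)) i * f j)" for k f
  proof -
    have "average k f i = average k (\<lambda>r. \<Sum>j\<in>{1..5}. of_bool (r = j) * f j) i"
      using i by (intro average_cong) (auto simp: sum_types types_cases)
    also have "\<dots> = (\<Sum>w\<in>words k. \<Sum>j\<in>{1..5}. weight i w * of_bool (run i w = j) * f j)"
      by (simp only: average_def sum_distrib_left mult.assoc)
    also have "\<dots> = (\<Sum>j\<in>{1..5}. average k (\<lambda>r. of_bool (r = j)) i * f j)"
      by (subst sum.swap) (simp only: average_def sum_distrib_right)
    finally show ?thesis .
  qed
  have "(\<lambda>N. average (d N) (\<lambda>r. of_bool (r = j)) i) \<longlonglongrightarrow> type_law j" if "j \<in> {1..5}" for j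
  proof -
    have "(\<Sum>r\<in>{1..5}. type_law r * of_bool (r = j)) = type_law j"
      using that by (auto simp: sum_types types_cases)
    thus ?thesis
      using filterlim_compose[OF average_tendsto[OF i, of "\<lambda>r. of_bool (r = j)"] d] by simp
  qed
  thus ?thesis unfolding decomp[of _ "h _"] using h by (intro tendsto_sum tendsto_mult)
qed

section \<open>Words in the uniform spanning trees of large boxes\<close>

text \<open>
  The probability of a word under the stationary chain, with the type at its start averaged out.
\<close>

definition word_law :: "(bool \<times> bool) list \<Rightarrow> real" where
  "word_law w = (\<Sum>i\<in>{1..5}. type_law i * weight i w)"

lemma word_law_Nil: "word_law [] = 1"
proof -
  have "word_law [] = (\<Sum>i\<in>{1..5}. type_law i)"
    unfolding word_law_def by (intro sum.cong refl) (simp add: weight_Nil)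
  thus ?thesis by (simp only: sum_type_law)
qed

lemma initial_type_range: "initial_type pq \<in> {1..5}"
  by (cases pq) (auto simp: initial_type_def split: bool.splits)

text \<open>
  Rewriting counts as weights: a run from \<open>i\<close> to type 1 of length \<open>n\<close> has weight
  \<open>1 / (lam ^ n * perron i)\<close>.
\<close>

lemma count_runs:
  assumes i: "i \<in> {1..5}"
  shows "(\<Sum>u\<in>words d. \<Sum>u'\<in>words e. of_bool (run i (u @ x @ u') = 1)) =
    lam ^ (d + length x + e) * (perron i *
      average d (\<lambda>j. weight j x * average e (\<lambda>r. of_bool (r = 1)) (run j x)) i)"
proof -
  have "of_bool (run i (u @ x @ u') = 1) = lam ^ (d + length x + e) * (perron i *
      (weight i u * (weight (run i u) x * (weight (run (run i u) x) u' *
        of_bool (run (run (run i u) x) u' = 1)))))"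
    if "u \<in> words d" "u' \<in> words e" for u u'
  proof (cases "run i (u @ x @ u') = 1")
    case True
    hence live: "run i u \<noteq> 0" by (metis One_nat_def run_0 run_simps(3) zero_neq_one)
    hence j: "run i u \<in> {1..5}" using run_nonzero_iff[OF i] by simp
    have "weight i u * (weight (run i u) x * weight (run (run i u) x) u') = weight i (u @ x @ u')"
      by (simp add: weight_append[OF i] weight_append[OF j] del: append_assoc)
    moreover have "lam ^ (d + length x + e) * (perron i * weight i (u @ x @ u')) = 1"
      using True that perron_pos[OF i] lam_pos by (simp add: weight_def words_def add.assoc)
    ultimately show ?thesis using True by (simp add: mult.assoc)
  qed simp
  hence "(\<Sum>u\<in>words d. \<Sum>u'\<in>words e. of_bool (run i (u @ x @ u') = 1)) =
    (\<Sum>u\<in>words d. \<Sum>u'\<in>words e. lam ^ (d + length x + e) * (perron i *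
      (weight i u * (weight (run i u) x * (weight (run (run i u) x) u' *
        of_bool (run (run (run i u) x) u' = 1))))))"
    by (intro sum.cong refl) 
  also have "\<dots> = lam ^ (d + length x + e) * (perron i *
      average d (\<lambda>j. weight j x * average e (\<lambda>r. of_bool (r = 1)) (run j x)) i)"
    by (simp only: average_def sum_distrib_left)
  finally show ?thesis .
qed

lemma filterlim_nat_add: "filterlim (\<lambda>N. nat (int N + c)) at_top sequentially"
  unfolding filterlim_at_top
proof
  fix Z :: nat
  show "\<forall>\<^sub>F N in sequentially. Z \<le> nat (int N + c)"
    by (rule eventually_sequentiallyI[of "Z + nat \<bar>c\<bar>"]) linarith
qed

text \<open>
  The limit of the number of spanning trees of the box, divided by \<open>lam ^ (2 * N - 2)\<close>.
\<close>

definition initial_mass :: real where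
  "initial_mass = (\<Sum>pq\<in>UNIV. perron (initial_type pq)) * type_law 1"

lemma initial_mass_pos: "0 < initial_mass"
proof -
  have "0 < (\<Sum>pq\<in>UNIV. perron (initial_type pq))"
    using perron_pos[OF initial_type_range] by (intro sum_pos) auto
  moreover have "0 < type_law 1"
  proof -
    have "0 < perron_left 1" unfolding perron_left_values using sg_bounds by (simp add: add_pos_pos)
    thus ?thesis by (simp add: type_law_def)
  qed
  ultimately show ?thesis by (simp add: initial_mass_def)
qed

text \<open>
  Up to the factor \<open>lam ^ (2 * N - 2)\<close>, the number of trees with the word \<open>x\<close> in its place is an average
  over the letters on the left of \<open>x\<close> of an average over the letters on the right; in the limit the type
  before \<open>x\<close> and the event of ending at type 1 become independent and stationary.
\<close>

lemma card_spanning_trees_word_tendsto: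
  assumes "length x = k"
  shows "(\<lambda>N. real (card {t \<in> spanning_trees (helix_box N) (box_edges N). word t m k = x}) / lam ^ (2 * N - 2))
    \<longlonglongrightarrow> initial_mass * word_law x"
proof -
  \<comment> \<open>The numbers of letters to the left and to the right of the window in the box.\<close>
  define d e where "d N = nat (int N + (m - 2))" and "e N = nat (int N + (- m - int k))" for N
  let ?h = "\<lambda>N j. weight j x * average (e N) (\<lambda>r. of_bool (r = 1)) (run j x)"
  let ?S = "\<lambda>N. \<Sum>pq\<in>UNIV. perron (initial_type pq) * average (d N) (?h N) (initial_type pq)"
  have "(\<lambda>N. average (d N) (?h N) (initial_type pq)) \<longlonglongrightarrow>
      (\<Sum>j\<in>{1..5}. type_law j * (weight j x * type_law 1))" for pq
  proof (rule average_tendsto_joint[OF initial_type_range])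
    show "filterlim d at_top sequentially" unfolding d_def by (rule filterlim_nat_add)
    fix j :: nat assume j: "j \<in> {1..5}"
    show "(\<lambda>N. weight j x * average (e N) (\<lambda>r. of_bool (r = 1)) (run j x)) \<longlonglongrightarrow> weight j x * type_law 1"
    proof (cases "run j x = 0")
      case False
      hence "run j x \<in> {1..5}" using run_nonzero_iff[OF j] by simp
      hence "(\<lambda>n. average n (\<lambda>r. of_bool (r = 1)) (run j x)) \<longlonglongrightarrow> (\<Sum>r\<in>{1..5}. type_law r * of_bool (r = 1))"
        by (rule average_tendsto)
      also have "(\<Sum>r\<in>{1..5}. type_law r * of_bool (r = 1)) = type_law 1"
        by (simp only: sum_types) simp
      finally have "(\<lambda>N. average (e N) (\<lambda>r. of_bool (r = 1)) (run j x)) \<longlonglongrightarrow> type_law 1"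
        by (rule filterlim_compose) (unfold e_def, rule filterlim_nat_add)
      thus ?thesis by (intro tendsto_mult tendsto_const)
    qed simp
  qed
  hence "?S \<longlonglongrightarrow> (\<Sum>pq\<in>UNIV. perron (initial_type pq) *
      (\<Sum>j\<in>{1..5}. type_law j * (weight j x * type_law 1)))"
    by (intro tendsto_sum tendsto_mult_left)
  also have "(\<Sum>pq\<in>UNIV. perron (initial_type pq) *
      (\<Sum>j\<in>{1..5}. type_law j * (weight j x * type_law 1))) = initial_mass * word_law x"
  proof -
    have "(\<Sum>j\<in>{1..5}. type_law j * (weight j x * type_law 1)) = type_law 1 * word_law x"
      unfolding word_law_def sum_distrib_left by (intro sum.cong refl) simp
    thus ?thesis by (simp add: initial_mass_def sum_distrib_right mult.assoc)
  qed
  finally have S: "?S \<longlonglongrightarrow> initial_mass * word_law x" .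
  have "\<forall>\<^sub>F N in sequentially.
      ?S N = real (card {t \<in> spanning_trees (helix_box N) (box_edges N). word t m k = x}) / lam ^ (2 * N - 2)"
  proof (rule eventually_sequentiallyI[of "nat \<bar>m\<bar> + k + 2"])
    fix N assume N: "nat \<bar>m\<bar> + k + 2 \<le> N"
    have pos: "2 * N - 2 = d N + k + e N" "- int N + 2 + int (d N) = m" "N \<ge> 1"
      using N by (auto simp: d_def e_def)
    have "real (card {t \<in> spanning_trees (helix_box N) (box_edges N). word t m k = x}) =
        (\<Sum>pq\<in>UNIV. \<Sum>u\<in>words (d N). \<Sum>u'\<in>words (e N). of_bool (run (initial_type pq) (u @ x @ u') = 1))"
      using card_spanning_trees_word[OF pos(1,3) assms] unfolding pos(2) by simp
    also have "\<dots> = lam ^ (2 * N - 2) * ?S N"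
      by (simp only: count_runs[OF initial_type_range] pos(1) assms sum_distrib_left)
    finally show "?S N = real (card {t \<in> spanning_trees (helix_box N) (box_edges N). word t m k = x}) / lam ^ (2 * N - 2)"
      using lam_pos by simp
  qed
  with S show ?thesis by (rule Lim_transform_eventually)
qed

lemma finite_ust_word_tendsto:
  assumes "length x = k"
  shows "(\<lambda>N. measure_pmf.prob (finite_ust N) {t. word t m k = x}) \<longlonglongrightarrow> word_law x"
proof -
  let ?ST = "\<lambda>N. spanning_trees (helix_box N) (box_edges N)"
  let ?c = "\<lambda>N. real (card {t \<in> ?ST N. word t m k = x}) / lam ^ (2 * N - 2)"
  let ?C = "\<lambda>N. real (card (?ST N)) / lam ^ (2 * N - 2)"
  have C: "?C \<longlonglongrightarrow> initial_mass"
    using card_spanning_trees_word_tendsto[of "[]" 0 m] by (simp add: word_law_Nil)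
  have "(\<lambda>N. ?c N / ?C N) \<longlonglongrightarrow> initial_mass * word_law x / initial_mass"
    using initial_mass_pos card_spanning_trees_word_tendsto[OF assms, of m] C
    by (intro tendsto_divide) auto
  hence "(\<lambda>N. ?c N / ?C N) \<longlonglongrightarrow> word_law x" using initial_mass_pos by simp
  moreover have "\<forall>\<^sub>F N in sequentially. 0 < ?C N"
    using C initial_mass_pos by (rule order_tendstoD)
  hence "\<forall>\<^sub>F N in sequentially. ?c N / ?C N = measure_pmf.prob (finite_ust N) {t. word t m k = x}"
  proof eventually_elim
    case (elim N)
    hence "0 < card (?ST N)" using lam_pos by (auto simp: zero_less_divide_iff)
    hence "?ST N \<noteq> {}" "finite (?ST N)" by (auto simp: card_gt_0_iff)
    moreover have "?ST N \<inter> {t. word t m k = x} = {t \<in> ?ST N. word t m k = x}" by auto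
    ultimately show ?case
      using lam_pos by (simp add: finite_ust_def box_edges_def[symmetric] measure_pmf_of_set)
  qed
  ultimately show ?thesis by (rule Lim_transform_eventually)
qed

section \<open>Words that reset the automaton\<close>

text \<open>
  A reset must be recognisable from the letters alone, whatever the type before.
\<close>

definition has_reset :: "(bool \<times> bool) list \<Rightarrow> bool" where
  "has_reset w \<longleftrightarrow> (\<exists>u v. w = u @ [(False, True), (False, True)] @ v)"

text \<open>
  A letter with a \<open>z\<close>-edge leads to type 1 or 3, and a second one leads from both of these to type 1.
\<close>

lemma run_z_z:
  assumes "snd l" "snd l'" "run i [l, l'] \<noteq> 0"
  shows "run i [l, l'] = 1"
proof -
  have "step i l \<in> {0, 1, 3}"
    using assms(1) by (cases l) (simp add: step_def split: bool.splits)
  moreover have "step 1 l' \<in> {0, 1}" "step 3 l' \<in> {0, 1}"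
    using assms(2) by (cases l'; simp add: step_def split: bool.splits)+
  ultimately show ?thesis using assms(3) by auto
qed

lemma has_reset_run_eq:
  assumes "has_reset w" "run i w \<noteq> 0" "run j w \<noteq> 0"
  shows "run i w = run j w"
proof -
  obtain u v where w: "w = u @ [(False, True), (False, True)] @ v"
    using assms(1) by (auto simp: has_reset_def)
  have "run (run r u) [(False, True), (False, True)] = 1" if "run r w \<noteq> 0" for r
  proof (rule run_z_z)
    show "run (run r u) [(False, True), (False, True)] \<noteq> 0"
      using that unfolding w by (metis run_0 run_simps(3))
  qed simp_all
  hence "run r w = run 1 v" if "run r w \<noteq> 0" for r
    using that unfolding w by (metis run_simps(3))
  thus ?thesis using assms(2,3) by metis
qed

lemma has_reset_append: "has_reset u \<Longrightarrow> has_reset (u @ w)" "has_reset w \<Longrightarrow> has_reset (u @ w)"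
proof -
  show "has_reset (u @ w)" if "has_reset u"
    using that unfolding has_reset_def by (metis append_assoc)
  show "has_reset (u @ w)" if "has_reset w"
    using that unfolding has_reset_def by (metis append_assoc)
qed

text \<open>
  In each of \<open>s\<close> consecutive blocks of four letters, a reset word is missed with probability at most
  \<open>1 - reset_prob\<close>, whatever the type at the start of the block.
\<close>

lemma no_reset_weight_le:
  assumes "i \<in> {1..5}"
  shows "(\<Sum>w\<in>words (4 * s). weight i w * of_bool (\<not> has_reset w)) \<le> (1 - reset_prob) ^ s"
  using assms
proof (induction s arbitrary: i)
  case 0
  thus ?case by (cases "has_reset []") (simp_all add: weight_Nil)
next
  case (Suc s)
  note i = Suc.prems
  obtain u\<^sub>0 where u\<^sub>0: "u\<^sub>0 \<in> words 4" "run i u\<^sub>0 = 1" "drop 2 u\<^sub>0 = [(False, True), (False, True)]"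
    using reset_word_exists[OF i] .
  have "has_reset u\<^sub>0"
    unfolding has_reset_def by (metis u\<^sub>0(3) append_Nil2 append_take_drop_id)
  let ?b = "\<lambda>w. of_bool (\<not> has_reset w) :: real"
  have "(\<Sum>w\<in>words (4 * Suc s). weight i w * ?b w) =
      (\<Sum>u\<in>words 4. \<Sum>w\<in>words (4 * s). weight i (u @ w) * ?b (u @ w))"
    using sum_words_add[of "\<lambda>w. weight i w * ?b w" 4 "4 * s"] by simp
  also have "\<dots> \<le> (\<Sum>u\<in>words 4. \<Sum>w\<in>words (4 * s). weight i u * ?b u * (weight (run i u) w * ?b w))"
  proof (intro sum_mono)
    fix u w
    have "?b (u @ w) \<le> ?b u * ?b w" using has_reset_append[of u w] has_reset_append(2)[of w u] by auto
    hence "weight i (u @ w) * ?b (u @ w) \<le> weight i (u @ w) * (?b u * ?b w)"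
      using weight_nonneg by (intro mult_left_mono)
    thus "weight i (u @ w) * ?b (u @ w) \<le> weight i u * ?b u * (weight (run i u) w * ?b w)"
      by (simp only: weight_append[OF i] mult_ac)
  qed
  also have "\<dots> = (\<Sum>u\<in>words 4. weight i u * ?b u * (\<Sum>w\<in>words (4 * s). weight (run i u) w * ?b w))"
    by (simp only: sum_distrib_left)
  also have "\<dots> \<le> (\<Sum>u\<in>words 4. weight i u * ?b u * (1 - reset_prob) ^ s)"
  proof (intro sum_mono)
    fix u
    show "weight i u * ?b u * (\<Sum>w\<in>words (4 * s). weight (run i u) w * ?b w) \<le>
        weight i u * ?b u * (1 - reset_prob) ^ s"
    proof (cases "run i u = 0")
      case False
      hence "run i u \<in> {1..5}" using run_nonzero_iff[OF i] by simp
      thus ?thesis using Suc.IH weight_nonneg by (intro mult_left_mono) simp_all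
    qed simp
  qed
  also have "\<dots> = (\<Sum>u\<in>words 4. weight i u * ?b u) * (1 - reset_prob) ^ s"
    by (simp only: sum_distrib_right)
  also have "\<dots> \<le> (1 - reset_prob) * (1 - reset_prob) ^ s"
  proof (rule mult_right_mono)
    have "(\<Sum>u\<in>words 4. weight i u * ?b u) \<le> (\<Sum>u\<in>words 4. weight i u * of_bool (u \<noteq> u\<^sub>0))"
      using \<open>has_reset u\<^sub>0\<close> weight_nonneg by (intro sum_mono mult_left_mono) auto
    also have "\<dots> = (\<Sum>u\<in>words 4. weight i u - (if u = u\<^sub>0 then weight i u else 0))"
      by (intro sum.cong) auto
    also have "\<dots> = 1 - weight i u\<^sub>0"
      using u\<^sub>0(1) by (simp add: sum_subtractf sum_weight[OF i] sum.delta)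
    also have "\<dots> \<le> 1 - reset_prob" using weight_reset[OF i u\<^sub>0(1,2)] by simp
    finally show "(\<Sum>u\<in>words 4. weight i u * ?b u) \<le> 1 - reset_prob" .
  qed (use reset_prob_bounds in simp)
  finally show ?case by simp
qed

lemma no_reset_word_law_le:
  "(\<Sum>w\<in>words (4 * s). word_law w * of_bool (\<not> has_reset w)) \<le> (1 - reset_prob) ^ s"
proof -
  have "(\<Sum>w\<in>words (4 * s). word_law w * of_bool (\<not> has_reset w)) =
      (\<Sum>i\<in>{1..5}. type_law i * (\<Sum>w\<in>words (4 * s). weight i w * of_bool (\<not> has_reset w)))"
    unfolding word_law_def sum_distrib_right sum_distrib_left
    by (subst sum.swap) (simp only: mult.assoc)
  also have "\<dots> \<le> (\<Sum>i\<in>{1..5}. type_law i * (1 - reset_prob) ^ s)"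
    using no_reset_weight_le type_law_nonneg by (intro sum_mono mult_left_mono)
  also have "\<dots> = (1 - reset_prob) ^ s"
    by (simp only: sum_distrib_right[symmetric] sum_type_law mult_1)
  finally show ?thesis .
qed

section \<open>Types determined by resets in the past\<close>

text \<open>
  The vertices \<open>k - 2\<close>, \<open>k - 1\<close>, \<open>k\<close> are joined by edges between them.
\<close>

definition anchor :: "int set set \<Rightarrow> int \<Rightarrow> bool" where
  "anchor t k \<longleftrightarrow> z_edge (k - 1) \<in> t \<and> z_edge k \<in> t"

text \<open>
  The properties that hold almost surely and suffice to compute the type from finitely many edges. The
  second one says that every finite piece looks like a piece of a spanning tree of a box.
\<close>

definition regular :: "int set set \<Rightarrow> bool" where
  "regular t \<longleftrightarrow> t \<subseteq> helix_edges \<and> (\<forall>m k. \<exists>i\<in>{1..5}. run i (word t m k) \<noteq> 0) \<and>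
     (\<forall>n. \<exists>k\<le>n. anchor t k)"

lemma regular_run_anchor:
  assumes "regular t" "anchor t k"
  shows "run 1 (word t k n) \<noteq> 0"
proof -
  obtain i where "run i (word t (k - 2) (2 + n)) \<noteq> 0"
    using assms(1) unfolding regular_def by blast
  moreover have "word t (k - 2) (2 + n) = [letter t (k - 1), letter t k] @ word t k n"
    unfolding word_add by (simp add: word_def numeral_2_eq_2)
  ultimately have live: "run (run i [letter t (k - 1), letter t k]) (word t k n) \<noteq> 0"
    by (simp only: run_simps(3) not_False_eq_True)
  hence "run i [letter t (k - 1), letter t k] \<noteq> 0" by (metis run_0)
  hence "run i [letter t (k - 1), letter t k] = 1"
    using assms(2) by (intro run_z_z) (auto simp: letter_def anchor_def)
  from live[unfolded this] show ?thesis .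
qed

lemma anchor_linked:
  assumes "anchor t k" "{k - 2, k - 1, k} \<subseteq> S"
  shows "linked S t k k (k - 1)" "linked S t k k (k - 2)"
proof -
  have "{k - 1, k} \<in> induced_edges t (S \<inter> {..k})" "{k - 2, k - 1} \<in> induced_edges t (S \<inter> {..k})"
    using assms by (auto simp: anchor_def z_edge_def induced_edges_def)
  hence "linked S t k (k - 1) k" "linked S t k (k - 2) (k - 1)"
    unfolding linked_def by (auto intro: reachable_edge)
  thus "linked S t k k (k - 1)" "linked S t k k (k - 2)"
    by (metis linked_sym linked_trans)+
qed

text \<open>
  An anchor at \<open>k\<close> joins the window, so it remains to connect an arbitrary older vertex \<open>x\<close> to \<open>k\<close>. A
  second anchor \<open>k'\<close> to the left of \<open>x\<close> starts a run on \<open>{k' - 2..}\<close> at type 1; this run stays alive up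
  to \<open>k\<close>, so that every vertex of that half-line, in particular \<open>x\<close>, is connected to the window at \<open>k\<close>.
\<close>

lemma anchor_has_type:
  assumes t: "regular t" and k: "anchor t k"
  shows "has_type UNIV t k 1"
  unfolding has_type_1_iff
proof (intro conjI ballI impI)
  show "linked UNIV t k k (k - 1)" "linked UNIV t k k (k - 2)" using anchor_linked[OF k] by auto
  fix x assume "x \<le> k"
  obtain k' where k': "k' \<le> x" "anchor t k'" using t unfolding regular_def by blast
  let ?S = "{k' - 2..}"
  have "has_type ?S t k' 1"
    unfolding has_type_1_iff
  proof (intro conjI ballI impI)
    show l: "linked ?S t k' k' (k' - 1)" "linked ?S t k' k' (k' - 2)"
      using anchor_linked[OF k'(2), of ?S] by auto
    fix y assume "y \<in> ?S" "y \<le> k'"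
    hence "y = k' \<or> y = k' - 1 \<or> y = k' - 2" by auto
    thus "linked ?S t k' y k'" using l linked_sym by auto
  qed
  moreover have "t \<subseteq> helix_edges" using t by (simp add: regular_def)
  moreover have "run 1 (word t k' (nat (k - k'))) \<noteq> 0" using t k'(2) by (rule regular_run_anchor)
  ultimately have "has_type ?S t (k' + int (nat (k - k'))) (run 1 (word t k' (nat (k - k'))))"
    by (intro has_type_run) auto
  hence type: "has_type ?S t k (run 1 (word t k' (nat (k - k'))))" (is "has_type _ _ _ ?i")
    using k' \<open>x \<le> k\<close> by simp
  have "linked ?S t k k (k - 1)" "linked ?S t k k (k - 2)"
    using anchor_linked[OF k, of ?S] k' \<open>x \<le> k\<close> by auto
  moreover have "x \<in> ?S" using k' by simp
  hence "linked ?S t k x k \<or> linked ?S t k x (k - 1) \<or> linked ?S t k x (k - 2)"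
    using type \<open>x \<le> k\<close> unfolding has_type_def by blast
  ultimately have "linked ?S t k x k" by (metis linked_sym linked_trans)
  thus "linked UNIV t k x k" by (rule linked_mono[rotated]) simp
qed

lemma regular_run:
  assumes t: "regular t" and i: "has_type UNIV t m i"
  shows "run i (word t m k) \<noteq> 0" "has_type UNIV t (m + int k) (run i (word t m k))"
proof -
  have sub: "t \<subseteq> helix_edges" using t by (simp add: regular_def)
  obtain n where n: "n \<le> m" "anchor t n" using t unfolding regular_def by blast
  have mn: "n + int (nat (m - n)) = m" using n by simp
  have "has_type UNIV t (n + int (nat (m - n))) (run 1 (word t n (nat (m - n))))"
    using sub regular_run_anchor[OF t n(2)] anchor_has_type[OF t n(2)] by (intro has_type_run) auto
  hence "run 1 (word t n (nat (m - n))) = i" using has_type_unique i unfolding mn by blast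
  moreover have "word t n (nat (m - n) + k) = word t n (nat (m - n)) @ word t m k"
    unfolding word_add mn ..
  ultimately show live: "run i (word t m k) \<noteq> 0"
    using regular_run_anchor[OF t n(2), of "nat (m - n) + k"] by simp
  show "has_type UNIV t (m + int k) (run i (word t m k))"
    using sub i live by (intro has_type_run) auto
qed

text \<open>
  The recursion for the type that the spanning trees of the boxes satisfy by construction.
\<close>

lemma regular_connectivity_type:
  assumes t: "regular t"
  shows "connectivity_type t m \<in> {1..5}"
    and "has_type UNIV t m (connectivity_type t m)"
    and "connectivity_type t (m + int k) = run (connectivity_type t m) (word t m k)"
proof -
  obtain n where n: "n \<le> m" "anchor t n" using t unfolding regular_def by blast
  have mn: "n + int (nat (m - n)) = m" using n by simp
  have type: "has_type UNIV t m (run 1 (word t n (nat (m - n))))"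
    using regular_run(2)[OF t anchor_has_type[OF t n(2)], of "nat (m - n)"] unfolding mn .
  hence eq: "connectivity_type t m = run 1 (word t n (nat (m - n)))"
    by (rule connectivity_type_eqI)
  show has: "has_type UNIV t m (connectivity_type t m)" using type unfolding eq .
  thus "connectivity_type t m \<in> {1..5}" by (rule has_type_range)
  show "connectivity_type t (m + int k) = run (connectivity_type t m) (word t m k)"
    using regular_run(2)[OF t has] by (rule connectivity_type_eqI)
qed

lemma has_reset_anchor:
  assumes "has_reset (word t m k)"
  obtains j where "j \<le> m + int k" "anchor t j"
proof -
  obtain u v where w: "word t m k = u @ [(False, True), (False, True)] @ v"
    using assms by (auto simp: has_reset_def)
  hence k: "length u + 2 \<le> k" by (metis length_word length_append le_add1 add.assoc length_Cons list.size(3) numeral_2_eq_2 add_Suc add_0)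
  have "word t m k ! length u = (False, True)" "word t m k ! Suc (length u) = (False, True)"
    unfolding w by (simp_all add: nth_append)
  hence "letter t (m + 1 + int (length u)) = (False, True)"
    "letter t (m + 1 + int (Suc (length u))) = (False, True)"
    using nth_word[of "length u" k t m] nth_word[of "Suc (length u)" k t m] k by auto
  hence "anchor t (m + 2 + int (length u))"
    by (simp add: anchor_def letter_def algebra_simps)
  thus ?thesis using that[of "m + 2 + int (length u)"] k by simp
qed

section \<open>Joint law of the type and the subsequent edges\<close>

lemma word_Int:
  assumes "(\<lambda>j. h_edge (m + 1 + int j)) ` {..<k} \<union> (\<lambda>j. z_edge (m + 1 + int j)) ` {..<k} \<subseteq> F"
  shows "word (t \<inter> F) m k = word t m k"
  using assms by (intro nth_equalityI) (auto simp: nth_word letter_def)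

locale helix_ust = prob_space M for M :: "'w measure" +
  fixes T :: "'w \<Rightarrow> int set set"
  assumes ust: "uniform_random_spanning_tree M T"
begin

abbreviation ctype :: "int \<Rightarrow> 'w \<Rightarrow> nat" where
  "ctype m \<omega> \<equiv> connectivity_type (T \<omega>) m"

lemma T_measurable: "T \<in> measurable M edge_space"
  using ust by (simp add: uniform_random_spanning_tree_def)

lemma ust_limit:
  assumes "finite F" "F \<subseteq> helix_edges" "A \<subseteq> Pow F"
  shows "(\<lambda>N. measure_pmf.prob (finite_ust N) {t. t \<inter> F \<in> A})
    \<longlonglongrightarrow> prob {\<omega> \<in> space M. T \<omega> \<inter> F \<in> A}"
  using ust assms unfolding uniform_random_spanning_tree_def by blast

lemma space_edge_space: "space edge_space = Pow helix_edges"
  unfolding edge_space_def by (rule space_measure_of) auto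

lemma T_subset: "\<omega> \<in> space M \<Longrightarrow> T \<omega> \<subseteq> helix_edges"
  using measurable_space[OF T_measurable] by (auto simp: space_edge_space)

lemma edge_measurable [measurable]: "Measurable.pred M (\<lambda>\<omega>. e \<in> T \<omega>)"
proof (cases "e \<in> helix_edges")
  case True
  have "{t \<in> Pow helix_edges. e \<in> t} \<in> sets edge_space"
    unfolding edge_space_def using True by (subst sets_measure_of) auto
  from measurable_sets[OF T_measurable this]
  have "T -` {t \<in> Pow helix_edges. e \<in> t} \<inter> space M \<in> sets M" .
  also have "T -` {t \<in> Pow helix_edges. e \<in> t} \<inter> space M = {\<omega> \<in> space M. e \<in> T \<omega>}"
    using T_subset by auto
  finally show ?thesis by (simp add: pred_def)
next
  case False
  hence "{\<omega> \<in> space M. e \<in> T \<omega>} = {}" using T_subset by auto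
  from this show ?thesis unfolding pred_def \<open>{\<omega> \<in> space M. e \<in> T \<omega>} = {}\<close> by simp
qed

text \<open>
  Being connected is a countable union of cylinder events, one for each number of steps and each choice
  of the intermediate vertices.
\<close>

lemma linked_measurable [measurable]: "Measurable.pred M (\<lambda>\<omega>. linked S (T \<omega>) m x y)"
proof -
  let ?R = "\<lambda>\<omega>. {(u, v). {u, v} \<in> induced_edges (T \<omega>) (S \<inter> {..m})}"
  have [measurable]: "Measurable.pred M (\<lambda>\<omega>. (u, v) \<in> ?R \<omega>)" for u v
  proof -
    have "(\<lambda>\<omega>. (u, v) \<in> ?R \<omega>) = (\<lambda>\<omega>. {u, v} \<in> T \<omega> \<and> {u, v} \<subseteq> S \<inter> {..m})"
      by (auto simp: induced_edges_def)
    thus ?thesis by simp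
  qed
  have steps: "Measurable.pred M (\<lambda>\<omega>. (x, y) \<in> ?R \<omega> ^^ n)" for n
  proof (induction n arbitrary: y)
    case 0
    show ?case by simp
  next
    case (Suc n)
    have "(\<lambda>\<omega>. (x, y) \<in> ?R \<omega> ^^ Suc n) = (\<lambda>\<omega>. \<exists>z. (x, z) \<in> ?R \<omega> ^^ n \<and> (z, y) \<in> ?R \<omega>)"
      by (auto simp: relcomp_unfold)
    moreover note [measurable] = Suc.IH
    have "Measurable.pred M (\<lambda>\<omega>. \<exists>z. (x, z) \<in> ?R \<omega> ^^ n \<and> (z, y) \<in> ?R \<omega>)" by measurable
    ultimately show ?case by simp
  qed
  have "(\<lambda>\<omega>. linked S (T \<omega>) m x y) = (\<lambda>\<omega>. \<exists>n. (x, y) \<in> ?R \<omega> ^^ n)"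
    by (auto simp: linked_def graph_reachable_def rtrancl_power)
  moreover note [measurable] = steps
  have "Measurable.pred M (\<lambda>\<omega>. \<exists>n. (x, y) \<in> ?R \<omega> ^^ n)" by measurable
  ultimately show ?thesis by simp
qed

lemma has_type_measurable [measurable]: "Measurable.pred M (\<lambda>\<omega>. has_type S (T \<omega>) m i)"
  unfolding has_type_def window_pattern_def Ball_def by measurable

lemma ctype_measurable [measurable]: "ctype m \<in> measurable M (count_space UNIV)"
  unfolding connectivity_type_cases by measurable

lemma helix_process_measurable [measurable]:
  "helix_process T n \<in> measurable M (count_space UNIV)"
  unfolding helix_process_def of_bool_def by measurable

lemma word_measurable [measurable]: "(\<lambda>\<omega>. word (T \<omega>) m k) \<in> measurable M (count_space UNIV)"
proof (induction k)
  case (Suc k)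
  note [measurable] = Suc.IH
  show ?case unfolding word_Suc letter_def by measurable
qed simp

text \<open>
  The defining limit of the tree, applied to the edges that the word records.
\<close>

lemma prob_word:
  assumes "length w = k"
  shows "prob {\<omega> \<in> space M. word (T \<omega>) m k = w} = word_law w"
proof -
  define F where "F = (\<lambda>j. h_edge (m + 1 + int j)) ` {..<k} \<union> (\<lambda>j. z_edge (m + 1 + int j)) ` {..<k}"
  have F: "word (t \<inter> F) m k = word t m k" for t by (rule word_Int) (simp add: F_def)
  have "finite F \<and> F \<subseteq> helix_edges \<and> {s \<in> Pow F. word s m k = w} \<subseteq> Pow F"
    by (auto simp: F_def helix_edges_def)
  hence "(\<lambda>N. measure_pmf.prob (finite_ust N) {t. t \<inter> F \<in> {s \<in> Pow F. word s m k = w}})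
      \<longlonglongrightarrow> prob {\<omega> \<in> space M. T \<omega> \<inter> F \<in> {s \<in> Pow F. word s m k = w}}"
    by (elim conjE) (rule ust_limit)
  hence "(\<lambda>N. measure_pmf.prob (finite_ust N) {t. word t m k = w})
      \<longlonglongrightarrow> prob {\<omega> \<in> space M. word (T \<omega>) m k = w}"
    by (simp add: F)
  thus ?thesis using finite_ust_word_tendsto[OF assms] LIMSEQ_unique by blast
qed

lemma prob_word_in:
  "prob {\<omega> \<in> space M. word (T \<omega>) m k \<in> W} = (\<Sum>w\<in>words k. word_law w * of_bool (w \<in> W))"
proof -
  have "{\<omega> \<in> space M. word (T \<omega>) m k \<in> W} =
      (\<Union>w\<in>words k \<inter> W. {\<omega> \<in> space M. word (T \<omega>) m k = w})"
    by (auto simp: words_def)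
  also have "prob \<dots> = (\<Sum>w\<in>words k \<inter> W. prob {\<omega> \<in> space M. word (T \<omega>) m k = w})"
    by (intro finite_measure_finite_Union) (auto simp: disjoint_family_on_def)
  also have "\<dots> = (\<Sum>w\<in>words k \<inter> W. word_law w)"
    by (intro sum.cong refl prob_word) (auto simp: words_def)
  also have "\<dots> = (\<Sum>w\<in>words k. word_law w * of_bool (w \<in> W))"
    by (simp add: sum.inter_restrict of_bool_def if_distrib cong: if_cong)
  finally show ?thesis .
qed

lemma prob_no_reset_le:
  "prob {\<omega> \<in> space M. \<not> has_reset (word (T \<omega>) m (4 * s))} \<le> (1 - reset_prob) ^ s"
  using prob_word_in[of m "4 * s" "{w. \<not> has_reset w}"] no_reset_word_law_le[of s] by simp

lemma AE_anchor: "AE \<omega> in M. \<forall>n. \<exists>k\<le>n. anchor (T \<omega>) k"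
  unfolding AE_all_countable
proof
  fix n :: int
  have [measurable]: "Measurable.pred M (\<lambda>\<omega>. \<exists>k\<le>n. anchor (T \<omega>) k)"
    unfolding anchor_def by measurable
  let ?p = "prob {\<omega> \<in> space M. \<not> (\<exists>k\<le>n. anchor (T \<omega>) k)}"
  have "?p \<le> (1 - reset_prob) ^ s" for s
  proof -
    have "\<not> has_reset (word (T \<omega>) (n - int (4 * s)) (4 * s))" if "\<not> (\<exists>k\<le>n. anchor (T \<omega>) k)" for \<omega>
      using that has_reset_anchor[of "T \<omega>" "n - int (4 * s)" "4 * s"] by auto
    hence "?p \<le> prob {\<omega> \<in> space M. \<not> has_reset (word (T \<omega>) (n - int (4 * s)) (4 * s))}"
      by (intro finite_measure_mono) auto
    also have "\<dots> \<le> (1 - reset_prob) ^ s" by (rule prob_no_reset_le)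
    finally show ?thesis .
  qed
  moreover have "(\<lambda>s. (1 - reset_prob) ^ s) \<longlonglongrightarrow> 0"
    using reset_prob_bounds by (intro LIMSEQ_realpow_zero) auto
  ultimately have "?p \<le> 0" by (intro LIMSEQ_le_const[of _ 0]) auto
  hence "?p = 0" by (intro order_antisym measure_nonneg)
  moreover have "{\<omega> \<in> space M. \<not> (\<exists>k\<le>n. anchor (T \<omega>) k)} \<in> events" by measurable
  ultimately have "AE \<omega> in M. \<not> \<not> (\<exists>k\<le>n. anchor (T \<omega>) k)"
    using prob_Collect_eq_0[of "\<lambda>\<omega>. \<not> (\<exists>k\<le>n. anchor (T \<omega>) k)"] by blast
  thus "AE \<omega> in M. \<exists>k\<le>n. anchor (T \<omega>) k" by simp
qed

text \<open>
  Impossible words have probability 0, and there are only countably many positions and lengths.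
\<close>

lemma AE_regular: "AE \<omega> in M. regular (T \<omega>)"
proof -
  have "AE \<omega> in M. \<exists>i\<in>{1..5}. run i (word (T \<omega>) m k) \<noteq> 0" for m k
  proof -
    let ?W = "{w. \<forall>i\<in>{1..5}. run i w = 0}"
    have "word_law w = 0" if "w \<in> ?W" for w
      using that by (simp add: word_law_def)
    hence "(\<Sum>w\<in>words k. word_law w * of_bool (w \<in> ?W)) = 0" by (intro sum.neutral) auto
    hence "prob {\<omega> \<in> space M. word (T \<omega>) m k \<in> ?W} = 0" unfolding prob_word_in .
    moreover have "{\<omega> \<in> space M. word (T \<omega>) m k \<in> ?W} \<in> events" by measurable
    ultimately have "AE \<omega> in M. word (T \<omega>) m k \<notin> ?W"
      using prob_Collect_eq_0[of "\<lambda>\<omega>. word (T \<omega>) m k \<in> ?W"] by blast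
    thus ?thesis by simp
  qed
  hence "AE \<omega> in M. \<forall>m k. \<exists>i\<in>{1..5}. run i (word (T \<omega>) m k) \<noteq> 0"
    unfolding AE_all_countable by blast
  moreover have "AE \<omega> in M. T \<omega> \<subseteq> helix_edges" using T_subset by (intro AE_I2)
  ultimately show ?thesis using AE_anchor unfolding regular_def by eventually_elim blast
qed

text \<open>
  If the \<open>s\<close> letters before \<open>m\<close> contain a reset, they determine the type at \<open>m\<close>, so the event becomes
  one about the word on \<open>s + k\<close> letters, whose law is known. By multiplicativity of the weights its
  probability is \<open>weight i w\<close> times the stationary probability of type \<open>i\<close>, up to the contribution of
  words without a reset, which is exponentially small in \<open>s\<close>.
\<close>

lemma prob_ctype_word:
  assumes i: "i \<in> {1..5}" and w: "length w = k"
  shows "prob {\<omega> \<in> space M. ctype m \<omega> = i \<and> word (T \<omega>) m k = w} = type_law i * weight i w"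
    (is "prob ?E = _")
proof -
  have bound: "\<bar>prob ?E - type_law i * weight i w\<bar> \<le> (1 + weight i w) * (1 - reset_prob) ^ q" for q
  proof -
    define s where "s = 4 * q"
    let ?A = "{\<omega> \<in> space M. has_reset (word (T \<omega>) (m - int s) s)}"
    let ?N = "{\<omega> \<in> space M. \<not> has_reset (word (T \<omega>) (m - int s) s)}"
    let ?U = "{u. has_reset u \<and> (\<exists>j\<in>{1..5}. run j u = i)}"
    let ?B = "{\<omega> \<in> space M. word (T \<omega>) (m - int s) (s + k) \<in> (\<lambda>u. u @ w) ` (?U \<inter> words s)}"
    \<comment> \<open>Given a reset, one live run of the letters before m determines the type at m.\<close>
    have "prob (?E \<inter> ?A) = prob ?B"
    proof (rule measure_eq_AE)
      show "AE \<omega> in M. \<omega> \<in> ?E \<inter> ?A \<longleftrightarrow> \<omega> \<in> ?B"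
        using AE_regular
      proof eventually_elim
        case (elim \<omega>)
        let ?u = "word (T \<omega>) (m - int s) s" and ?j = "ctype (m - int s) \<omega>"
        have split: "word (T \<omega>) (m - int s) (s + k) = ?u @ word (T \<omega>) m k"
          using word_add[of "T \<omega>" "m - int s" s k] by simp
        have j: "?j \<in> {1..5}" by (rule regular_connectivity_type(1)[OF elim])
        have run: "ctype m \<omega> = run ?j ?u"
          using regular_connectivity_type(3)[OF elim, of "m - int s" s] by simp
        have live: "run ?j ?u \<noteq> 0"
          using regular_connectivity_type(1)[OF elim, of m] unfolding run by simp
        have "ctype m \<omega> = i \<longleftrightarrow> (\<exists>r\<in>{1..5}. run r ?u = i)" if "has_reset ?u"
          unfolding run using has_reset_run_eq[OF that live] j i by auto
        moreover have "word (T \<omega>) (m - int s) (s + k) \<in> (\<lambda>u. u @ w) ` (?U \<inter> words s) \<longleftrightarrow>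
            ?u \<in> ?U \<and> word (T \<omega>) m k = w"
          unfolding split using w by (auto simp: words_def)
        ultimately show ?case by blast
      qed
    qed measurable
    also have "prob ?B = (\<Sum>u\<in>words s. word_law (u @ w) * of_bool (u \<in> ?U))"
      unfolding prob_word_in sum_words_add
    proof (intro sum.cong refl)
      fix u assume u: "u \<in> words s"
      have wk: "w \<in> words k" using w by (simp add: words_def)
      have "(\<Sum>y\<in>words k. word_law (u @ y) * of_bool (u @ y \<in> (\<lambda>u. u @ w) ` (?U \<inter> words s))) =
          (\<Sum>y\<in>words k. if y = w then word_law (u @ w) * of_bool (u \<in> ?U) else 0)"
        using u w by (intro sum.cong refl) (auto simp: words_def)
      also have "\<dots> = word_law (u @ w) * of_bool (u \<in> ?U)"
        using wk by (subst sum.delta) simp_all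
      finally show "(\<Sum>y\<in>words k. word_law (u @ y) *
          of_bool (u @ y \<in> (\<lambda>u. u @ w) ` (?U \<inter> words s))) = word_law (u @ w) * of_bool (u \<in> ?U)" .
    qed
    also have "\<dots> = (\<Sum>u\<in>words s. (\<Sum>j\<in>{1..5}. type_law j * weight j u * of_bool (run j u = i)) *
        of_bool (has_reset u)) * weight i w"
      unfolding sum_distrib_right
    proof (intro sum.cong refl)
      fix u
      show "word_law (u @ w) * of_bool (u \<in> ?U) =
          (\<Sum>j\<in>{1..5}. type_law j * weight j u * of_bool (run j u = i) * of_bool (has_reset u) * weight i w)"
      proof (cases "u \<in> ?U")
        case True
        then obtain r where r: "r \<in> {1..5}" "run r u = i" "has_reset u" by auto
        have "weight j u * weight (run j u) w = weight j u * of_bool (run j u = i) * weight i w" for j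
          using has_reset_run_eq[OF r(3), of r j] r(2) i by (cases "run j u = 0") auto
        thus ?thesis
          using True unfolding word_law_def sum_distrib_right
          by (intro sum.cong refl) (simp add: weight_append mult.assoc)
      next
        case False
        thus ?thesis by (auto intro!: sum.neutral[symmetric])
      qed
    qed
    also have "\<dots> = (type_law i - (\<Sum>u\<in>words s. (\<Sum>j\<in>{1..5}. type_law j * weight j u * of_bool (run j u = i)) *
        of_bool (\<not> has_reset u))) * weight i w" (is "_ = (_ - ?d) * _")
    proof -
      let ?g = "\<lambda>u. \<Sum>j\<in>{1..5}. type_law j * weight j u * of_bool (run j u = i)"
      have "(\<Sum>u\<in>words s. ?g u * of_bool (has_reset u)) + (\<Sum>u\<in>words s. ?g u * of_bool (\<not> has_reset u)) =
          (\<Sum>u\<in>words s. ?g u)"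
        unfolding sum.distrib[symmetric] by (intro sum.cong refl) auto
      also have "\<dots> = (\<Sum>j\<in>{1..5}. type_law j * average s (\<lambda>r. of_bool (r = i)) j)"
        unfolding average_def sum_distrib_left by (subst sum.swap) (simp only: mult.assoc)
      also have "\<dots> = (\<Sum>j\<in>{1..5}. type_law j * of_bool (j = i))" by (rule type_law_invariant)
      also have "\<dots> = type_law i" using i unfolding types_cases sum_types by auto
      finally show ?thesis by (simp only: eq_diff_eq[symmetric])
    qed
    finally have EA: "prob (?E \<inter> ?A) = (type_law i - ?d) * weight i w" .
    have N: "prob ?N \<le> (1 - reset_prob) ^ q" unfolding s_def by (rule prob_no_reset_le)
    \<comment> \<open>The correction is the weight of the reset-free words that lead to type i.\<close>
    have d: "0 \<le> ?d" "?d \<le> prob ?N"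
    proof -
      show "0 \<le> ?d"
        by (intro sum_nonneg mult_nonneg_nonneg type_law_nonneg weight_nonneg) auto
      have "?d \<le> (\<Sum>u\<in>words s. word_law u * of_bool (u \<in> {u. \<not> has_reset u}))"
      proof (intro sum_mono)
        fix u
        have "(\<Sum>j\<in>{1..5}. type_law j * weight j u * of_bool (run j u = i)) \<le> word_law u"
          unfolding word_law_def
          by (intro sum_mono) (simp add: type_law_nonneg weight_nonneg del: sum_of_bool_mult_eq)
        thus "(\<Sum>j\<in>{1..5}. type_law j * weight j u * of_bool (run j u = i)) * of_bool (\<not> has_reset u) \<le>
            word_law u * of_bool (u \<in> {u. \<not> has_reset u})"
          unfolding mem_Collect_eq by (rule mult_right_mono) simp
      qed
      also have "\<dots> = prob ?N" using prob_word_in[of "m - int s" s "{u. \<not> has_reset u}"] by simp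
      finally show "?d \<le> prob ?N" .
    qed
    have "?E \<subseteq> (?E \<inter> ?A) \<union> ?N" by auto
    hence "prob ?E \<le> prob ((?E \<inter> ?A) \<union> ?N)" by (rule finite_measure_mono) measurable
    also have "\<dots> \<le> prob (?E \<inter> ?A) + prob ?N" by (rule measure_Un_le) measurable
    finally have upper: "prob ?E \<le> prob (?E \<inter> ?A) + prob ?N" .
    have lower: "prob (?E \<inter> ?A) \<le> prob ?E" by (rule finite_measure_mono) (auto, measurable)
    have "?d * weight i w \<le> (1 - reset_prob) ^ q * weight i w"
      using d N weight_nonneg by (intro mult_right_mono) auto
    moreover have "0 \<le> ?d * weight i w" using d(1) weight_nonneg by simp
    moreover have "0 \<le> (1 - reset_prob) ^ q" using reset_prob_bounds by simp
    ultimately show ?thesis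
      using upper lower N unfolding EA by (simp add: algebra_simps abs_le_iff)
  qed
  have "(\<lambda>q. (1 + weight i w) * (1 - reset_prob) ^ q) \<longlonglongrightarrow> (1 + weight i w) * 0"
    using reset_prob_bounds by (intro tendsto_mult tendsto_const LIMSEQ_realpow_zero) auto
  hence "\<bar>prob ?E - type_law i * weight i w\<bar> \<le> (1 + weight i w) * 0"
    using bound by (intro LIMSEQ_le_const) auto
  thus ?thesis by simp
qed

end

section \<open>Path probabilities\<close>

text \<open>
  The state of the process \<open>j + 1\<close> steps after a vertex of type \<open>i\<close> that is followed by the word \<open>w\<close>.
\<close>

definition path_state :: "nat \<Rightarrow> (bool \<times> bool) list \<Rightarrow> nat \<Rightarrow> nat \<times> nat \<times> nat" where
  "path_state i w j = (of_bool (fst (w ! j)), of_bool (snd (w ! j)), run i (take (Suc j) w))"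

text \<open>
  The probability of a property of a stationary starting type and the next \<open>k\<close> letters.
\<close>

definition path_law :: "nat \<Rightarrow> (nat \<Rightarrow> (bool \<times> bool) list \<Rightarrow> bool) \<Rightarrow> real" where
  "path_law k Q = (\<Sum>i\<in>{1..5}. \<Sum>w\<in>words k. of_bool (Q i w) * (type_law i * weight i w))"

definition transition :: "nat \<Rightarrow> nat \<times> nat \<times> nat \<Rightarrow> real" where
  "transition i y = (\<Sum>l\<in>UNIV. of_bool ((of_bool (fst l), of_bool (snd l), step i l) = y) * weight i [l])"

context helix_ust
begin

lemma prob_ctype_word_in:
  "prob {\<omega> \<in> space M. Q (ctype m \<omega>) (word (T \<omega>) m k)} = path_law k Q"
proof -
  let ?I = "{p \<in> {1..5} \<times> words k. Q (fst p) (snd p)}"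
  let ?E = "\<lambda>p. {\<omega> \<in> space M. ctype m \<omega> = fst p \<and> word (T \<omega>) m k = snd p}"
  have "prob {\<omega> \<in> space M. Q (ctype m \<omega>) (word (T \<omega>) m k)} = prob (\<Union>p\<in>?I. ?E p)"
  proof (rule measure_eq_AE)
    show "AE \<omega> in M. \<omega> \<in> {\<omega> \<in> space M. Q (ctype m \<omega>) (word (T \<omega>) m k)} \<longleftrightarrow> \<omega> \<in> (\<Union>p\<in>?I. ?E p)"
      using AE_regular
    proof eventually_elim
      case (elim \<omega>)
      have "ctype m \<omega> \<in> {1..5}" by (rule regular_connectivity_type(1)[OF elim])
      thus ?case by (auto simp: words_def)
    qed
    show "{\<omega> \<in> space M. Q (ctype m \<omega>) (word (T \<omega>) m k)} \<in> events"
      by (rule predE) measurable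
    show "(\<Union>p\<in>?I. ?E p) \<in> events" by (intro sets.finite_UN) auto
  qed
  also have "\<dots> = (\<Sum>p\<in>?I. prob (?E p))"
    by (intro finite_measure_finite_Union) (auto simp: disjoint_family_on_def)
  also have "\<dots> = (\<Sum>p\<in>?I. type_law (fst p) * weight (fst p) (snd p))"
    by (intro sum.cong refl prob_ctype_word) (auto simp: words_def)
  also have "\<dots> = (\<Sum>p\<in>{1..5} \<times> words k. of_bool (Q (fst p) (snd p)) * (type_law (fst p) * weight (fst p) (snd p)))"
  proof -
    have "finite ({1..5::nat} \<times> words k)" by simp
    from sum.inter_filter[OF this, of "\<lambda>p. type_law (fst p) * weight (fst p) (snd p)" "\<lambda>p. Q (fst p) (snd p)"]
    show ?thesis by (simp only: of_bool_def if_distrib[of "\<lambda>c. c * _"] mult_1 mult_zero_left)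
  qed
  also have "\<dots> = path_law k Q"
    unfolding path_law_def sum.cartesian_product by (simp only: case_prod_unfold)
  finally show ?thesis .
qed

lemma regular_helix_process:
  assumes "regular (T \<omega>)" "j < k"
  shows "helix_process T (m + 1 + int j) \<omega> = path_state (ctype m \<omega>) (word (T \<omega>) m k) j"
proof -
  have "take (Suc j) (word (T \<omega>) m k) = word (T \<omega>) m (Suc j)"
    using assms(2) by (simp add: word_def take_map)
  moreover have "ctype (m + 1 + int j) \<omega> = run (ctype m \<omega>) (word (T \<omega>) m (Suc j))"
    using regular_connectivity_type(3)[OF assms(1), of m "Suc j"] by (simp add: algebra_simps)
  ultimately show ?thesis
    using assms(2) by (simp add: helix_process_def path_state_def nth_word letter_def)
qed

lemma prob_path:
  assumes "J \<subseteq> {m + 1..m + int k}"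
  shows "prob {\<omega> \<in> space M. \<forall>j\<in>J. helix_process T j \<omega> = x j} =
    path_law k (\<lambda>i w. \<forall>j\<in>J. path_state i w (nat (j - m - 1)) = x j)"
proof -
  have fin: "finite J" using assms finite_subset by blast
  have "prob {\<omega> \<in> space M. \<forall>j\<in>J. helix_process T j \<omega> = x j} =
      prob {\<omega> \<in> space M. \<forall>j\<in>J. path_state (ctype m \<omega>) (word (T \<omega>) m k) (nat (j - m - 1)) = x j}"
  proof (rule measure_eq_AE)
    show "AE \<omega> in M. \<omega> \<in> {\<omega> \<in> space M. \<forall>j\<in>J. helix_process T j \<omega> = x j} \<longleftrightarrow>
        \<omega> \<in> {\<omega> \<in> space M. \<forall>j\<in>J. path_state (ctype m \<omega>) (word (T \<omega>) m k) (nat (j - m - 1)) = x j}"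
      using AE_regular
    proof eventually_elim
      case (elim \<omega>)
      have "helix_process T j \<omega> = path_state (ctype m \<omega>) (word (T \<omega>) m k) (nat (j - m - 1))"
        if "j \<in> J" for j
      proof -
        have "m + 1 + int (nat (j - m - 1)) = j" "nat (j - m - 1) < k" using that assms by force+
        thus ?thesis using regular_helix_process[OF elim, of "nat (j - m - 1)" k m] by simp
      qed
      thus ?case by simp
    qed
    show "{\<omega> \<in> space M. \<forall>j\<in>J. helix_process T j \<omega> = x j} \<in> events"
      using fin by measurable
    show "{\<omega> \<in> space M. \<forall>j\<in>J. path_state (ctype m \<omega>) (word (T \<omega>) m k) (nat (j - m - 1)) = x j} \<in> events"
      by (rule predE) measurable
  qed
  also have "\<dots> = path_law k (\<lambda>i w. \<forall>j\<in>J. path_state i w (nat (j - m - 1)) = x j)"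
    using prob_ctype_word_in[of "\<lambda>i w. \<forall>j\<in>J. path_state i w (nat (j - m - 1)) = x j"] .
  finally show ?thesis .
qed

text \<open>
  A path in a window is the same function of the type before the window and the letters in it wherever
  the window lies, and the law of these data does not depend on the position.
\<close>

lemma stationary: "stationary_process M (helix_process T)"
  unfolding stationary_process_def
proof (intro allI impI)
  fix J :: "int set" and x :: "int \<Rightarrow> nat \<times> nat \<times> nat" and c :: int
  assume "finite J"
  then obtain b where b: "J \<subseteq> {- int b..int b}"
  proof -
    have "J \<subseteq> {- int (nat (\<Sum>j\<in>J. \<bar>j\<bar>))..int (nat (\<Sum>j\<in>J. \<bar>j\<bar>))}"
    proof
      fix j assume "j \<in> J"
      hence "\<bar>j\<bar> \<le> (\<Sum>j\<in>J. \<bar>j\<bar>)" using \<open>finite J\<close> by (intro member_le_sum) auto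
      thus "j \<in> {- int (nat (\<Sum>j\<in>J. \<bar>j\<bar>))..int (nat (\<Sum>j\<in>J. \<bar>j\<bar>))}" by auto
    qed
    thus ?thesis using that by blast
  qed
  let ?m = "- int b - 1" and ?k = "2 * b + 1"
  have "prob {\<omega> \<in> space M. \<forall>j\<in>J. helix_process T (j + c) \<omega> = x j} =
      prob {\<omega> \<in> space M. \<forall>j\<in>(\<lambda>j. j + c) ` J. helix_process T j \<omega> = x (j - c)}"
    by simp
  also have "\<dots> = path_law ?k (\<lambda>i w. \<forall>j\<in>(\<lambda>j. j + c) ` J. path_state i w (nat (j - (?m + c) - 1)) = x (j - c))"
    using b by (intro prob_path) auto
  also have "\<dots> = path_law ?k (\<lambda>i w. \<forall>j\<in>J. path_state i w (nat (j - ?m - 1)) = x j)"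
    by (simp add: algebra_simps)
  also have "\<dots> = prob {\<omega> \<in> space M. \<forall>j\<in>J. helix_process T j \<omega> = x j}"
    using b by (intro prob_path[symmetric]) auto
  finally show "prob {\<omega> \<in> space M. \<forall>j\<in>J. helix_process T (j + c) \<omega> = x j} =
      prob {\<omega> \<in> space M. \<forall>j\<in>J. helix_process T j \<omega> = x j}" .
qed

lemma prob_state: "prob {\<omega> \<in> space M. helix_process T n \<omega> = y} = (\<Sum>i\<in>{1..5}. type_law i * transition i y)"
proof -
  have "prob {\<omega> \<in> space M. helix_process T n \<omega> = y} =
      prob {\<omega> \<in> space M. \<forall>j\<in>{n}. helix_process T j \<omega> = y}" by simp
  also have "\<dots> = path_law (Suc 0) (\<lambda>i w. \<forall>j\<in>{n}. path_state i w (nat (j - (n - 1) - 1)) = y)"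
    by (intro prob_path) auto
  also have "\<dots> = (\<Sum>i\<in>{1..5}. type_law i * transition i y)"
    unfolding path_law_def transition_def sum_words_Suc_0 sum_distrib_left
    by (simp add: path_state_def mult_ac)
  finally show ?thesis .
qed

text \<open>
  The past enters the weight of the next letter through the type at \<open>n\<close>, and this type is part of the
  state at \<open>n\<close>.
\<close>

lemma prob_path_extend:
  fixes x :: "int \<Rightarrow> nat \<times> nat \<times> nat" and k :: nat
  assumes x: "snd (snd (x n)) = i"
  defines "A \<equiv> \<lambda>\<omega>. \<forall>j\<in>{n - int k..n}. helix_process T j \<omega> = x j"
  shows "prob {\<omega> \<in> space M. helix_process T (n + 1) \<omega> = y \<and> A \<omega>} =
    prob {\<omega> \<in> space M. A \<omega>} * transition i y"
proof -
  let ?m = "n - int k - 1"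
  define Q where "Q = (\<lambda>r w. \<forall>j\<in>{n - int k..n}. path_state r w (nat (j - ?m - 1)) = x j)"
  define x' where "x' j = (if j = n + 1 then y else x j)" for j
  have "prob {\<omega> \<in> space M. helix_process T (n + 1) \<omega> = y \<and> A \<omega>} =
      prob {\<omega> \<in> space M. \<forall>j\<in>{n - int k..n + 1}. helix_process T j \<omega> = x' j}"
  proof -
    have "{n - int k..n + 1} = insert (n + 1) {n - int k..n}" by auto
    thus ?thesis by (auto simp: A_def x'_def intro!: arg_cong[of _ _ prob])
  qed
  also have "\<dots> = path_law (Suc k + Suc 0)
      (\<lambda>r w. \<forall>j\<in>{n - int k..n + 1}. path_state r w (nat (j - ?m - 1)) = x' j)"
    by (intro prob_path) auto
  also have "\<dots> = (\<Sum>r\<in>{1..5}. \<Sum>u\<in>words (Suc k). \<Sum>l\<in>UNIV.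
      of_bool (Q r u) * of_bool ((of_bool (fst l), of_bool (snd l), step i l) = y) *
        (type_law r * (weight r u * weight i [l])))"
    unfolding path_law_def sum_words_add[of _ "Suc k" "Suc 0"] sum_words_Suc_0
  proof (intro sum.cong refl)
    fix r :: nat and u and l :: "bool \<times> bool"
    assume r: "r \<in> {1..5}" and u: "u \<in> words (Suc k)"
    have len: "length u = Suc k" using u by (simp add: words_def)
    have old: "path_state r (u @ [l]) j = path_state r u j" if "j < Suc k" for j
      using that len by (simp add: path_state_def nth_append)
    have "n - int k \<le> j \<Longrightarrow> j \<le> n \<Longrightarrow> nat (j - ?m - 1) < Suc k" for j by auto
    hence Q: "Q r u \<longleftrightarrow> (\<forall>j\<in>{n - int k..n}. path_state r (u @ [l]) (nat (j - ?m - 1)) = x j)"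
      unfolding Q_def using old by simp
    have new: "path_state r (u @ [l]) (nat (n + 1 - ?m - 1)) = (of_bool (fst l), of_bool (snd l), step (run r u) l)"
      using len by (simp add: path_state_def nth_append nat_add_distrib)
    have end_type: "run r u = i" if "Q r u"
    proof -
      have "path_state r u k = x n" using bspec[OF that[unfolded Q_def], of n] by simp
      moreover have "run r u = snd (snd (path_state r u k))" using len by (simp add: path_state_def)
      ultimately show ?thesis using x by simp
    qed
    have "{n - int k..n + 1} = insert (n + 1) {n - int k..n}" by auto
    hence "(\<forall>j\<in>{n - int k..n + 1}. path_state r (u @ [l]) (nat (j - ?m - 1)) = x' j) \<longleftrightarrow>
        path_state r (u @ [l]) (nat (n + 1 - ?m - 1)) = y \<and> Q r u"
      unfolding Q by (auto simp: x'_def)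
    also have "\<dots> \<longleftrightarrow> Q r u \<and> (of_bool (fst l), of_bool (snd l), step i l) = y"
      unfolding new using end_type by auto
    finally show "of_bool (\<forall>j\<in>{n - int k..n + 1}. path_state r (u @ [l]) (nat (j - ?m - 1)) = x' j) *
        (type_law r * weight r (u @ [l])) =
      of_bool (Q r u) * of_bool ((of_bool (fst l), of_bool (snd l), step i l) = y) *
        (type_law r * (weight r u * weight i [l]))"
      using end_type by (auto simp: weight_append[OF r])
  qed
  also have "\<dots> = path_law (Suc k) Q * transition i y"
    unfolding path_law_def transition_def sum_distrib_right
    by (intro sum.cong refl) (simp only: sum_distrib_left mult_ac)
  also have "path_law (Suc k) Q = prob {\<omega> \<in> space M. A \<omega>}"
    unfolding Q_def A_def by (intro prob_path[symmetric]) auto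
  finally show ?thesis .
qed

end

section \<open>The transition matrix and the invariant distribution\<close>

definition state_type :: "nat \<Rightarrow> nat" where
  "state_type k = snd (snd (\<delta> k))"

lemma \<delta>_values: "\<delta> 1 = (0,1,1)" "\<delta> 2 = (1,0,1)" "\<delta> 3 = (1,1,1)" "\<delta> 4 = (0,0,2)"
  "\<delta> 5 = (1,0,2)" "\<delta> 6 = (0,1,3)" "\<delta> 7 = (1,0,3)" "\<delta> 8 = (1,1,3)" "\<delta> 9 = (1,0,4)"
  "\<delta> 10 = (0,0,5)" "\<delta> 11 = (1,0,5)"
  by (simp_all add: \<delta>_def)

lemma state_type_values: "state_type 1 = 1" "state_type 2 = 1" "state_type 3 = 1" "state_type 4 = 2"
  "state_type 5 = 2" "state_type 6 = 3" "state_type 7 = 3" "state_type 8 = 3" "state_type 9 = 4"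
  "state_type 10 = 5" "state_type 11 = 5"
  by (simp_all add: state_type_def \<delta>_values del: One_nat_def)

lemma states_cases: "k \<in> {1..11} \<longleftrightarrow> k = 1 \<or> k = 2 \<or> k = 3 \<or> k = 4 \<or> k = 5 \<or> k = 6 \<or>
    k = 7 \<or> k = 8 \<or> k = 9 \<or> k = 10 \<or> k = (11::nat)"
  unfolding atLeastAtMost_iff by arith

lemma inj_on_\<delta>: "inj_on \<delta> {1..11}"
proof (rule inj_onI)
  fix k l :: nat assume "k \<in> {1..11}" "l \<in> {1..11}" "\<delta> k = \<delta> l"
  thus "k = l" unfolding states_cases by (elim disjE; simp add: \<delta>_values del: One_nat_def)
qed

lemma state_type_range: "k \<in> {1..11} \<Longrightarrow> state_type k \<in> {1..5}"
  unfolding states_cases by (elim disjE) (simp_all add: state_type_values del: One_nat_def)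

lemma live_step_state:
  assumes "step i l \<noteq> 0"
  shows "(of_bool (fst l), of_bool (snd l), step i l) \<in> \<delta> ` {1..11}"
proof -
  have "(of_bool (fst l), of_bool (snd l), step i l) \<in> {\<delta> 1, \<delta> 2, \<delta> 3, \<delta> 4, \<delta> 5, \<delta> 6, \<delta> 7, \<delta> 8, \<delta> 9, \<delta> 10, \<delta> 11}"
    using assms unfolding \<delta>_values by (cases l) (auto simp: step_def split: bool.splits if_splits)
  thus ?thesis by auto
qed

lemma step_values:
  "step 1 (False, False) = 2" "step 1 (False, True) = 1" "step 1 (True, False) = 1" "step 1 (True, True) = 0"
  "step 2 (False, False) = 5" "step 2 (False, True) = 3" "step 2 (True, False) = 4" "step 2 (True, True) = 1"
  "step 3 (False, False) = 0" "step 3 (False, True) = 0" "step 3 (True, False) = 2" "step 3 (True, True) = 1"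
  "step 4 (False, False) = 5" "step 4 (False, True) = 3" "step 4 (True, False) = 3" "step 4 (True, True) = 0"
  "step 5 (False, False) = 0" "step 5 (False, True) = 0" "step 5 (True, False) = 5" "step 5 (True, True) = 3"
  by (simp_all add: step_def)

lemma weight_letter: "weight i [l] = perron (step i l) / (lam * perron i)"
  by (simp add: weight_def)

text \<open>
  Each live letter after type \<open>i\<close> produces exactly one of the eleven states, so summing over states is
  summing over letters.
\<close>

lemma sum_transition:
  assumes i: "i \<in> {1..5}"
  shows "(\<Sum>k\<in>{1..11}. transition i (\<delta> k) * g (state_type k)) = average (Suc 0) g i"
proof -
  have inner: "(\<Sum>k\<in>{1..11}. of_bool ((of_bool (fst l), of_bool (snd l), step i l) = \<delta> k) * g (state_type k)) =
      g (step i l)" if live: "step i l \<noteq> 0" for l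
  proof -
    let ?y = "(of_bool (fst l), of_bool (snd l), step i l) :: nat \<times> nat \<times> nat"
    obtain k\<^sub>0 where k\<^sub>0: "k\<^sub>0 \<in> {1..11}" "?y = \<delta> k\<^sub>0" using live_step_state[OF live] by blast
    have "(\<Sum>k\<in>{1..11}. of_bool (?y = \<delta> k) * g (state_type k)) =
        (\<Sum>k\<in>{1..11}. if k = k\<^sub>0 then g (state_type k\<^sub>0) else 0)"
      using k\<^sub>0 inj_on_\<delta> by (intro sum.cong refl) (auto dest: inj_onD)
    also have "\<dots> = g (state_type k\<^sub>0)" using k\<^sub>0 by (simp add: sum.delta)
    also have "state_type k\<^sub>0 = step i l" unfolding state_type_def k\<^sub>0(2)[symmetric] by simp
    finally show ?thesis .
  qed
  have "(\<Sum>k\<in>{1..11}. transition i (\<delta> k) * g (state_type k)) =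
      (\<Sum>l\<in>UNIV. weight i [l] *
        (\<Sum>k\<in>{1..11}. of_bool ((of_bool (fst l), of_bool (snd l), step i l) = \<delta> k) * g (state_type k)))"
    unfolding transition_def sum_distrib_left sum_distrib_right
    by (subst sum.swap) (simp only: mult_ac)
  also have "\<dots> = (\<Sum>l\<in>UNIV. weight i [l] * g (step i l))"
  proof (intro sum.cong refl)
    fix l
    show "weight i [l] * (\<Sum>k\<in>{1..11}. of_bool ((of_bool (fst l), of_bool (snd l), step i l) = \<delta> k) *
        g (state_type k)) = weight i [l] * g (step i l)"
    proof (cases "step i l = 0")
      case False
      show ?thesis unfolding inner[OF False] ..
    qed (simp add: weight_letter)
  qed
  also have "\<dots> = average (Suc 0) g i"
    by (simp add: average_def sum_words_Suc_0)
  finally show ?thesis .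
qed

lemma gam_powr: "gam powr (real n / 2) = sg ^ n"
proof -
  have "gam powr (real n / 2) = gam powr (1 / 2 * real n)" by simp
  also have "\<dots> = (gam powr (1 / 2)) ^ n"
    using gam_bounds by (subst powr_powr[symmetric]) (simp add: powr_realpow)
  also have "gam powr (1 / 2) = sg" using gam_bounds by (simp add: powr_half_sqrt sg_def)
  finally show ?thesis .
qed

lemma gam_powers: "gam powr (3/2) = sg ^ 3" "gam powr (5/2) = sg ^ 5" "gam powr (1/2) = sg"
  "gam powr (-1) = sg\<^sup>2 - 1" "gam powr (-1/2) = sg ^ 3 - sg" "1 / sg = sg ^ 3 - sg"
proof -
  show "gam powr (3/2) = sg ^ 3" "gam powr (5/2) = sg ^ 5"
    using gam_powr[of 3] gam_powr[of 5] by simp_all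
  show half: "gam powr (1/2) = sg" using gam_powr[of 1] by simp
  have "sg\<^sup>2 * (sg\<^sup>2 - 1) = 1" using sg_pow4 by algebra
  hence "inverse (sg\<^sup>2) = sg\<^sup>2 - 1" using inverse_unique by blast
  thus "gam powr (-1) = sg\<^sup>2 - 1"
    using gam_bounds by (simp add: powr_minus gam_eq[symmetric])
  have "sg * (sg ^ 3 - sg) = 1" using sg_pow4 by algebra
  hence *: "inverse sg = sg ^ 3 - sg" using inverse_unique by blast
  thus "1 / sg = sg ^ 3 - sg" by (simp add: inverse_eq_divide)
  have "gam powr (-1/2) = inverse (gam powr (1/2))" using powr_minus[of gam "1/2"] by simp
  thus "gam powr (-1/2) = sg ^ 3 - sg" unfolding half * .
qed

lemma perron_ratio_eqI:
  assumes "i \<in> {1..5}" "0 < b" "a * (lam * perron i) = p * b"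
  shows "a / b = p / (lam * perron i)"
  using assms perron_pos[OF assms(1)] lam_pos by (simp add: frac_eq_eq)

lemma Rbar_values:
  "Rbar11 / 2 = perron 1 / (lam * perron 1)"
  "Rbar21 = perron 1 / (lam * perron 2)"
  "Rbar23 = perron 3 / (lam * perron 2)"
  "Rbar24 = perron 4 / (lam * perron 2)"
  "Rbar31 = perron 1 / (lam * perron 3)"
  "Rbar43 / 2 = perron 3 / (lam * perron 4)"
  "Rbar53 = perron 3 / (lam * perron 5)"
proof -
  have pos: "0 < 2 + sg" "0 < 2 - sg" "0 < sg\<^sup>2 + sg" "0 < sg" using sg_bounds by (simp_all add: add_pos_pos)
  note unf = Rbar11_def Rbar21_def Rbar23_def Rbar24_def Rbar31_def Rbar43_def Rbar53_def
    gam_powers(1,2) sg_def[symmetric]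
  show "Rbar11 / 2 = perron 1 / (lam * perron 1)"
    using lam_inverse unfolding unf by (simp add: gam_eq perron_values)
  show "Rbar21 = perron 1 / (lam * perron 2)"
    unfolding unf using pos
    by (intro perron_ratio_eqI) (simp, simp, use sg_pow4 in \<open>unfold perron_values lam_eq, algebra\<close>)
  show "Rbar23 = perron 3 / (lam * perron 2)"
    unfolding unf unfolding gam_eq gam_powers(6) using pos
    by (intro perron_ratio_eqI) (simp, simp, use sg_pow4 in \<open>unfold perron_values lam_eq, algebra\<close>)
  show "Rbar24 = perron 4 / (lam * perron 2)"
    unfolding unf using pos
    by (intro perron_ratio_eqI) (simp, simp, use sg_pow4 in \<open>unfold perron_values lam_eq, algebra\<close>)
  show "Rbar31 = perron 1 / (lam * perron 3)"
    unfolding unf using pos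
    by (intro perron_ratio_eqI) (simp, simp, use sg_pow4 in \<open>unfold perron_values lam_eq, algebra\<close>)
  have "Rbar43 / 2 = ((2 * sg\<^sup>2 - 1) * sg\<^sup>2 - sg ^ 5) / (2 - sg)"
    unfolding unf unfolding sqrt5_eq gam_eq using pos by (simp add: field_simps)
  also have "\<dots> = perron 3 / (lam * perron 4)"
    using pos
    by (intro perron_ratio_eqI) (simp, simp, use sg_pow4 in \<open>unfold perron_values lam_eq, algebra\<close>)
  finally show "Rbar43 / 2 = perron 3 / (lam * perron 4)" .
  have "Rbar53 = (lam - 1) / lam" unfolding Rbar53_def lam_def[symmetric] using lam_pos by (simp add: field_simps)
  also have "\<dots> = perron 3 / (lam * perron 5)"
    using lam_pos
    by (intro perron_ratio_eqI) (simp, simp, use sg_pow4 in \<open>unfold perron_values lam_eq, algebra\<close>)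
  finally show "Rbar53 = perron 3 / (lam * perron 5)" .
qed

lemma Rbar_complements:
  "1 - Rbar11 = perron 2 / (lam * perron 1)"
  "1 - Rbar21 - Rbar23 - Rbar24 = perron 5 / (lam * perron 2)"
  "1 - Rbar31 = perron 2 / (lam * perron 3)"
  "1 - Rbar43 = perron 5 / (lam * perron 4)"
  "1 - Rbar53 = perron 5 / (lam * perron 5)"
proof -
  have pos: "lam * perron 1 \<noteq> 0" "lam * perron 2 \<noteq> 0" "lam * perron 3 \<noteq> 0" "lam * perron 4 \<noteq> 0" "lam * perron 5 \<noteq> 0"
    using lam_pos perron_pos[of 1] perron_pos[of 2] perron_pos[of 3] perron_pos[of 4] perron_pos[of 5]
    by simp_all
  have split: "1 - a / c = b / c" if "a + b = c" "c \<noteq> 0" for a b c :: real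
    using that by (simp add: field_simps)
  have "Rbar11 = 2 * (Rbar11 / 2)" "Rbar43 = 2 * (Rbar43 / 2)" by simp_all
  hence double: "Rbar11 = 2 * perron 1 / (lam * perron 1)" "Rbar43 = 2 * perron 3 / (lam * perron 4)"
    unfolding Rbar_values by simp_all
  show "1 - Rbar11 = perron 2 / (lam * perron 1)"
    unfolding double by (rule split[OF perron_equations(1) pos(1)])
  show "1 - Rbar31 = perron 2 / (lam * perron 3)"
    unfolding Rbar_values by (rule split[OF perron_equations(3) pos(3)])
  show "1 - Rbar43 = perron 5 / (lam * perron 4)"
    unfolding double by (rule split[OF perron_equations(4) pos(4)])
  show "1 - Rbar53 = perron 5 / (lam * perron 5)"
    unfolding Rbar_values by (rule split[OF perron_equations(5) pos(5)])
  have "1 - Rbar21 - Rbar23 - Rbar24 = 1 - (perron 1 + perron 3 + perron 4) / (lam * perron 2)"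
    unfolding Rbar_values by (simp add: add_divide_distrib)
  also have "\<dots> = perron 5 / (lam * perron 2)"
    by (rule split[OF perron_equations(2) pos(2)])
  finally show "1 - Rbar21 - Rbar23 - Rbar24 = perron 5 / (lam * perron 2)" .
qed

text \<open>
  The constants of the transition matrix are the ratios of eigenvector coordinates given by the weights
  of single letters.
\<close>

lemma R_mat_table:
  "R_mat k l =
    (if k \<in> {1,2,3} then
       (if l = 1 \<or> l = 2 then perron 1 / (lam * perron 1) else if l = 4 then perron 2 / (lam * perron 1) else 0)
     else if k \<in> {4,5} then
       (if l = 3 then perron 1 / (lam * perron 2) else if l = 6 then perron 3 / (lam * perron 2)
        else if l = 9 then perron 4 / (lam * perron 2) else if l = 10 then perron 5 / (lam * perron 2) else 0)
     else if k \<in> {6,7,8} then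
       (if l = 3 then perron 1 / (lam * perron 3) else if l = 5 then perron 2 / (lam * perron 3) else 0)
     else if k = 9 then
       (if l = 6 \<or> l = 7 then perron 3 / (lam * perron 4) else if l = 10 then perron 5 / (lam * perron 4) else 0)
     else if k \<in> {10,11} then
       (if l = 8 then perron 3 / (lam * perron 5) else if l = 11 then perron 5 / (lam * perron 5) else 0)
     else 0)"
  unfolding R_mat_def Rbar_complements unfolding Rbar_values ..

lemma transition_table:
  assumes "l \<in> {1..11}"
  shows "transition 1 (\<delta> l) =
      (if l = 1 \<or> l = 2 then perron 1 / (lam * perron 1) else if l = 4 then perron 2 / (lam * perron 1) else 0)"
    and "transition 2 (\<delta> l) =
      (if l = 3 then perron 1 / (lam * perron 2) else if l = 6 then perron 3 / (lam * perron 2)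
        else if l = 9 then perron 4 / (lam * perron 2) else if l = 10 then perron 5 / (lam * perron 2) else 0)"
    and "transition 3 (\<delta> l) =
      (if l = 3 then perron 1 / (lam * perron 3) else if l = 5 then perron 2 / (lam * perron 3) else 0)"
    and "transition 4 (\<delta> l) =
      (if l = 6 \<or> l = 7 then perron 3 / (lam * perron 4) else if l = 10 then perron 5 / (lam * perron 4) else 0)"
    and "transition 5 (\<delta> l) =
      (if l = 8 then perron 3 / (lam * perron 5) else if l = 11 then perron 5 / (lam * perron 5) else 0)"
  using assms unfolding states_cases transition_def sum_letters weight_letter step_values fst_conv snd_conv of_bool_eq
  by (elim disjE; simp add: \<delta>_values del: One_nat_def perron_0(2))+

lemma R_mat_eq_transition:
  assumes "k \<in> {1..11}" "l \<in> {1..11}"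
  shows "R_mat k l = transition (state_type k) (\<delta> l)"
  using assms(1) transition_table[OF assms(2)] unfolding R_mat_table states_cases
  by (elim disjE) (simp_all add: state_type_values del: One_nat_def perron_0(2))

lemma R_mat_zero: "(k, l) \<notin> R_nonzero_positions \<Longrightarrow> R_mat k l = 0"
  unfolding R_mat_def R_nonzero_positions_def by auto

lemma R_mat_perron:
  assumes "(k, l) \<in> R_nonzero_positions"
  shows "R_mat k l = perron (state_type l) / (lam * perron (state_type k))"
proof -
  consider "k \<in> {1,2,3}" "l \<in> {1,2,4}" | "k \<in> {4,5}" "l \<in> {3,6,9,10}" | "k \<in> {6,7,8}" "l \<in> {3,5}"
    | "k = 9" "l \<in> {6,7,10}" | "k \<in> {10,11}" "l \<in> {8,11}"
    using assms by (auto simp: R_nonzero_positions_def)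
  thus ?thesis
    unfolding R_mat_table insert_iff empty_iff simp_thms
    by cases (elim disjE; simp add: state_type_values del: One_nat_def perron_0(2))+
qed

lemma perron_state_type_pos: "k \<in> {1..11} \<Longrightarrow> 0 < perron (state_type k)"
  using perron_pos state_type_range by blast

lemma R_mat_nonneg: "0 \<le> R_mat k l"
  using R_mat_perron R_mat_zero perron_nonneg lam_pos by (cases "(k, l) \<in> R_nonzero_positions") simp_all

lemma R_mat_nonzero_iff:
  "k \<in> {1..11} \<Longrightarrow> l \<in> {1..11} \<Longrightarrow> R_mat k l \<noteq> 0 \<longleftrightarrow> (k, l) \<in> R_nonzero_positions"
  using R_mat_perron R_mat_zero perron_state_type_pos[of k] perron_state_type_pos[of l] lam_pos
  by (cases "(k, l) \<in> R_nonzero_positions") simp_all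

lemma sum_R_mat:
  assumes "k \<in> {1..11}"
  shows "(\<Sum>l\<in>{1..11}. R_mat k l * g (state_type l)) = average (Suc 0) g (state_type k)"
proof -
  have "(\<Sum>l\<in>{1..11}. R_mat k l * g (state_type l)) =
      (\<Sum>l\<in>{1..11}. transition (state_type k) (\<delta> l) * g (state_type l))"
    using R_mat_eq_transition[OF assms] by (intro sum.cong refl) simp
  thus ?thesis using sum_transition[OF state_type_range[OF assms]] by simp
qed

lemma stochastic_R_mat: "stochastic_matrix {1..11} R_mat"
  unfolding stochastic_matrix_def
proof (intro ballI conjI)
  fix k :: nat assume k: "k \<in> {1..11}"
  show "(\<Sum>l\<in>{1..11}. R_mat k l) = 1"
    using sum_R_mat[OF k, of "\<lambda>_. 1"] average_const[OF state_type_range[OF k]] by simp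
qed (rule R_mat_nonneg)

lemma \<pi>R_table:
  "\<pi>R 1 = sg\<^sup>2 / (4 * sqrt 5)" "\<pi>R 2 = sg\<^sup>2 / (4 * sqrt 5)"
  "\<pi>R 3 = (sg ^ 3 - (sg\<^sup>2 - 1)) / (4 * sqrt 5)" "\<pi>R 4 = (sg ^ 3 - (sg\<^sup>2 - 1)) / (4 * sqrt 5)"
  "\<pi>R 5 = (3 * (sg\<^sup>2 - 1) - sg) / (4 * sqrt 5)" "\<pi>R 6 = (2 * sg\<^sup>2 - 2 * sg) / (4 * sqrt 5)"
  "\<pi>R 7 = (2 * sg\<^sup>2 - 1 - sg ^ 3) / (4 * sqrt 5)" "\<pi>R 8 = ((2 * sg\<^sup>2 - 1) * sg ^ 3 - (sg\<^sup>2) ^ 3) / (4 * sqrt 5)"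
  "\<pi>R 9 = (2 * (sg\<^sup>2 - 1) - (sg ^ 3 - sg)) / (4 * sqrt 5)"
  "\<pi>R 10 = ((2 * sg\<^sup>2 - 1) * sg ^ 3 - (sg\<^sup>2) ^ 3) / (4 * sqrt 5)"
  "\<pi>R 11 = ((sg\<^sup>2) ^ 4 - 2 * sg ^ 5) / (4 * sqrt 5)"
  unfolding \<pi>R_def gam_powers unfolding gam_eq by (simp_all add: sqrt5_eq)

text \<open>
  The stationary probability of seeing type \<open>i\<close> followed by type \<open>j\<close> through one given letter
  that leads from \<open>i\<close> to \<open>j\<close>.
\<close>

definition flow :: "nat \<Rightarrow> nat \<Rightarrow> real" where
  "flow i j = perron_left i * perron j * (sg\<^sup>2 - sg) / (4 * sqrt 5)"

lemma flow_eq: "type_law i * (perron j / (lam * perron i)) = flow i j"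
proof (cases "i \<in> {1..5}")
  case True
  have "type_law i * (perron j / (lam * perron i)) = perron_left i * perron j * (1 / lam) / (4 * sqrt 5)"
    using perron_pos[OF True] by (simp add: type_law_def)
  thus ?thesis unfolding lam_inverse flow_def .
qed (auto simp: type_law_def flow_def perron_left_def)

lemma type_law_transition_table:
  assumes "l \<in> {1..11}"
  shows "type_law 1 * transition 1 (\<delta> l) = (if l = 1 \<or> l = 2 then flow 1 1 else if l = 4 then flow 1 2 else 0)"
    and "type_law 2 * transition 2 (\<delta> l) = (if l = 3 then flow 2 1 else if l = 6 then flow 2 3
      else if l = 9 then flow 2 4 else if l = 10 then flow 2 5 else 0)"
    and "type_law 3 * transition 3 (\<delta> l) = (if l = 3 then flow 3 1 else if l = 5 then flow 3 2 else 0)"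
    and "type_law 4 * transition 4 (\<delta> l) = (if l = 6 \<or> l = 7 then flow 4 3 else if l = 10 then flow 4 5 else 0)"
    and "type_law 5 * transition 5 (\<delta> l) = (if l = 8 then flow 5 3 else if l = 11 then flow 5 5 else 0)"
  unfolding transition_table[OF assms]
  by (simp_all only: if_distrib[of "\<lambda>c. _ * c"] flow_eq mult_zero_right)

lemma \<pi>R_flow:
  "flow 1 1 = \<pi>R 1"
  "flow 2 1 + flow 3 1 = \<pi>R 3"
  "flow 1 2 = \<pi>R 4"
  "flow 3 2 = \<pi>R 5"
  "flow 2 3 + flow 4 3 = \<pi>R 6"
  "flow 4 3 = \<pi>R 7"
  "flow 5 3 = \<pi>R 8"
  "flow 2 4 = \<pi>R 9"
  "flow 2 5 + flow 4 5 = \<pi>R 10"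
  "flow 5 5 = \<pi>R 11"
  "flow 1 1 = \<pi>R 2"
proof -
  have e1: "perron_left 1 * perron 1 * (sg\<^sup>2 - sg) =
      sg\<^sup>2"
    unfolding perron_values perron_left_values using sg_pow4 by algebra
  have e3: "perron_left 2 * perron 1 * (sg\<^sup>2 - sg) + perron_left 3 * perron 1 * (sg\<^sup>2 - sg) =
      sg ^ 3 - (sg\<^sup>2 - 1)"
    unfolding perron_values perron_left_values using sg_pow4 by algebra
  have e4: "perron_left 1 * perron 2 * (sg\<^sup>2 - sg) =
      sg ^ 3 - (sg\<^sup>2 - 1)"
    unfolding perron_values perron_left_values using sg_pow4 by algebra
  have e5: "perron_left 3 * perron 2 * (sg\<^sup>2 - sg) =
      3 * (sg\<^sup>2 - 1) - sg"
    unfolding perron_values perron_left_values using sg_pow4 by algebra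
  have e6: "perron_left 2 * perron 3 * (sg\<^sup>2 - sg) + perron_left 4 * perron 3 * (sg\<^sup>2 - sg) =
      2 * sg\<^sup>2 - 2 * sg"
    unfolding perron_values perron_left_values using sg_pow4 by algebra
  have e7: "perron_left 4 * perron 3 * (sg\<^sup>2 - sg) =
      2 * sg\<^sup>2 - 1 - sg ^ 3"
    unfolding perron_values perron_left_values using sg_pow4 by algebra
  have e8: "perron_left 5 * perron 3 * (sg\<^sup>2 - sg) =
      (2 * sg\<^sup>2 - 1) * sg ^ 3 - (sg\<^sup>2) ^ 3"
    unfolding perron_values perron_left_values by algebra
  have e9: "perron_left 2 * perron 4 * (sg\<^sup>2 - sg) =
      2 * (sg\<^sup>2 - 1) - (sg ^ 3 - sg)"
    unfolding perron_values perron_left_values using sg_pow4 by algebra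
  have e10: "perron_left 2 * perron 5 * (sg\<^sup>2 - sg) + perron_left 4 * perron 5 * (sg\<^sup>2 - sg) =
      (2 * sg\<^sup>2 - 1) * sg ^ 3 - (sg\<^sup>2) ^ 3"
    unfolding perron_values perron_left_values using sg_pow4 by algebra
  have e11: "perron_left 5 * perron 5 * (sg\<^sup>2 - sg) =
      (sg\<^sup>2) ^ 4 - 2 * sg ^ 5"
    unfolding perron_values perron_left_values using sg_pow4 by algebra
  show "flow 1 1 = \<pi>R 1"
    by (simp only: flow_def \<pi>R_table add_divide_distrib[symmetric] e1)
  show "flow 2 1 + flow 3 1 = \<pi>R 3"
    by (simp only: flow_def \<pi>R_table add_divide_distrib[symmetric] e3)
  show "flow 1 2 = \<pi>R 4"
    by (simp only: flow_def \<pi>R_table add_divide_distrib[symmetric] e4)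
  show "flow 3 2 = \<pi>R 5"
    by (simp only: flow_def \<pi>R_table add_divide_distrib[symmetric] e5)
  show "flow 2 3 + flow 4 3 = \<pi>R 6"
    by (simp only: flow_def \<pi>R_table add_divide_distrib[symmetric] e6)
  show "flow 4 3 = \<pi>R 7"
    by (simp only: flow_def \<pi>R_table add_divide_distrib[symmetric] e7)
  show "flow 5 3 = \<pi>R 8"
    by (simp only: flow_def \<pi>R_table add_divide_distrib[symmetric] e8)
  show "flow 2 4 = \<pi>R 9"
    by (simp only: flow_def \<pi>R_table add_divide_distrib[symmetric] e9)
  show "flow 2 5 + flow 4 5 = \<pi>R 10"
    by (simp only: flow_def \<pi>R_table add_divide_distrib[symmetric] e10)
  show "flow 5 5 = \<pi>R 11"
    by (simp only: flow_def \<pi>R_table add_divide_distrib[symmetric] e11)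
  show "flow 1 1 = \<pi>R 2"
    by (simp only: flow_def \<pi>R_table add_divide_distrib[symmetric] e1)
qed

lemma \<pi>R_eq_type_law_transition:
  assumes "k \<in> {1..11}"
  shows "\<pi>R k = (\<Sum>i\<in>{1..5}. type_law i * transition i (\<delta> k))"
  using assms \<pi>R_flow unfolding sum_types type_law_transition_table[OF assms] states_cases
  by (elim disjE) (simp_all del: One_nat_def)

lemma sum_state_laws:
  assumes "\<And>k. k \<in> {1..11} \<Longrightarrow> \<rho> k = (\<Sum>i\<in>{1..5}. r i * transition i (\<delta> k))"
  shows "(\<Sum>k\<in>{1..11}. \<rho> k * g (state_type k)) = (\<Sum>i\<in>{1..5}. r i * average (Suc 0) g i)"
proof -
  have "(\<Sum>k\<in>{1..11}. \<rho> k * g (state_type k)) =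
      (\<Sum>k\<in>{1..11}. \<Sum>i\<in>{1..5}. r i * (transition i (\<delta> k) * g (state_type k)))"
    by (intro sum.cong refl) (simp only: assms sum_distrib_right mult.assoc)
  also have "\<dots> = (\<Sum>i\<in>{1..5}. r i * (\<Sum>k\<in>{1..11}. transition i (\<delta> k) * g (state_type k)))"
    by (subst sum.swap) (simp only: sum_distrib_left)
  also have "\<dots> = (\<Sum>i\<in>{1..5}. r i * average (Suc 0) g i)"
    by (intro sum.cong refl) (simp only: sum_transition)
  finally show ?thesis .
qed

lemma sum_\<pi>R: "(\<Sum>k\<in>{1..11}. \<pi>R k * g (state_type k)) = (\<Sum>i\<in>{1..5}. type_law i * g i)"
  using sum_state_laws[OF \<pi>R_eq_type_law_transition] type_law_invariant[of "Suc 0" g] by simp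

lemma sum_law_R_mat:
  assumes "l \<in> {1..11}"
  shows "(\<Sum>k\<in>{1..11}. \<rho> k * R_mat k l) = (\<Sum>k\<in>{1..11}. \<rho> k * transition (state_type k) (\<delta> l))"
  using R_mat_eq_transition assms by (intro sum.cong refl) simp

lemma invariant_\<pi>R: "invariant_distribution {1..11} R_mat \<pi>R"
  unfolding invariant_distribution_def
proof (intro conjI ballI)
  fix k :: nat assume k: "k \<in> {1..11}"
  have "0 \<le> transition i y" for i y
    unfolding transition_def by (intro sum_nonneg mult_nonneg_nonneg weight_nonneg) simp
  thus "0 \<le> \<pi>R k"
    unfolding \<pi>R_eq_type_law_transition[OF k] by (intro sum_nonneg mult_nonneg_nonneg type_law_nonneg)
  show "(\<Sum>j\<in>{1..11}. \<pi>R j * R_mat j k) = \<pi>R k"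
    unfolding sum_law_R_mat[OF k] sum_\<pi>R[of "\<lambda>i. transition i (\<delta> k)"]
    using \<pi>R_eq_type_law_transition[OF k] by simp
next
  show "(\<Sum>k\<in>{1..11}. \<pi>R k) = 1"
    using sum_\<pi>R[of "\<lambda>_. 1"] sum_type_law by simp
qed

text \<open>
  An invariant \<open>\<rho>\<close> is determined by its law \<open>r\<close> of types, because the next state depends on the
  type only. The law \<open>r\<close> is invariant for the chain of types, and letting the number of steps tend to
  infinity replaces it by \<open>type_law\<close>.
\<close>

lemma invariant_distribution_unique:
  assumes \<rho>: "invariant_distribution {1..11} R_mat \<rho>" and l: "l \<in> {1..11}"
  shows "\<rho> l = \<pi>R l"
proof -
  define r where "r i = (\<Sum>k\<in>{1..11}. \<rho> k * of_bool (state_type k = i))" for i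
  have to_types: "(\<Sum>k\<in>{1..11}. \<rho> k * g (state_type k)) = (\<Sum>i\<in>{1..5}. r i * g i)" for g
  proof -
    have "(\<Sum>i\<in>{1..5}. r i * g i) = (\<Sum>k\<in>{1..11}. \<Sum>i\<in>{1..5}. \<rho> k * of_bool (state_type k = i) * g i)"
      unfolding r_def sum_distrib_right by (rule sum.swap)
    also have "\<dots> = (\<Sum>k\<in>{1..11}. \<rho> k * g (state_type k))"
    proof (intro sum.cong refl)
      fix k :: nat assume "k \<in> {1..11}"
      hence "state_type k \<in> {1..5}" by (rule state_type_range)
      thus "(\<Sum>i\<in>{1..5}. \<rho> k * of_bool (state_type k = i) * g i) = \<rho> k * g (state_type k)"
        unfolding types_cases sum_types by (elim disjE) simp_all
    qed
    finally show ?thesis by simp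
  qed
  have fixed: "\<rho> k = (\<Sum>i\<in>{1..5}. r i * transition i (\<delta> k))" if "k \<in> {1..11}" for k
  proof -
    have "(\<Sum>j\<in>{1..11}. \<rho> j * R_mat j k) = \<rho> k"
      using \<rho> that unfolding invariant_distribution_def by blast
    thus ?thesis
      unfolding sum_law_R_mat[OF that] to_types[of "\<lambda>i. transition i (\<delta> k)"] by simp
  qed
  have one: "(\<Sum>i\<in>{1..5}. r i * average (Suc 0) g i) = (\<Sum>i\<in>{1..5}. r i * g i)" for g
    using sum_state_laws[OF fixed] to_types by simp
  have iter: "(\<Sum>i\<in>{1..5}. r i * average n g i) = (\<Sum>i\<in>{1..5}. r i * g i)" for n g
  proof (induction n)
    case 0
    show ?case by (intro sum.cong refl) simp
  next
    case (Suc n)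
    have "(\<Sum>i\<in>{1..5}. r i * average (Suc n) g i) = (\<Sum>i\<in>{1..5}. r i * average (Suc 0) (average n g) i)"
      using average_add[of _ "Suc 0" n g] by (intro sum.cong refl) simp
    thus ?case using one Suc.IH by simp
  qed
  have total: "(\<Sum>i\<in>{1..5}. r i) = 1"
    using to_types[of "\<lambda>_. 1"] \<rho> by (simp add: invariant_distribution_def)
  let ?g = "\<lambda>i. transition i (\<delta> l)"
  have "(\<lambda>n. \<Sum>i\<in>{1..5}. r i * average n ?g i) \<longlonglongrightarrow> (\<Sum>i\<in>{1..5}. r i * (\<Sum>j\<in>{1..5}. type_law j * ?g j))"
    by (intro tendsto_sum tendsto_mult_left average_tendsto)
  hence "(\<Sum>i\<in>{1..5}. r i * ?g i) = (\<Sum>i\<in>{1..5}. r i * (\<Sum>j\<in>{1..5}. type_law j * ?g j))"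
    unfolding iter using LIMSEQ_const_iff by blast
  also have "\<dots> = (\<Sum>j\<in>{1..5}. type_law j * ?g j)"
    unfolding sum_distrib_right[symmetric] total by simp
  finally show ?thesis using fixed[OF l] \<pi>R_eq_type_law_transition[OF l] by simp
qed

text \<open>
  Along positive entries \<open>ln (R_mat k l)\<close> is a difference of \<open>ln (perron _)\<close> at the types of \<open>l\<close> and
  \<open>k\<close>, minus \<open>ln lam\<close>; the differences have stationary mean 0.
\<close>

lemma entropy_R_mat: "- (\<Sum>k=1..11. \<Sum>l=1..11. \<pi>R k * R_mat k l * ln (R_mat k l)) = ln lam"
proof -
  let ?g = "\<lambda>i. ln (perron i)"
  have "(\<Sum>l=1..11. \<pi>R k * R_mat k l * ln (R_mat k l)) =
      \<pi>R k * (average (Suc 0) ?g (state_type k) - (ln lam + ?g (state_type k)))" if k: "k \<in> {1..11}" for k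
  proof -
    have "\<pi>R k * R_mat k l * ln (R_mat k l) =
        \<pi>R k * (R_mat k l * (?g (state_type l) - (ln lam + ?g (state_type k))))" if l: "l \<in> {1..11}" for l
    proof (cases "(k, l) \<in> R_nonzero_positions")
      case True
      thus ?thesis
        using perron_state_type_pos[OF k] perron_state_type_pos[OF l] lam_pos
        by (simp add: R_mat_perron ln_div ln_mult)
    next
      case False
      thus ?thesis by (simp add: R_mat_zero)
    qed
    hence "(\<Sum>l=1..11. \<pi>R k * R_mat k l * ln (R_mat k l)) =
        \<pi>R k * (\<Sum>l=1..11. R_mat k l * (?g (state_type l) - (ln lam + ?g (state_type k))))"
      unfolding sum_distrib_left by (rule sum.cong[OF refl])
    also have "(\<Sum>l=1..11. R_mat k l * (?g (state_type l) - (ln lam + ?g (state_type k)))) =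
        average (Suc 0) ?g (state_type k) - (ln lam + ?g (state_type k))"
      using sum_R_mat[OF k, of "\<lambda>i. ?g i - (ln lam + ?g (state_type k))"]
        average_const[OF state_type_range[OF k]]
      by (simp add: average_diff)
    finally show ?thesis .
  qed
  hence "(\<Sum>k=1..11. \<Sum>l=1..11. \<pi>R k * R_mat k l * ln (R_mat k l)) =
      (\<Sum>k\<in>{1..11}. \<pi>R k * (\<lambda>i. average (Suc 0) ?g i - (ln lam + ?g i)) (state_type k))"
    by (rule sum.cong[OF refl])
  also have "\<dots> = (\<Sum>i\<in>{1..5}. type_law i * (average (Suc 0) ?g i - (ln lam + ?g i)))"
    by (rule sum_\<pi>R)
  also have "\<dots> = (\<Sum>i\<in>{1..5}. type_law i * average (Suc 0) ?g i) -
      ((\<Sum>i\<in>{1..5}. type_law i) * ln lam + (\<Sum>i\<in>{1..5}. type_law i * ?g i))"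
    unfolding sum_distrib_right by (simp only: right_diff_distrib distrib_left sum_subtractf sum.distrib)
  also have "\<dots> = - ln lam"
    unfolding type_law_invariant sum_type_law by simp
  finally show ?thesis by simp
qed

lemma (in helix_ust) stationary_markov_chain_helix_process:
  "stationary_markov_chain M (helix_process T) {1..11} \<delta> R_mat"
  unfolding stationary_markov_chain_def
proof (intro conjI allI)
  show "prob_space M" by (rule prob_space_axioms)
  show "finite {1..11::nat}" by simp
  show "inj_on \<delta> {1..11}" by (rule inj_on_\<delta>)
  show "stochastic_matrix {1..11} R_mat" by (rule stochastic_R_mat)
  show "helix_process T n \<in> measurable M (count_space UNIV)" for n by measurable
  show "stationary_process M (helix_process T)" by (rule stationary)
  show "AE \<omega> in M. helix_process T n \<omega> \<in> \<delta> ` {1..11}" for n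
    using AE_regular
  proof eventually_elim
    case (elim \<omega>)
    have "ctype n \<omega> = step (ctype (n - 1) \<omega>) (letter (T \<omega>) n)"
      using regular_connectivity_type(3)[OF elim, of "n - 1" "Suc 0"] by simp
    moreover from this have "step (ctype (n - 1) \<omega>) (letter (T \<omega>) n) \<noteq> 0"
      using regular_connectivity_type(1)[OF elim, of n] by simp
    ultimately show ?case
      using live_step_state by (fastforce simp: helix_process_def letter_def)
  qed
  show "markov_property M (helix_process T) {1..11} \<delta> R_mat"
    unfolding markov_property_def
  proof (intro allI ballI impI)
    fix n :: int and m :: nat and x :: "int \<Rightarrow> nat \<times> nat \<times> nat" and k l :: nat
    assume kl: "k \<in> {1..11}" "l \<in> {1..11}" and x: "x n = \<delta> k"
      and pos: "0 < \<P>(\<omega> in M. \<forall>j\<in>{n - int m..n}. helix_process T j \<omega> = x j)"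
    have "snd (snd (x n)) = state_type k" by (simp add: x state_type_def)
    from prob_path_extend[of x n, OF this, where y = "\<delta> l" and k = m] pos
    show "\<P>(\<omega> in M. helix_process T (n + 1) \<omega> = \<delta> l \<bar> \<forall>j\<in>{n - int m..n}. helix_process T j \<omega> = x j) = R_mat k l"
      unfolding cond_prob_def R_mat_eq_transition[OF kl] by simp
  qed
qed

theorem theorem6p1:
  fixes M :: "'w measure" and T :: "'w \<Rightarrow> int set set"
  assumes "uniform_random_spanning_tree M T"
  shows "stationary_markov_chain M (helix_process T) {1..11} \<delta> R_mat
    \<and> (\<forall>k\<in>{1..11}. \<forall>l\<in>{1..11}. R_mat k l \<noteq> 0 \<longleftrightarrow> (k, l) \<in> R_nonzero_positions)
    \<and> (\<forall>n. \<forall>k\<in>{1..11}. \<P>(\<omega> in M. helix_process T n \<omega> = \<delta> k) = \<pi>R k)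
    \<and> invariant_distribution {1..11} R_mat \<pi>R
    \<and> (\<forall>\<rho>. invariant_distribution {1..11} R_mat \<rho> \<longrightarrow> (\<forall>k\<in>{1..11}. \<rho> k = \<pi>R k))
    \<and> - (\<Sum>k=1..11. \<Sum>l=1..11. \<pi>R k * R_mat k l * ln (R_mat k l)) = ln (gam + sqrt gam)"
proof -
  have "prob_space M" using assms by (simp add: uniform_random_spanning_tree_def)
  then interpret helix_ust M T
    using assms by (intro helix_ust.intro helix_ust_axioms.intro)
  show ?thesis
  proof (intro conjI allI ballI impI)
    show "stationary_markov_chain M (helix_process T) {1..11} \<delta> R_mat"
      by (rule stationary_markov_chain_helix_process)
    show "R_mat k l \<noteq> 0 \<longleftrightarrow> (k, l) \<in> R_nonzero_positions" if "k \<in> {1..11}" "l \<in> {1..11}" for k l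
      using that by (rule R_mat_nonzero_iff)
    show "\<P>(\<omega> in M. helix_process T n \<omega> = \<delta> k) = \<pi>R k" if "k \<in> {1..11}" for n k
      unfolding prob_state \<pi>R_eq_type_law_transition[OF that] ..
    show "invariant_distribution {1..11} R_mat \<pi>R" by (rule invariant_\<pi>R)
    show "\<rho> k = \<pi>R k" if "invariant_distribution {1..11} R_mat \<rho>" "k \<in> {1..11}" for \<rho> k
      using that by (rule invariant_distribution_unique)
    show "- (\<Sum>k=1..11. \<Sum>l=1..11. \<pi>R k * R_mat k l * ln (R_mat k l)) = ln (gam + sqrt gam)"
      using entropy_R_mat unfolding lam_def .
  qed
qed

end
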